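(* Let $p$ be a prime number, let $\mathbf{G}=SL_2(\bar{\mathbb{F}}_p)$ (regarded as an abstract group), let $\mathbf{T}\subset\mathbf{G}$ be the subgroup of diagonal matrices, and let $\Bbbk$ be an algebraically closed field of characteristic not equal to $2$ and $p$. Then, up to isomorphism, the simple $\Bbbk\mathbf{G}$-modules admitting $\mathbf{T}$-stable lines are precisely the trivial module $\Bbbk_{\mathrm{tr}}$, the Steinberg module $\mathrm{St}$, and the modules $\mathbb{M}(\theta)$ for all nontrivial characters $\theta\in\widehat{\mathbf{T}}$.
   Context: The characteristic of $\Bbbk$ may be $0$ or a prime. Modules are modules over the abstract group algebra $\Bbbk\mathbf{G}$, possibly infinite-dimensional. $\widehat{\mathbf{T}}$ is the group of all group homomorphisms $\theta:\mathbf{T}\to\Bbbk^*$ (abstract characters, no algebraicity required). For a $\Bbbk\mathbf{G}$-module $M$ and $\theta\in\widehat{\mathbf{T}}$ put $M_\theta=\{m\in M\mid tm=\theta(t)m\ \ \forall t\in\mathbf{T}\}$ and $M^{\mathbf{T}}=\bigoplus_{\theta\in\widehat{\mathbf{T}}}M_\theta$. The module $M$ is said to admit $\mathbf{T}$-stable lines if $M^{\mathbf{T}}\neq 0$. Let $\mathbf{U}$ be the group of upper unitriangular matrices in $\mathbf{G}$, and $\mathbf{B}=\mathbf{T}\mathbf{U}$ the group of upper triangular matrices. Each $\theta\in\widehat{\mathbf{T}}$ is regarded as a character of $\mathbf{B}$ via the natural homomorphism $\mathbf{B}\to\mathbf{T}$ with kernel $\mathbf{U}$; $\Bbbk_\theta$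 is the corresponding one-dimensional $\mathbf{B}$-module, and $\mathbb{M}(\theta)=\Bbbk\mathbf{G}\otimes_{\Bbbk\mathbf{B}}\Bbbk_\theta$. Let $\mathrm{tr}$ denote the trivial character, fix a nonzero element $\mathbf{1}_{\mathrm{tr}}\in\Bbbk_{\mathrm{tr}}$ and write $x\mathbf{1}_{\mathrm{tr}}=x\otimes\mathbf{1}_{\mathrm{tr}}\in\mathbb{M}(\mathrm{tr})$ for $x\in\mathbf{G}$. With $s=\begin{pmatrix}0&1\\-1&0\end{pmatrix}$ and $\eta_s=(1-s)\mathbf{1}_{\mathrm{tr}}$, the Steinberg module is the submodule $\mathrm{St}=\Bbbk\mathbf{U}\,\eta_s\subset\mathbb{M}(\mathrm{tr})$. In the theorem, $\Bbbk_{\mathrm{tr}}$ denotes the one-dimensional trivial $\Bbbk\mathbf{G}$-module. *)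

theory Defs
  imports
    "HOL-Analysis.Analysis"
    "HOL-Algebra.Algebra"
    "HOL-Algebra.Algebraic_Closure_Type"
    "Berlekamp_Zassenhaus.Finite_Field"
begin

unbundle no fps_syntax

section \<open>Modules over a not necessarily commutative ring\<close>

text \<open>
  The module locale of HOL-Algebra requires a commutative ring of scalars. The following is the same
  list of axioms over an arbitrary ring, for the same record type.
\<close>

locale left_module = R?: Ring.ring R + M?: abelian_group M
    for R :: "('r, 'x) ring_scheme" (structure) and M :: "('r, 'm, 'y) module_scheme" (structure) +
  assumes smult_closed [simp, intro]:
      "\<lbrakk>a \<in> carrier R; x \<in> carrier M\<rbrakk> \<Longrightarrow> a \<odot>\<^bsub>M\<^esub> x \<in> carrier M"
    and smult_l_distr:
      "\<lbrakk>a \<in> carrier R; b \<in> carrier R; x \<in> carrier M\<rbrakk> \<Longrightarrow>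
        (a \<oplus> b) \<odot>\<^bsub>M\<^esub> x = a \<odot>\<^bsub>M\<^esub> x \<oplus>\<^bsub>M\<^esub> b \<odot>\<^bsub>M\<^esub> x"
    and smult_r_distr:
      "\<lbrakk>a \<in> carrier R; x \<in> carrier M; y \<in> carrier M\<rbrakk> \<Longrightarrow>
        a \<odot>\<^bsub>M\<^esub> (x \<oplus>\<^bsub>M\<^esub> y) = a \<odot>\<^bsub>M\<^esub> x \<oplus>\<^bsub>M\<^esub> a \<odot>\<^bsub>M\<^esub> y"
    and smult_assoc1:
      "\<lbrakk>a \<in> carrier R; b \<in> carrier R; x \<in> carrier M\<rbrakk> \<Longrightarrow>
        (a \<otimes> b) \<odot>\<^bsub>M\<^esub> x = a \<odot>\<^bsub>M\<^esub> (b \<odot>\<^bsub>M\<^esub> x)"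
    and smult_one [simp]:
      "x \<in> carrier M \<Longrightarrow> \<one> \<odot>\<^bsub>M\<^esub> x = x"

definition simple_module :: "('r, 'x) ring_scheme \<Rightarrow> ('r, 'm) module \<Rightarrow> bool" where
  "simple_module R M \<longleftrightarrow>
     left_module R M \<and> carrier M \<noteq> {\<zero>\<^bsub>M\<^esub>} \<and>
     (\<forall>H. submodule H R M \<longrightarrow> H = {\<zero>\<^bsub>M\<^esub>} \<or> H = carrier M)"

definition module_isomorphic ::
    "('r, 'x) ring_scheme \<Rightarrow> ('r, 'm) module \<Rightarrow> ('r, 'n) module \<Rightarrow> bool" where
  "module_isomorphic R M N \<longleftrightarrow>
     (\<exists>h \<in> iso (add_monoid M) (add_monoid N).
        \<forall>a \<in> carrier R. \<forall>x \<in> carrier M. h (a \<odot>\<^bsub>M\<^esub> x) = a \<odot>\<^bsub>N\<^esub> h x)"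


section \<open>Extension of scalars\<close>

text \<open>
  For a ring \<open>S\<close>, a subring \<open>R\<close> and a left \<open>R\<close>-module \<open>N\<close>, the tensor product of \<open>S\<close> and \<open>N\<close> over \<open>R\<close>
  is the quotient of the free abelian group on \<open>S \<times> N\<close> by the subgroup generated by the usual
  relations; \<open>S\<close> acts on it by multiplication on the first factor. The fields \<open>mult\<close> and \<open>one\<close>, which
  the record type for modules inherits from that for rings, carry no information.
\<close>

definition tensor_relations ::
    "('r, 'x) ring_scheme \<Rightarrow> ('r, 'y) ring_scheme \<Rightarrow> ('r, 'n) module \<Rightarrow> ('r \<times> 'n \<Rightarrow>\<^sub>0 int) set" where
  "tensor_relations S R N =
     {frag_of (a \<oplus>\<^bsub>S\<^esub> b, n) - frag_of (a, n) - frag_of (b, n) | a b n.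
        a \<in> carrier S \<and> b \<in> carrier S \<and> n \<in> carrier N} \<union>
     {frag_of (a, n \<oplus>\<^bsub>N\<^esub> m) - frag_of (a, n) - frag_of (a, m) | a n m.
        a \<in> carrier S \<and> n \<in> carrier N \<and> m \<in> carrier N} \<union>
     {frag_of (a \<otimes>\<^bsub>S\<^esub> r, n) - frag_of (a, r \<odot>\<^bsub>N\<^esub> n) | a r n.
        a \<in> carrier S \<and> r \<in> carrier R \<and> n \<in> carrier N}"

definition tensor_null ::
    "('r, 'x) ring_scheme \<Rightarrow> ('r, 'y) ring_scheme \<Rightarrow> ('r, 'n) module \<Rightarrow> ('r \<times> 'n \<Rightarrow>\<^sub>0 int) set" where
  "tensor_null S R N =
     generate (free_Abelian_group (carrier S \<times> carrier N)) (tensor_relations S R N)"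

definition tensor_class ::
    "('r, 'x) ring_scheme \<Rightarrow> ('r, 'y) ring_scheme \<Rightarrow> ('r, 'n) module \<Rightarrow>
     ('r \<times> 'n \<Rightarrow>\<^sub>0 int) \<Rightarrow> ('r \<times> 'n \<Rightarrow>\<^sub>0 int) set" where
  "tensor_class S R N u =
     tensor_null S R N #>\<^bsub>free_Abelian_group (carrier S \<times> carrier N)\<^esub> u"

definition pure_tensor ::
    "('r, 'x) ring_scheme \<Rightarrow> ('r, 'y) ring_scheme \<Rightarrow> ('r, 'n) module \<Rightarrow>
     'r \<Rightarrow> 'n \<Rightarrow> ('r \<times> 'n \<Rightarrow>\<^sub>0 int) set" where
  "pure_tensor S R N a n = tensor_class S R N (frag_of (a, n))"

definition extend_scalars ::
    "('r, 'x) ring_scheme \<Rightarrow> ('r, 'y) ring_scheme \<Rightarrow> ('r, 'n) module \<Rightarrow>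
     ('r, ('r \<times> 'n \<Rightarrow>\<^sub>0 int) set) module" where
  "extend_scalars S R N =
     (let F = free_Abelian_group (carrier S \<times> carrier N); K = tensor_null S R N in
      \<lparr>carrier = rcosets\<^bsub>F\<^esub> K,
       monoid.mult = undefined,
       one = undefined,
       ring.zero = K,
       ring.add = set_mult F,
       smult = (\<lambda>a C. \<Union>u\<in>C.
         tensor_class S R N (frag_extend (\<lambda>(b, n). frag_of (a \<otimes>\<^bsub>S\<^esub> b, n)) u))\<rparr>)"


section \<open>Group algebras and one-dimensional modules\<close>

definition group_algebra :: "('g, 'x) monoid_scheme \<Rightarrow> ('g \<Rightarrow>\<^sub>0 'k::field) ring" where
  "group_algebra G =
     \<lparr>carrier = {a. Poly_Mapping.keys a \<subseteq> carrier G},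
      monoid.mult = (\<lambda>a b. \<Sum>x\<in>Poly_Mapping.keys a. \<Sum>y\<in>Poly_Mapping.keys b.
        Poly_Mapping.single (x \<otimes>\<^bsub>G\<^esub> y)
          (Poly_Mapping.lookup a x * Poly_Mapping.lookup b y)),
      one = Poly_Mapping.single \<one>\<^bsub>G\<^esub> 1,
      ring.zero = 0,
      ring.add = (+)\<rparr>"

text \<open>
  Characters are normalised to be \<^term>\<open>undefined\<close> outside the group, so that two characters with the
  same values are equal.
\<close>

definition linear_characters :: "('g, 'x) monoid_scheme \<Rightarrow> ('g \<Rightarrow> 'k::field) set" where
  "linear_characters G = hom G (mult_of ring_of_type_algebra) \<inter> extensional (carrier G)"

text \<open>The field \<open>'k\<close>, on which the group element \<open>x\<close> acts as multiplication by \<open>\<psi> x\<close>.\<close>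

definition one_dim_module :: "('g \<Rightarrow> 'k) \<Rightarrow> ('g \<Rightarrow>\<^sub>0 'k::field, 'k) module" where
  "one_dim_module \<psi> =
     \<lparr>carrier = UNIV,
      monoid.mult = (*),
      one = 1,
      ring.zero = 0,
      ring.add = (+),
      smult = (\<lambda>a c. (\<Sum>x\<in>Poly_Mapping.keys a. Poly_Mapping.lookup a x * \<psi> x) * c)\<rparr>"


section \<open>The group \<open>SL\<^sub>2\<close> and its modules\<close>

definition SL2 :: "('f::field ^ 2 ^ 2) monoid" where
  "SL2 =
     \<lparr>carrier = {A. Determinants.det A = 1},
      monoid.mult = (**),
      one = Finite_Cartesian_Product.mat 1\<rparr>"

definition torus :: "('f::field ^ 2 ^ 2) monoid" where
  "torus = SL2\<lparr>carrier := {A \<in> carrier SL2. A $ 1 $ 2 = 0 \<and> A $ 2 $ 1 = 0}\<rparr>"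

definition unipotent :: "('f::field ^ 2 ^ 2) monoid" where
  "unipotent = SL2\<lparr>carrier := {A \<in> carrier SL2. A $ 1 $ 1 = 1 \<and> A $ 2 $ 2 = 1 \<and> A $ 2 $ 1 = 0}\<rparr>"

definition borel_subgroup :: "('f::field ^ 2 ^ 2) monoid" where
  "borel_subgroup = SL2\<lparr>carrier := {A \<in> carrier SL2. A $ 2 $ 1 = 0}\<rparr>"

text \<open>On \<^const>\<open>borel_subgroup\<close> this is the homomorphism onto \<^const>\<open>torus\<close> with kernel \<^const>\<open>unipotent\<close>.\<close>

definition torus_part :: "'f::field ^ 2 ^ 2 \<Rightarrow> 'f ^ 2 ^ 2" where
  "torus_part A = (\<chi> i j. if i = j then A $ i $ j else 0)"

definition weyl_s :: "'f::field ^ 2 ^ 2" where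
  "weyl_s = vector [vector [0, 1], vector [- 1, 0]]"

definition trivial_character :: "'f::field ^ 2 ^ 2 \<Rightarrow> 'k::field" where
  "trivial_character = (\<lambda>t \<in> carrier torus. 1)"

definition trivial_module :: "('f::field ^ 2 ^ 2 \<Rightarrow>\<^sub>0 'k::field, 'k) module" where
  "trivial_module = one_dim_module (\<lambda>_. 1)"

definition borel_module :: "('f::field ^ 2 ^ 2 \<Rightarrow> 'k) \<Rightarrow> ('f ^ 2 ^ 2 \<Rightarrow>\<^sub>0 'k::field, 'k) module" where
  "borel_module \<theta> = one_dim_module (\<lambda>b. \<theta> (torus_part b))"

type_synonym ('f, 'k) induced_carrier = "(('f ^ 2 ^ 2 \<Rightarrow>\<^sub>0 'k) \<times> 'k \<Rightarrow>\<^sub>0 int) set"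

definition induced_module ::
    "('f::field ^ 2 ^ 2 \<Rightarrow> 'k::field) \<Rightarrow>
     ('f ^ 2 ^ 2 \<Rightarrow>\<^sub>0 'k, ('f, 'k) induced_carrier) module" where
  "induced_module \<theta> =
     extend_scalars (group_algebra SL2) (group_algebra borel_subgroup) (borel_module \<theta>)"

text \<open>
  The fixed nonzero element of the one-dimensional trivial module is the unit of the field, regarded
  in the induced module as \<open>1 \<otimes> 1\<close>.
\<close>

definition one_tr :: "('f::field, 'k::field) induced_carrier" where
  "one_tr =
     pure_tensor (group_algebra SL2) (group_algebra borel_subgroup) (borel_module trivial_character)
       \<one>\<^bsub>group_algebra SL2\<^esub> 1"

definition eta_s :: "('f::field, 'k::field) induced_carrier" where
  "eta_s =
     (\<one>\<^bsub>group_algebra SL2\<^esub> - Poly_Mapping.single weyl_s 1)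
       \<odot>\<^bsub>induced_module trivial_character\<^esub> one_tr"

definition steinberg_module ::
    "('f::field ^ 2 ^ 2 \<Rightarrow>\<^sub>0 'k::field, ('f, 'k) induced_carrier) module" where
  "steinberg_module =
     (induced_module trivial_character)
       \<lparr>carrier := {a \<odot>\<^bsub>induced_module trivial_character\<^esub> eta_s | a.
          a \<in> carrier (group_algebra unipotent)}\<rparr>"


type_synonym 'p Fp_closure = "'p mod_ring alg_closure"


section \<open>Weight spaces for the torus\<close>

definition weight_space ::
    "('f::field ^ 2 ^ 2 \<Rightarrow>\<^sub>0 'k::field, 'm) module \<Rightarrow> ('f ^ 2 ^ 2 \<Rightarrow> 'k) \<Rightarrow> 'm set" where
  "weight_space M \<theta> =
     {m \<in> carrier M. \<forall>t \<in> carrier torus.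
        Poly_Mapping.single t 1 \<odot>\<^bsub>M\<^esub> m = Poly_Mapping.single \<one>\<^bsub>SL2\<^esub> (\<theta> t) \<odot>\<^bsub>M\<^esub> m}"

text \<open>The sum of all weight spaces, as a subset of the module; the sum is automatically direct.\<close>

definition torus_weight_sum ::
    "('f::field ^ 2 ^ 2 \<Rightarrow>\<^sub>0 'k::field, 'm) module \<Rightarrow> 'm set" where
  "torus_weight_sum M =
     {\<Oplus>\<^bsub>M\<^esub>\<theta>\<in>F. m \<theta> | F m.
        finite F \<and> F \<subseteq> linear_characters torus \<and> m \<in> (\<Pi> \<theta>\<in>F. weight_space M \<theta>)}"

definition admits_T_stable_lines ::
    "('f::field ^ 2 ^ 2 \<Rightarrow>\<^sub>0 'k::field, 'm) module \<Rightarrow> bool" where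
  "admits_T_stable_lines M \<longleftrightarrow> torus_weight_sum M \<noteq> {\<zero>\<^bsub>M\<^esub>}"

end

theory Submission
  imports Defs
begin

no_notation fps_nth (infixl "$" 75)

text \<open>
  Let \<open>m\<close> be an eigenvector of the torus in a simple module \<open>M\<close>, with character \<open>\<theta>\<close>. The group algebra of
  the unipotent group \<open>U\<close> is a union of group algebras of finite groups whose orders are invertible, and
  since the torus acts transitively on the nonzero elements of the field, an ideal of it that is stable
  under the torus is \<open>0\<close>, the augmentation ideal or the whole ring. Hence no sum over a finite subfield in \<open>U\<close>
  kills \<open>m\<close>, so \<open>m\<close> survives in the \<open>U\<close>-coinvariants of \<open>M\<close>. By the Bruhat decomposition these are
  generated over the torus by three elements, two of them being eigenvectors, and a determinant trick as in
  Nakayama's lemma yields a nonzero linear form on \<open>M\<close> on which the Borel subgroup acts through \<open>\<theta>\<close>. It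
  embeds \<open>M\<close> into functions on the projective line (sections of a line bundle), where the torus eigenvectors
  of weight \<open>\<theta>\<close> are determined by three values: at the two fixed points and on the open orbit. Comparing
  these values, one finds in \<open>M\<close> either a function of finite support, a \<open>B\<close>-stable line, or only constants.
\<close>

section \<open>Finitely supported functions\<close>

text \<open>A torus eigenvector need not be fixed by \<open>U\<close>, and nonzero
  \<open>U\<close>-fixed vectors need not exist: the Steinberg module is a copy of the group algebra
  of the infinite group \<open>U\<close>. Linear forms avoid this, since a form on the coinvariants
  is \<open>U\<close>-invariant by construction, and Frobenius reciprocity turns a form with a
  \<open>B\<close>-character into a map of the module into functions. A simple module is handled as
  the quotient of the group algebra by a maximal left ideal; if that ideal is the largest one inside
  the kernel of a form, comparing modules means comparing two forms after right multiplication by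
  suitable elements. The form is first translated by \<open>weyl\<close>: at
  \<open>weyl + upper y + weyl\<close> the torus acts on the two sides with opposite weights, so the
  value does not depend on the nonzero \<open>y\<close>, whatever the character. A difference of two
  \<open>U\<close>-translates of this function is then supported on finitely many points of the big
  cell, as in the induced module. Square roots in the field matter because \<open>diag t\<close>
  dilates \<open>U\<close> by the square of \<open>t\<close>.\<close>

abbreviation "single \<equiv> Poly_Mapping.single"

abbreviation "lookup \<equiv> Poly_Mapping.lookup"

abbreviation "keys \<equiv> Poly_Mapping.keys"

abbreviation scalar :: "'b \<Rightarrow> 'a::zero \<Rightarrow>\<^sub>0 'b::zero" where
  "scalar \<equiv> single 0"

abbreviation point :: "'a \<Rightarrow> 'a \<Rightarrow>\<^sub>0 'b::zero_neq_one" where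
  "point x \<equiv> single x 1"

lemma poly_mapping_eq_sum_single:
  assumes "finite S" "keys a \<subseteq> S"
  shows "a = (\<Sum>x\<in>S. single x (lookup a x))"
proof (rule poly_mapping_eqI)
  fix k
  have "lookup (\<Sum>x\<in>S. single x (lookup a x)) k =
    (\<Sum>x\<in>S. if x = k then lookup a x else 0)"
    unfolding lookup_sum by (intro sum.cong) (auto simp: lookup_single when_def)
  also have "\<dots> = lookup a k"
    using assms by (auto simp: sum.delta in_keys_iff)
  finally show "lookup a k =
    lookup (\<Sum>x\<in>S. single x (lookup a x)) k" ..
qed

text \<open>Additive identities need checking only on multiples of single group elements; the zero
  function is absorbed as \<open>single x 0\<close>.\<close>

lemma single_add_induct [case_names single add]:
  assumes "\<And>x c. P (single x c)" "\<And>a b. P a \<Longrightarrow> P b \<Longrightarrow> P (a + b)"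
  shows "P (a :: 'a \<Rightarrow>\<^sub>0 'b::comm_monoid_add)"
proof -
  have "P 0" using assms(1)[of undefined 0] by simp
  have "P (\<Sum>x\<in>S. single x (lookup a x))" if "finite S" for S
    using that by induction (auto simp: \<open>P 0\<close> assms)
  from this[OF finite_keys, of a] show ?thesis
    using poly_mapping_eq_sum_single[OF finite_keys order_refl, of a] by simp
qed

text \<open>The pushforward along \<open>h\<close>. For additive \<open>h\<close> it is the induced
  homomorphism of group algebras (\<open>push_mult\<close>), which is how \<open>upper\<close>,
  \<open>diag\<close> and \<open>matrix_of\<close> are extended linearly.\<close>

definition push :: "('a \<Rightarrow> 'b) \<Rightarrow> ('a \<Rightarrow>\<^sub>0 'c) \<Rightarrow> ('b \<Rightarrow>\<^sub>0 'c::comm_monoid_add)" where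
  "push h a = (\<Sum>x\<in>keys a. single (h x) (lookup a x))"

lemma push_eq_sum:
  assumes "finite S" "keys a \<subseteq> S"
  shows "push h a = (\<Sum>x\<in>S. single (h x) (lookup a x))"
  unfolding push_def using assms by (intro sum.mono_neutral_left) (auto simp: in_keys_iff)

lemma push_zero [simp]: "push h 0 = 0"
  by (simp add: push_def)

lemma push_single [simp]: "push h (single x c) = single (h x) c"
  by (subst push_eq_sum[where S = "{x}"]) auto

lemma push_one: "h 0 = 0 \<Longrightarrow> push h 1 = (1 :: 'b::zero \<Rightarrow>\<^sub>0 'c::semiring_1)"
  unfolding single_one[symmetric] push_single by simp

lemma push_add: "push h (a + b) = push h a + push h b"
proof -
  let ?S = "keys a \<union> keys b"
  show ?thesis
    using Poly_Mapping.keys_add[of a b]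
    by (subst (1 2 3) push_eq_sum[where S = ?S])
      (auto simp: lookup_add single_add sum.distrib)
qed

lemma push_uminus: "push h (- a) = - push h (a :: 'a \<Rightarrow>\<^sub>0 'b::ab_group_add)"
  using push_add[of h a "-a"] by (simp add: eq_neg_iff_add_eq_0 add.commute)

lemma push_diff: "push h (a - b) = push h a - push h (b :: 'a \<Rightarrow>\<^sub>0 'b::ab_group_add)"
  using push_add[of h a "-b"] by (simp add: push_uminus)

lemma push_sum: "push h (sum f S) = (\<Sum>x\<in>S. push h (f x))"
  by (induction S rule: infinite_finite_induct) (auto simp: push_add)

lemma push_mult:
  fixes a b :: "'a::monoid_add \<Rightarrow>\<^sub>0 'c::semiring_0"
  assumes "\<And>x y. h (x + y) = h x + h y"
  shows "push h (a * b) = push h a * push h b"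
proof (induction a rule: single_add_induct)
  case (single x c)
  show ?case
    by (induction b rule: single_add_induct)
      (auto simp: mult_single assms distrib_left push_add)
qed (simp add: distrib_right push_add)

lemma lookup_push_inj:
  assumes "inj h"
  shows "lookup (push h a) (h x) = lookup a x"
  by (induction a rule: single_add_induct)
    (auto simp: push_add lookup_add lookup_single when_def inj_eq[OF assms])

lemma keys_push: "keys (push h a) \<subseteq> h ` keys a"
proof -
  have "keys (push h a) \<subseteq>
    (\<Union>x\<in>keys a. keys (single (h x) (lookup a x)))"
    unfolding push_def by (rule keys_sum)
  thus ?thesis by (auto split: if_splits)
qed

lemma push_eq_0_iff:
  assumes "inj h"
  shows "push h a = 0 \<longleftrightarrow> a = 0"
proof
  assume "push h a = 0"
  hence "lookup a x = 0" for x
    using lookup_push_inj[OF assms, of a x] by simp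
  thus "a = 0" by (intro poly_mapping_eqI) simp
qed simp

section \<open>Dilation-stable ideals of the group algebra of the additive group\<close>

text \<open>Subfields rather than finite subgroups of the additive group, because their nonzero
  elements permute them by dilation. Closure under \<open>inverse\<close> is harmless at zero, as
  \<open>inverse 0 = 0\<close>.\<close>

definition finite_subfield :: "'f::field set \<Rightarrow> bool" where
  "finite_subfield V \<longleftrightarrow> finite V \<and> 1 \<in> V \<and>
     (\<forall>x\<in>V. \<forall>y\<in>V. x - y \<in> V \<and> x * y \<in> V \<and> inverse x \<in> V)"

lemma finite_subfieldD:
  assumes "finite_subfield V"
  shows "finite V" "0 \<in> V" "1 \<in> V"
    "\<And>x y. x \<in> V \<Longrightarrow> y \<in> V \<Longrightarrow> x + y \<in> V"
    "\<And>x y. x \<in> V \<Longrightarrow> y \<in> V \<Longrightarrow> x - y \<in> V"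
    "\<And>x y. x \<in> V \<Longrightarrow> y \<in> V \<Longrightarrow> x * y \<in> V"
    "\<And>x. x \<in> V \<Longrightarrow> inverse x \<in> V"
    "\<And>x. x \<in> V \<Longrightarrow> - x \<in> V"
proof -
  show "finite V" "1 \<in> V" and d: "\<And>x y. x \<in> V \<Longrightarrow> y \<in> V \<Longrightarrow> x - y \<in> V"
    and "\<And>x y. x \<in> V \<Longrightarrow> y \<in> V \<Longrightarrow> x * y \<in> V" "\<And>x. x \<in> V \<Longrightarrow> inverse x \<in> V"
    using assms by (auto simp: finite_subfield_def)
  from d[of 1 1] \<open>1 \<in> V\<close> show z: "0 \<in> V" by simp
  from d[OF z] show m: "\<And>x. x \<in> V \<Longrightarrow> - x \<in> V" by simp
  from d[OF _ m] show "\<And>x y. x \<in> V \<Longrightarrow> y \<in> V \<Longrightarrow> x + y \<in> V" by simp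
qed

lemma finite_subfield_mult_bij:
  assumes "finite_subfield V" "b \<in> V" "b \<noteq> 0"
  shows "bij_betw (\<lambda>x. x * b) V V"
proof (rule bij_betwI[where g = "\<lambda>x. x * inverse b"])
  show "(\<lambda>x. x * b) \<in> V \<rightarrow> V" "(\<lambda>x. x * inverse b) \<in> V \<rightarrow> V"
    using finite_subfieldD[OF assms(1)] assms by auto
qed (use assms in auto)

lemma finite_subfield_plus_bij:
  assumes "finite_subfield V" "b \<in> V"
  shows "bij_betw (\<lambda>x. b + x) V V"
proof (rule bij_betwI[where g = "\<lambda>x. x - b"])
  show "(\<lambda>x. b + x) \<in> V \<rightarrow> V" "(\<lambda>x. x - b) \<in> V \<rightarrow> V"
    using finite_subfieldD[OF assms(1)] assms by auto
qed auto

abbreviation dilate :: "'f::field \<Rightarrow> ('f \<Rightarrow>\<^sub>0 'k) \<Rightarrow> ('f \<Rightarrow>\<^sub>0 'k::field)" where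
  "dilate l \<equiv> push (\<lambda>x. l * x)"

definition subset_sum :: "'f set \<Rightarrow> ('f::field \<Rightarrow>\<^sub>0 'k::field)" where
  "subset_sum V = (\<Sum>v\<in>V. point v)"

text \<open>The elements of the group algebra of \<open>U\<close> that kill a torus eigenvector form
  such an ideal: conjugation by the torus becomes dilation (see
  \<open>dilation_idealI\<close>).\<close>

definition dilation_ideal :: "('f::field \<Rightarrow>\<^sub>0 'k::field) set \<Rightarrow> bool" where
  "dilation_ideal J \<longleftrightarrow> 0 \<in> J \<and> (\<forall>x\<in>J. \<forall>y\<in>J. x + y \<in> J) \<and> (\<forall>x\<in>J. \<forall>a. a * x \<in> J) \<and>
     (\<forall>x\<in>J. \<forall>l. l \<noteq> 0 \<longrightarrow> dilate l x \<in> J)"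

lemma dilation_idealD:
  assumes "dilation_ideal J"
  shows "0 \<in> J" "\<And>x y. x \<in> J \<Longrightarrow> y \<in> J \<Longrightarrow> x + y \<in> J" "\<And>a x. x \<in> J \<Longrightarrow> a * x \<in> J"
    "\<And>l x. x \<in> J \<Longrightarrow> l \<noteq> 0 \<Longrightarrow> dilate l x \<in> J" "\<And>x y. x \<in> J \<Longrightarrow> y \<in> J \<Longrightarrow> x - y \<in> J"
    "\<And>f S. (\<And>i. i \<in> S \<Longrightarrow> f i \<in> J) \<Longrightarrow> sum f S \<in> J"
proof -
  show *: "0 \<in> J" "\<And>x y. x \<in> J \<Longrightarrow> y \<in> J \<Longrightarrow> x + y \<in> J" "\<And>a x. x \<in> J \<Longrightarrow> a * x \<in> J"
    "\<And>l x. x \<in> J \<Longrightarrow> l \<noteq> 0 \<Longrightarrow> dilate l x \<in> J"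
    using assms by (auto simp: dilation_ideal_def)
  from *(2)[OF _ *(3)[of _ "-1"]] show "\<And>x y. x \<in> J \<Longrightarrow> y \<in> J \<Longrightarrow> x - y \<in> J" by simp
  show "\<And>f S. (\<And>i. i \<in> S \<Longrightarrow> f i \<in> J) \<Longrightarrow> sum f S \<in> J"
    subgoal for f S by (induction S rule: infinite_finite_induct) (auto intro: *) done
qed

lemma single_mult_in_dilation_ideal_cancel:
  assumes "dilation_ideal J" "scalar c * x \<in> J" "c \<noteq> 0"
  shows "x \<in> J"
proof -
  have "scalar (inverse c) * (scalar c * x) = x"
    using assms(3) by (simp add: mult.assoc[symmetric] mult_single)
  thus ?thesis using dilation_idealD(3)[OF assms(1,2), of "scalar (inverse c)"] by simp
qed

lemma dilate_subset_sum: "l \<noteq> 0 \<Longrightarrow> dilate l (subset_sum V) = (\<Sum>v\<in>V. point (l * v))"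
  by (simp add: subset_sum_def push_sum)

lemma point_mult_subset_sum:
  assumes "finite_subfield V" "a \<in> V"
  shows "point a * subset_sum V = (subset_sum V :: 'f::field \<Rightarrow>\<^sub>0 'k::field)"
  unfolding subset_sum_def sum_distrib_left mult_single
  using sum.reindex_bij_betw[OF finite_subfield_plus_bij[OF assms], of "\<lambda>x. point x :: 'f \<Rightarrow>\<^sub>0 'k"]
  by simp

text \<open>
  The lines through the origin of the plane \<open>V + w V\<close> cover the origin \<open>card V + 1\<close> times and every
  other point once.
\<close>
lemma one_in_dilation_ideal:
  fixes J :: "('f::field \<Rightarrow>\<^sub>0 'k::field) set"
  assumes J: "dilation_ideal J" and V: "finite_subfield V" "of_nat (card V) \<noteq> (0::'k)"
    and N: "subset_sum V \<in> J" and w: "w \<notin> V"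
  shows "1 \<in> J"
proof -
  note V' = finite_subfieldD[OF V(1)]
  let ?N = "\<lambda>l. dilate l (subset_sum V) :: 'f \<Rightarrow>\<^sub>0 'k"
  have w0: "w \<noteq> 0" using w V'(2) by auto
  have nz: "1 + c * w \<noteq> 0" if "c \<in> V" for c
  proof
    assume "1 + c * w = 0"
    hence "w = - inverse c"
      by (cases "c = 0") (auto simp: field_simps eq_neg_iff_add_eq_0)
    thus False using w that V' by auto
  qed
  have "?N w + (\<Sum>c\<in>V. ?N (1 + c * w)) - subset_sum V * ?N w \<in> J"
    by (intro dilation_idealD(5)[OF J] dilation_idealD(2)[OF J] dilation_idealD(6)[OF J]
        dilation_idealD(3)[OF J] dilation_idealD(4)[OF J] N w0 nz)
  moreover have "?N w + (\<Sum>c\<in>V. ?N (1 + c * w)) = of_nat (card V) + subset_sum V * ?N w"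
  proof -
    have "(\<Sum>c\<in>V. ?N (1 + c * w)) = (\<Sum>c\<in>V. \<Sum>v\<in>V. point (v + v * c * w))"
      by (intro sum.cong refl, subst dilate_subset_sum) (auto simp: nz algebra_simps)
    also have "\<dots> = (\<Sum>v\<in>V. \<Sum>c\<in>V. point (v + v * c * w))"
      by (rule sum.swap)
    also have "\<dots> = (\<Sum>v\<in>insert 0 (V - {0}). \<Sum>c\<in>V. point (v + v * c * w))"
      using V'(2) by (simp add: insert_absorb)
    \<comment> \<open>For \<open>v = 0\<close> all \<open>card V\<close> slopes \<open>c\<close>
      give the origin; for nonzero \<open>v\<close> the substitution of \<open>v * c\<close> for
      \<open>c\<close> permutes \<open>V\<close>.\<close>
    also have "\<dots> = of_nat (card V) + (\<Sum>v\<in>V - {0}. \<Sum>c\<in>V. point (v + c * w))"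
    proof (subst sum.insert)
      have "(\<Sum>c\<in>V. point (v + v * c * w)) = (\<Sum>c\<in>V. point (v + c * w) :: 'f \<Rightarrow>\<^sub>0 'k)"
        if "v \<in> V - {0}" for v
        using sum.reindex_bij_betw[OF finite_subfield_mult_bij[OF V(1)],
            of v "\<lambda>c. point (v + c * w) :: 'f \<Rightarrow>\<^sub>0 'k"] that
        by (simp add: mult.commute)
      thus "(\<Sum>c\<in>V. point (0 + 0 * c * w)) + (\<Sum>v\<in>V - {0}. \<Sum>c\<in>V. point (v + v * c * w)) =
          of_nat (card V) + (\<Sum>v\<in>V - {0}. \<Sum>c\<in>V. point (v + c * w) :: 'f \<Rightarrow>\<^sub>0 'k)"
        by simp
    qed (use V' in auto)
    finally have 1: "(\<Sum>c\<in>V. ?N (1 + c * w)) =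
        of_nat (card V) + (\<Sum>v\<in>V - {0}. \<Sum>c\<in>V. point (v + c * w))" .
    have "subset_sum V * ?N w = (\<Sum>v\<in>V. \<Sum>c\<in>V. point (v + c * w))"
      by (subst dilate_subset_sum[OF w0])
        (simp add: subset_sum_def sum_product mult_single mult.commute)
    also have "\<dots> = (\<Sum>c\<in>V. point (0 + c * w)) + (\<Sum>v\<in>V - {0}. \<Sum>c\<in>V. point (v + c * w))"
      by (rule sum.remove) (use V' in auto)
    also have "(\<Sum>c\<in>V. point (0 + c * w)) = ?N w"
      by (subst dilate_subset_sum[OF w0]) (simp add: mult.commute)
    finally show ?thesis using 1 by simp
  qed
  ultimately have "scalar (of_nat (card V)) * 1 \<in> J"
    by simp
  thus ?thesis using single_mult_in_dilation_ideal_cancel[OF J _ V(2)] by blast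
qed

text \<open>The nonzero elements of \<open>V\<close> act simply transitively on
  \<open>V - {0}\<close>, so the mass at a nonzero point is spread evenly over
  \<open>V - {0}\<close>, while the mass at the origin is counted \<open>card V - 1\<close>
  times.\<close>

lemma sum_dilate_subfield:
  fixes x :: "'f::field \<Rightarrow>\<^sub>0 'k::field"
  assumes V: "finite_subfield V" and "keys x \<subseteq> V"
  defines "c \<equiv> lookup x 0" and "s \<equiv> (\<Sum>v\<in>V. lookup x v)"
  shows "(\<Sum>l\<in>V - {0}. dilate l x) =
    scalar (of_nat (card V) * c - s) + scalar (s - c) * subset_sum V"
proof -
  note V' = finite_subfieldD[OF V]
  have sv: "(\<Sum>l\<in>V - {0}. single (l * v) b) =
      scalar b * (subset_sum V - 1)" if v: "v \<in> V" "v \<noteq> 0" for v and b :: 'k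
  proof -
    have "(\<Sum>l\<in>V. single (l * v) b) = scalar b * subset_sum V"
      using sum.reindex_bij_betw[OF finite_subfield_mult_bij[OF V v],
          of "\<lambda>x. single x b :: 'f \<Rightarrow>\<^sub>0 'k"]
      by (simp add: subset_sum_def sum_distrib_left mult_single)
    thus ?thesis using V' by (subst sum_diff1) (auto simp: algebra_simps)
  qed
  have "(\<Sum>l\<in>V - {0}. dilate l x) =
      (\<Sum>l\<in>V - {0}. \<Sum>v\<in>V. single (l * v) (lookup x v))"
    using assms(2) V' by (intro sum.cong refl push_eq_sum) auto
  also have "\<dots> = (\<Sum>v\<in>V. \<Sum>l\<in>V - {0}. single (l * v) (lookup x v))"
    by (rule sum.swap)
  also have "\<dots> = (\<Sum>l\<in>V - {0}. single (l * 0) (lookup x 0)) +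
      (\<Sum>v\<in>V - {0}. \<Sum>l\<in>V - {0}. single (l * v) (lookup x v))"
    by (rule sum.remove) (use V' in auto)
  also have "(\<Sum>v\<in>V - {0}. \<Sum>l\<in>V - {0}. single (l * v) (lookup x v)) =
      (\<Sum>v\<in>V - {0}. scalar (lookup x v) * (subset_sum V - 1))"
    by (intro sum.cong refl sv) auto
  also have "\<dots> = (\<Sum>v\<in>V - {0}. scalar (lookup x v)) * (subset_sum V - 1)"
    by (simp add: sum_distrib_right)
  also have "(\<Sum>v\<in>V - {0}. scalar (lookup x v)) =
      (scalar (s - c) :: 'f \<Rightarrow>\<^sub>0 'k)"
  proof -
    have "(\<Sum>v\<in>S. scalar (lookup x v)) =
      (scalar (\<Sum>v\<in>S. lookup x v) :: 'f \<Rightarrow>\<^sub>0 'k)" for S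
      by (induction S rule: infinite_finite_induct) (auto simp: single_add)
    thus ?thesis unfolding s_def c_def using V' by (simp add: sum_diff1)
  qed
  also have "(\<Sum>l\<in>V - {0}. single (l * 0) (lookup x 0)) =
      (scalar (of_nat (card V) * c - c) :: 'f \<Rightarrow>\<^sub>0 'k)"
  proof -
    define n where "n = card (V - {0})"
    have "card V = Suc n" unfolding n_def using V'(1,2) by (rule card.remove)
    hence *: "of_nat (card V) * c - c = of_nat n * c"
      by (simp add: algebra_simps)
    have "(\<Sum>l\<in>V - {0}. single (l * 0) (lookup x 0)) =
        of_nat n * (scalar c :: 'f \<Rightarrow>\<^sub>0 'k)"
      by (simp add: c_def n_def)
    thus ?thesis
      by (simp only: * mult_single single_of_nat[symmetric] add_0_left)
  qed
  finally have "(\<Sum>l\<in>V - {0}. dilate l x) = scalar (of_nat (card V) * c - c) +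
      scalar (s - c) * (subset_sum V - 1)" .
  moreover have "scalar (of_nat (card V) * c - c) - scalar (s - c) =
      (scalar (of_nat (card V) * c - s) :: 'f \<Rightarrow>\<^sub>0 'k)"
    by (simp flip: single_diff)
  ultimately show ?thesis
    by (simp add: right_diff_distrib)
qed

text \<open>Averaging a translate of \<open>x\<close> over dilations leaves a combination of
  \<open>1\<close> and \<open>subset_sum V\<close>, and the factor \<open>1 - point 1\<close> kills
  the latter. What survives is nonzero if the coefficient moved to the origin differs from the mean
  over \<open>V\<close>; the gap \<open>z\<close> in the support ensures such a choice.\<close>

lemma augmentation_in_dilation_ideal:
  fixes J :: "('f::field \<Rightarrow>\<^sub>0 'k::field) set"
  assumes J: "dilation_ideal J" and x: "x \<in> J" "x \<noteq> 0"
    and V: "finite_subfield V" "of_nat (card V) \<noteq> (0::'k)"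
    and k: "keys x \<subseteq> V" "z \<in> V" "z \<notin> keys x"
  shows "1 - point a \<in> J"
proof -
  note V' = finite_subfieldD[OF V(1)]
  let ?q = "of_nat (card V) :: 'k"
  define s where "s = (\<Sum>v\<in>V. lookup x v)"
  \<comment> \<open>If the total is zero, any point of the support serves because
    \<open>card V\<close> is invertible; otherwise the gap \<open>z\<close> does.\<close>
  obtain y where y: "y \<in> V" "?q * lookup x y \<noteq> s"
  proof (cases "s = 0")
    case True
    from x(2) obtain y where "y \<in> keys x" by fastforce
    with k V True show thesis by (intro that[of y]) (auto simp: in_keys_iff)
  next
    case False
    with k show thesis by (intro that[of z]) (auto simp: in_keys_iff)
  qed
  define x' where "x' = point (- y) * x"
  have x': "x' = push (\<lambda>v. - y + v) x"
    unfolding x'_def push_def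
    by (subst (1) poly_mapping_eq_sum_single[OF finite_keys order_refl, of x])
      (simp add: sum_distrib_left mult_single)
  have lx': "lookup x' (- y + v) = lookup x v" for v
    unfolding x' by (rule lookup_push_inj) (auto intro: injI)
  have "keys x' \<subseteq> V"
    unfolding x' using keys_push[of "\<lambda>v. - y + v" x] k(1) V'(4)[OF V'(8)[OF y(1)]] by blast
  note * = sum_dilate_subfield[OF V(1) this]
  have "(\<Sum>v\<in>V. lookup x' v) = s"
    unfolding s_def
    using sum.reindex_bij_betw[OF finite_subfield_plus_bij[OF V(1) V'(8)[OF y(1)]],
        of "lookup x'"] by (simp add: lx'[simplified])
  moreover have "lookup x' 0 = lookup x y"
    using lx'[of y] by simp
  moreover have "(\<Sum>l\<in>V - {0}. dilate l x') \<in> J"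
    using J x by (intro dilation_idealD(6)[OF J] dilation_idealD(4)[OF J]) (auto simp: x'_def dilation_idealD)
  ultimately have "scalar (?q * lookup x y - s) +
      scalar (s - lookup x y) * subset_sum V \<in> J"
    using * by simp
  from dilation_idealD(3)[OF J this, of "1 - point 1"]
  have "(1 - point 1) * scalar (?q * lookup x y - s) +
    scalar (s - lookup x y) * ((1 - point 1) * subset_sum V) \<in> J"
    by (simp only: distrib_left mult.commute mult.left_commute)
  moreover have "(1 - point 1) * subset_sum V = (0 :: 'f \<Rightarrow>\<^sub>0 'k)"
    using point_mult_subset_sum[OF V(1) V'(3), where 'k = 'k] by (simp add: algebra_simps)
  ultimately have "scalar (?q * lookup x y - s) * (1 - point 1) \<in> J"
    by (simp add: mult.commute)
  hence 1: "1 - point 1 \<in> J"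
    by (rule single_mult_in_dilation_ideal_cancel[OF J]) (use y in simp)
  show ?thesis
  proof (cases "a = 0")
    case False
    from dilation_idealD(4)[OF J 1 False] show ?thesis
      by (simp add: push_diff push_one)
  qed (use dilation_idealD(1)[OF J] in simp)
qed

section \<open>The group and its Bruhat decomposition\<close>

text \<open>
  The group is written additively, because \<open>'a \<Rightarrow>\<^sub>0 'b\<close> carries the convolution product for an
  additively written, not necessarily commutative monoid \<open>'a\<close>.
\<close>

typedef (overloaded) 'f sl2 = "{A :: 'f::field ^ 2 ^ 2. Determinants.det A = 1}"
  morphisms matrix_of Abs_sl2
  by (intro exI[of _ "Finite_Cartesian_Product.mat 1"]) simp

setup_lifting type_definition_sl2

lemma det_matrix_of [simp]: "Determinants.det (matrix_of g) = 1"
  using matrix_of[of g] by simp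

instantiation sl2 :: (field) group_add
begin

lift_definition zero_sl2 :: "'a sl2" is "Finite_Cartesian_Product.mat 1" by simp

lift_definition plus_sl2 :: "'a sl2 \<Rightarrow> 'a sl2 \<Rightarrow> 'a sl2" is "(**)" by (simp add: det_mul)

lift_definition uminus_sl2 :: "'a sl2 \<Rightarrow> 'a sl2" is
  "\<lambda>A. vector [vector [A $ 2 $ 2, - A $ 1 $ 2], vector [- A $ 2 $ 1, A $ 1 $ 1]]"
  by (simp add: det_2 mult.commute)

definition minus_sl2 :: "'a sl2 \<Rightarrow> 'a sl2 \<Rightarrow> 'a sl2" where
  "minus_sl2 g h = g + - h"

instance
proof
  fix a b c :: "'a sl2"
  show "a + b + c = a + (b + c)" by transfer (simp add: matrix_mul_assoc)
  show "0 + a = a" by transfer simp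
  show "a + 0 = a" by transfer simp
  show "- a + a = 0"
    by transfer (auto simp: vec_eq_iff forall_2 det_2 matrix_matrix_mult_def sum_2
        Finite_Cartesian_Product.mat_def algebra_simps)
  show "a + - b = a - b" by (simp add: minus_sl2_def)
qed

end

definition entry :: "'f::field sl2 \<Rightarrow> 2 \<Rightarrow> 2 \<Rightarrow> 'f" where
  "entry g i j = matrix_of g $ i $ j"

lemma sl2_eq_iff:
  "g = h \<longleftrightarrow> entry g 1 1 = entry h 1 1 \<and> entry g 1 2 = entry h 1 2 \<and>
     entry g 2 1 = entry h 2 1 \<and> entry g 2 2 = entry h 2 2"
  by (auto simp: entry_def matrix_of_inject[symmetric] vec_eq_iff forall_2)

lemma entry_plus [simp]: "entry (g + h) i j = entry g i 1 * entry h 1 j + entry g i 2 * entry h 2 j"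
  unfolding entry_def by transfer (simp add: matrix_matrix_mult_def sum_2)

lemma entry_zero [simp]:
  "entry 0 1 1 = 1" "entry 0 1 2 = 0" "entry 0 2 1 = 0" "entry 0 2 2 = 1"
  unfolding entry_def by (transfer, simp add: Finite_Cartesian_Product.mat_def)+

lemma entry_uminus [simp]:
  "entry (- g) 1 1 = entry g 2 2" "entry (- g) 1 2 = - entry g 1 2"
  "entry (- g) 2 1 = - entry g 2 1" "entry (- g) 2 2 = entry g 1 1"
  unfolding entry_def by (transfer, simp)+

lemma entry_det: "entry g 1 1 * entry g 2 2 - entry g 1 2 * entry g 2 1 = 1"
  using det_matrix_of[of g] by (simp add: det_2 entry_def)

lift_definition upper :: "'f::field \<Rightarrow> 'f sl2" is "\<lambda>x. vector [vector [1, x], vector [0, 1]]"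
  by (simp add: det_2)

text \<open>The junk argument \<open>0\<close> is sent to the identity, so that \<open>diag\<close>
  is total.\<close>

lift_definition diag :: "'f::field \<Rightarrow> 'f sl2" is
  "\<lambda>t. if t = 0 then Finite_Cartesian_Product.mat 1 else vector [vector [t, 0], vector [0, inverse t]]"
  by (simp add: det_2 Finite_Cartesian_Product.mat_def)

lift_definition weyl :: "'f::field sl2" is weyl_s
  by (simp add: det_2 weyl_s_def)

lemma entry_upper [simp]:
  "entry (upper x) 1 1 = 1" "entry (upper x) 1 2 = x" "entry (upper x) 2 1 = 0" "entry (upper x) 2 2 = 1"
  unfolding entry_def by (transfer, simp)+

lemma entry_diag [simp]:
  "entry (diag t) 1 1 = (if t = 0 then 1 else t)" "entry (diag t) 1 2 = 0"
  "entry (diag t) 2 1 = 0" "entry (diag t) 2 2 = (if t = 0 then 1 else inverse t)"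
  unfolding entry_def by (transfer, simp add: Finite_Cartesian_Product.mat_def)+

lemma entry_weyl [simp]:
  "entry weyl 1 1 = 0" "entry weyl 1 2 = 1" "entry weyl 2 1 = -1" "entry weyl 2 2 = 0"
  unfolding entry_def by (transfer, simp add: weyl_s_def)+

lemma upper_add: "upper (x + y) = upper x + upper y"
  by (simp add: sl2_eq_iff add.commute)

lemma upper_0 [simp]: "upper 0 = 0"
  by (simp add: sl2_eq_iff)

lemma diag_1 [simp]: "diag 1 = 0"
  by (simp add: sl2_eq_iff)

lemma diag_mult: "s \<noteq> 0 \<Longrightarrow> t \<noteq> 0 \<Longrightarrow> diag (s * t) = diag s + diag t"
  by (simp add: sl2_eq_iff)

lemma diag_add_upper: "t \<noteq> 0 \<Longrightarrow> diag t + upper x = upper (t\<^sup>2 * x) + diag t"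
  by (simp add: sl2_eq_iff power2_eq_square)

lemma diag_add_weyl: "diag t + weyl = weyl + diag (inverse t)"
  by (simp add: sl2_eq_iff)

lemma weyl_add_diag: "weyl + diag t = diag (inverse t) + weyl"
  by (simp add: sl2_eq_iff)

lemma weyl_add_weyl: "weyl + weyl = diag (- 1)"
  by (simp add: sl2_eq_iff)

text \<open>The rank-one relation: the big-cell factorization of an element that leaves the Borel
  subgroup as soon as \<open>x\<close> is nonzero. Both simplicity proofs rest on it.\<close>

lemma weyl_upper_weyl:
  "x \<noteq> 0 \<Longrightarrow> weyl + upper x + weyl =
    upper (- inverse x) + weyl + (diag (- x) + upper (- inverse x))"
  by (simp add: sl2_eq_iff)

text \<open>With square roots available, this puts all \<open>weyl + upper y\<close> with
  \<open>y\<close> nonzero into one orbit of the torus acting on both sides.\<close>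

lemma weyl_upper_dilate:
  "t \<noteq> 0 \<Longrightarrow> weyl + upper (t\<^sup>2 * x) = diag (inverse t) + (weyl + upper x + diag (inverse t))"
  by (simp add: sl2_eq_iff power2_eq_square)

lemma borel_decomp:
  assumes "entry g 2 1 = 0"
  shows "g = upper (entry g 1 2 * entry g 1 1) + diag (entry g 1 1)" and "entry g 1 1 \<noteq> 0"
proof -
  have *: "entry g 1 1 * entry g 2 2 = 1" using entry_det[of g] assms by simp
  thus "entry g 1 1 \<noteq> 0" by auto
  with * have "inverse (entry g 1 1) = entry g 2 2" by (simp add: field_simps)
  with * \<open>entry g 1 1 \<noteq> 0\<close> assms show "g = upper (entry g 1 2 * entry g 1 1) + diag (entry g 1 1)"
    by (simp add: sl2_eq_iff)
qed

lemma big_cell_decomp: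
  assumes "entry g 2 1 \<noteq> 0"
  obtains x t y where "t \<noteq> 0" "g = upper x + diag t + (weyl + upper y)"
proof -
  let ?c = "entry g 2 1"
  have "entry g 1 2 = (entry g 1 1 * entry g 2 2 - 1) / ?c"
    using entry_det[of g] assms by (simp add: field_simps)
  hence "g = upper (entry g 1 1 / ?c) + diag (- inverse ?c) + (weyl + upper (entry g 2 2 / ?c))"
    using assms by (auto simp: sl2_eq_iff field_simps)
  thus thesis by (intro that) (use assms in auto)
qed

lemma sl2_cases:
  obtains x t where "t \<noteq> 0" "g = upper x + diag t"
  | x t y where "t \<noteq> 0" "g = upper x + diag t + (weyl + upper y)"
  using borel_decomp[of g] big_cell_decomp[of g] by metis

section \<open>Left ideals of the group algebra and linear forms\<close>

text \<open>A character of the multiplicative group as a total function; the value at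
  \<open>0\<close> is left free.\<close>

definition mult_char :: "('f::field \<Rightarrow> 'k::field) \<Rightarrow> bool" where
  "mult_char \<psi> \<longleftrightarrow> \<psi> 1 = 1 \<and> (\<forall>x y. x \<noteq> 0 \<longrightarrow> y \<noteq> 0 \<longrightarrow> \<psi> (x * y) = \<psi> x * \<psi> y)"

lemma mult_charD:
  assumes "mult_char \<psi>"
  shows "\<psi> 1 = 1" "\<And>x y. x \<noteq> 0 \<Longrightarrow> y \<noteq> 0 \<Longrightarrow> \<psi> (x * y) = \<psi> x * \<psi> y"
    "\<And>x. x \<noteq> 0 \<Longrightarrow> \<psi> x \<noteq> 0" "\<And>x. x \<noteq> 0 \<Longrightarrow> \<psi> (inverse x) = inverse (\<psi> x)"
proof -
  show 1: "\<psi> 1 = 1" and 2: "\<And>x y. x \<noteq> 0 \<Longrightarrow> y \<noteq> 0 \<Longrightarrow> \<psi> (x * y) = \<psi> x * \<psi> y"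
    using assms by (auto simp: mult_char_def)
  have *: "\<psi> x * \<psi> (inverse x) = 1" if "x \<noteq> 0" for x
    using 2[of x "inverse x"] that 1 by simp
  show "\<And>x. x \<noteq> 0 \<Longrightarrow> \<psi> x \<noteq> 0" using * by force
  show "\<And>x. x \<noteq> 0 \<Longrightarrow> \<psi> (inverse x) = inverse (\<psi> x)"
    using * inverse_unique by metis
qed

definition left_ideal :: "'r::ring_1 set \<Rightarrow> bool" where
  "left_ideal L \<longleftrightarrow> 0 \<in> L \<and> (\<forall>x\<in>L. \<forall>y\<in>L. x + y \<in> L) \<and> (\<forall>a. \<forall>x\<in>L. a * x \<in> L)"

lemma left_idealD:
  assumes "left_ideal L"
  shows "0 \<in> L" "\<And>x y. x \<in> L \<Longrightarrow> y \<in> L \<Longrightarrow> x + y \<in> L" "\<And>a x. x \<in> L \<Longrightarrow> a * x \<in> L"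
    "\<And>x. x \<in> L \<Longrightarrow> - x \<in> L" "\<And>x y. x \<in> L \<Longrightarrow> y \<in> L \<Longrightarrow> x - y \<in> L"
proof -
  show *: "0 \<in> L" "\<And>x y. x \<in> L \<Longrightarrow> y \<in> L \<Longrightarrow> x + y \<in> L" "\<And>a x. x \<in> L \<Longrightarrow> a * x \<in> L"
    using assms by (auto simp: left_ideal_def)
  from *(3)[of _ "-1"] show m: "\<And>x. x \<in> L \<Longrightarrow> - x \<in> L" by simp
  from *(2)[OF _ m] show "\<And>x y. x \<in> L \<Longrightarrow> y \<in> L \<Longrightarrow> x - y \<in> L" by simp
qed

lemma left_ideal_cong:
  assumes "left_ideal L" "a - b \<in> L"
  shows "a \<in> L \<longleftrightarrow> b \<in> L"
  using left_idealD(5)[OF assms(1) _ assms(2), of a] left_idealD(2)[OF assms(1,2), of b] by auto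

definition maximal_left_ideal :: "'r::ring_1 set \<Rightarrow> bool" where
  "maximal_left_ideal L \<longleftrightarrow> left_ideal L \<and> 1 \<notin> L \<and> (\<forall>L'. left_ideal L' \<and> L \<subset> L' \<longrightarrow> 1 \<in> L')"

text \<open>The annihilator of the class of \<open>y\<close> in the quotient by \<open>L\<close>.\<close>
definition colon :: "'r::ring_1 set \<Rightarrow> 'r \<Rightarrow> 'r set" where
  "colon L y = {a. a * y \<in> L}"

lemma left_ideal_colon: "left_ideal L \<Longrightarrow> left_ideal (colon L y)"
  by (auto simp: left_ideal_def colon_def distrib_right mult.assoc)

lemma in_left_ideal_single_cancel:
  fixes a :: "'g::monoid_add \<Rightarrow>\<^sub>0 'k::field"
  assumes "left_ideal L" "scalar c * a \<in> L" "c \<noteq> 0"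
  shows "a \<in> L"
  using left_idealD(3)[OF assms(1,2), of "scalar (inverse c)"] assms(3)
  by (simp add: mult.assoc[symmetric] mult_single)

lemma single_0_commutes:
  fixes a :: "'g::monoid_add \<Rightarrow>\<^sub>0 'k::comm_semiring_0"
  shows "a * scalar c = scalar c * a"
  by (induction a rule: single_add_induct)
    (auto simp: mult_single distrib_left distrib_right mult.commute)

lemma single_eq_scalar_mult_point:
  "single g c = scalar c * (point g :: 'g::monoid_add \<Rightarrow>\<^sub>0 'k::semiring_1)"
  by (simp add: mult_single)

definition linear_form :: "(('g::monoid_add \<Rightarrow>\<^sub>0 'k::field) \<Rightarrow> 'k) \<Rightarrow> bool" where
  "linear_form \<phi> \<longleftrightarrow> (\<forall>a b. \<phi> (a + b) = \<phi> a + \<phi> b) \<and> (\<forall>c a. \<phi> (scalar c * a) = c * \<phi> a)"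

lemma linear_formD:
  assumes "linear_form \<phi>"
  shows "\<phi> (a + b) = \<phi> a + \<phi> b" "\<phi> (scalar c * a) = c * \<phi> a" "\<phi> 0 = 0"
    "\<phi> (- a) = - \<phi> a" "\<phi> (a - b) = \<phi> a - \<phi> b"
proof -
  show 1: "\<phi> (a + b) = \<phi> a + \<phi> b" for a b using assms by (auto simp: linear_form_def)
  show 2: "\<phi> (scalar c * a) = c * \<phi> a" for c a using assms by (auto simp: linear_form_def)
  show 3: "\<phi> 0 = 0" using 2[of 0 0] by simp
  show 4: "\<phi> (- a) = - \<phi> a" for a
    using 1[of a "-a"] 3 by (simp add: eq_neg_iff_add_eq_0 add.commute)
  show "\<phi> (a - b) = \<phi> a - \<phi> b" using 1[of a "-b"] 4[of b] by simp
qed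

lemma linear_form_eq_on_mult:
  assumes "linear_form \<phi>" "linear_form \<phi>'" "\<And>g. \<phi> (point g * a) = k * \<phi>' (point g * b)"
  shows "\<phi> (r * a) = k * \<phi>' (r * b)"
proof (induction r rule: single_add_induct)
  case (single g c)
  show ?case
    by (subst (1 2) single_eq_scalar_mult_point)
      (simp only: mult.assoc linear_formD(2)[OF assms(1)] linear_formD(2)[OF assms(2)] assms(3) mult.left_commute)
qed (simp add: distrib_right linear_formD[OF assms(1)] linear_formD[OF assms(2)] distrib_left)

lemma linear_form_zero_on_mult:
  assumes "linear_form \<phi>" "\<And>g. \<phi> (point g * a) = 0"
  shows "\<phi> (r * a) = 0"
  using linear_form_eq_on_mult[OF assms(1) assms(1), of a 0 a r] assms(2) by simp

text \<open>The largest left ideal inside the kernel of the form, that is, the kernel of the map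
  taking \<open>a\<close> to the function whose value at \<open>g\<close> is the form at
  \<open>point g * a\<close>.\<close>

definition form_kernel :: "('r::ring_1 \<Rightarrow> 'k::zero) \<Rightarrow> 'r set" where
  "form_kernel \<phi> = {a. \<forall>r. \<phi> (r * a) = 0}"

lemma left_ideal_form_kernel: "linear_form \<phi> \<Longrightarrow> left_ideal (form_kernel \<phi>)"
  by (auto simp: left_ideal_def form_kernel_def linear_formD distrib_left mult.assoc[symmetric])

text \<open>Such a form corresponds, by Frobenius reciprocity, to a map from the group algebra into
  functions on the group that transform under left translation by the Borel subgroup through
  \<open>\<psi>\<close>.\<close>

definition borel_form :: "('f::field \<Rightarrow> 'k::field) \<Rightarrow> (('f sl2 \<Rightarrow>\<^sub>0 'k) \<Rightarrow> 'k) \<Rightarrow> bool" where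
  "borel_form \<psi> \<phi> \<longleftrightarrow> linear_form \<phi> \<and>
     (\<forall>x a. \<phi> (point (upper x) * a) = \<phi> a) \<and>
     (\<forall>t a. t \<noteq> 0 \<longrightarrow> \<phi> (point (diag t) * a) = \<psi> t * \<phi> a)"

lemma borel_formD:
  assumes "borel_form \<psi> \<phi>"
  shows "linear_form \<phi>" "\<phi> (point (upper x) * a) = \<phi> a"
    "t \<noteq> 0 \<Longrightarrow> \<phi> (point (diag t) * a) = \<psi> t * \<phi> a"
  using assms by (auto simp: borel_form_def)

lemma point_plus: "point (g + h) = (point g * point h :: 'g::monoid_add \<Rightarrow>\<^sub>0 'k::semiring_1)"
  by (simp add: mult_single)

text \<open>By the Bruhat decomposition an equivariant function is determined by one value for each
  point of the projective line: the identity and the elements \<open>weyl + upper y\<close>.\<close>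

lemma borel_form_eq_on_mult:
  assumes "borel_form \<psi> \<phi>" "borel_form \<psi> \<phi>'" "\<phi> a = k * \<phi>' b"
    "\<And>y. \<phi> (point (weyl + upper y) * a) = k * \<phi>' (point (weyl + upper y) * b)"
  shows "\<phi> (r * a) = k * \<phi>' (r * b)"
proof (rule linear_form_eq_on_mult[OF borel_formD(1)[OF assms(1)] borel_formD(1)[OF assms(2)]])
  fix g
  show "\<phi> (point g * a) = k * \<phi>' (point g * b)"
  proof (cases g rule: sl2_cases)
    case (1 x t)
    show ?thesis unfolding 1(2) point_plus mult.assoc borel_formD(2)[OF assms(1)]
        borel_formD(2)[OF assms(2)] borel_formD(3)[OF assms(1) 1(1)] borel_formD(3)[OF assms(2) 1(1)]
      using assms(3) by simp
  next
    case (2 x t y)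
    show ?thesis unfolding 2(2) point_plus[of "upper x + diag t"] point_plus[of "upper x"] mult.assoc
        borel_formD(2)[OF assms(1)] borel_formD(2)[OF assms(2)] borel_formD(3)[OF assms(1) 2(1)]
        borel_formD(3)[OF assms(2) 2(1)] assms(4) by simp
  qed
qed

lemma borel_form_zero_on_mult:
  assumes "borel_form \<psi> \<phi>" "\<phi> a = 0" "\<And>y. \<phi> (point (weyl + upper y) * a) = 0"
  shows "\<phi> (r * a) = 0"
  using borel_form_eq_on_mult[OF assms(1) assms(1), of a 0 a] assms(2,3) by simp

section \<open>The annihilator of the generator of an induced module\<close>

text \<open>The character of the Borel subgroup, extended by zero to the whole group.\<close>

definition borel_coeff :: "('f::field \<Rightarrow> 'k::field) \<Rightarrow> 'f sl2 \<Rightarrow> 'k" where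
  "borel_coeff \<psi> g = (if entry g 2 1 = 0 then \<psi> (entry g 1 1) else 0)"

text \<open>The coefficient of the generator in \<open>a\<close> times the generator of the induced
  module, with respect to the basis given by the points of the projective line.\<close>

definition borel_eval :: "('f::field \<Rightarrow> 'k::field) \<Rightarrow> ('f sl2 \<Rightarrow>\<^sub>0 'k) \<Rightarrow> 'k" where
  "borel_eval \<psi> a = (\<Sum>g\<in>keys a. lookup a g * borel_coeff \<psi> g)"

lemma borel_eval_eq_sum:
  assumes "finite S" "keys a \<subseteq> S"
  shows "borel_eval \<psi> a = (\<Sum>g\<in>S. lookup a g * borel_coeff \<psi> g)"
  unfolding borel_eval_def using assms by (intro sum.mono_neutral_left) (auto simp: in_keys_iff)

lemma borel_eval_single [simp]: "borel_eval \<psi> (single g c) = c * borel_coeff \<psi> g"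
  by (subst borel_eval_eq_sum[where S = "{g}"]) auto

lemma borel_eval_add: "borel_eval \<psi> (a + b) = borel_eval \<psi> a + borel_eval \<psi> b"
  using Poly_Mapping.keys_add[of a b]
  by (subst (1 2 3) borel_eval_eq_sum[where S = "keys a \<union> keys b"])
    (auto simp: lookup_add distrib_right sum.distrib)

lemma borel_coeff_mult:
  assumes "mult_char \<psi>" "entry g 2 1 = 0"
  shows "borel_coeff \<psi> (g + h) = \<psi> (entry g 1 1) * borel_coeff \<psi> h"
    "borel_coeff \<psi> (h + g) = borel_coeff \<psi> h * \<psi> (entry g 1 1)"
proof -
  have "entry g 2 2 \<noteq> 0" "entry g 1 1 \<noteq> 0" using entry_det[of g] assms(2) by auto
  thus "borel_coeff \<psi> (g + h) = \<psi> (entry g 1 1) * borel_coeff \<psi> h"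
    "borel_coeff \<psi> (h + g) = borel_coeff \<psi> h * \<psi> (entry g 1 1)"
    using assms borel_decomp(2)[of h] mult_charD[OF assms(1)] by (auto simp: borel_coeff_def)
qed

lemma linear_form_borel_eval: "linear_form (borel_eval \<psi>)"
  unfolding linear_form_def
proof (intro conjI allI)
  fix c a show "borel_eval \<psi> (scalar c * a) = c * borel_eval \<psi> a"
    by (induction a rule: single_add_induct)
      (auto simp: mult_single distrib_left borel_eval_add)
qed (rule borel_eval_add)

lemma borel_eval_borel_mult:
  assumes "mult_char \<psi>" "entry g 2 1 = 0"
  shows "borel_eval \<psi> (point g * a) = \<psi> (entry g 1 1) * borel_eval \<psi> a"
  by (induction a rule: single_add_induct)
    (auto simp: mult_single distrib_left borel_eval_add borel_coeff_mult[OF assms])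

lemma borel_form_borel_eval:
  assumes "mult_char \<psi>"
  shows "borel_form \<psi> (borel_eval \<psi>)"
  using linear_form_borel_eval borel_eval_borel_mult[OF assms] mult_charD(1)[OF assms]
  by (auto simp: borel_form_def)

text \<open>The annihilator of the generator of the induced module (shown in
  \<open>ann_induced_presentation\<close>): the factor \<open>r\<close> in
  \<open>form_kernel\<close> moves any point of the projective line to the base point, so every
  coefficient is tested.\<close>

definition induced_ann :: "('f::field \<Rightarrow> 'k::field) \<Rightarrow> ('f sl2 \<Rightarrow>\<^sub>0 'k) set" where
  "induced_ann \<psi> = form_kernel (borel_eval \<psi>)"

lemma left_ideal_induced_ann: "left_ideal (induced_ann \<psi>)"
  unfolding induced_ann_def by (intro left_ideal_form_kernel linear_form_borel_eval)

lemma one_notin_induced_ann: "mult_char \<psi> \<Longrightarrow> 1 \<notin> induced_ann \<psi>"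
proof
  assume "1 \<in> induced_ann \<psi>" "mult_char \<psi>"
  hence "borel_eval \<psi> (point 0 * 1) = 0" unfolding induced_ann_def form_kernel_def by blast
  thus False using \<open>mult_char \<psi>\<close> mult_charD(1)[of \<psi>]
    by (simp only: mult_1_right borel_eval_single) (simp add: borel_coeff_def)
qed

text \<open>Modulo \<open>L\<close> the class of \<open>1\<close> spans a line on which the Borel
  subgroup acts through \<open>\<psi>\<close>, so the quotient by \<open>L\<close> is a quotient of
  the induced module.\<close>

definition borel_stable :: "('f::field \<Rightarrow> 'k::field) \<Rightarrow> ('f sl2 \<Rightarrow>\<^sub>0 'k) set \<Rightarrow> bool" where
  "borel_stable \<psi> L \<longleftrightarrow> left_ideal L \<and>
     (\<forall>x. point (upper x) - 1 \<in> L) \<and>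
     (\<forall>t. t \<noteq> 0 \<longrightarrow> point (diag t) - scalar (\<psi> t) \<in> L)"

lemma borel_stableD:
  assumes "borel_stable \<psi> L"
  shows "left_ideal L" "r * point (upper x) - r \<in> L"
    "t \<noteq> 0 \<Longrightarrow> r * point (diag t) - scalar (\<psi> t) * r \<in> L"
proof -
  show L: "left_ideal L" using assms by (simp add: borel_stable_def)
  have "r * (point (upper x) - 1) \<in> L"
    using assms left_idealD(3)[OF L] by (simp add: borel_stable_def)
  thus "r * point (upper x) - r \<in> L" by (simp add: right_diff_distrib)
  assume "t \<noteq> 0"
  hence "r * (point (diag t) - scalar (\<psi> t)) \<in> L"
    using assms left_idealD(3)[OF L] by (simp add: borel_stable_def)
  thus "r * point (diag t) - scalar (\<psi> t) * r \<in> L"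
    by (simp add: right_diff_distrib single_0_commutes)
qed

lemma borel_stable_induced_ann:
  assumes "mult_char \<psi>"
  shows "borel_stable \<psi> (induced_ann \<psi>)"
proof -
  have *: "borel_eval \<psi> (r * (point b - scalar (\<psi> (entry b 1 1)))) = 0"
    if "entry b 2 1 = 0" for r b
  proof (rule linear_form_zero_on_mult[OF linear_form_borel_eval])
    fix g
    have "borel_eval \<psi> (point g * point b) = \<psi> (entry b 1 1) * borel_coeff \<psi> g"
      using borel_coeff_mult(2)[OF assms that, of g] by (simp add: mult_single)
    thus "borel_eval \<psi> (point g * (point b - scalar (\<psi> (entry b 1 1)))) = 0"
      unfolding right_diff_distrib linear_formD(5)[OF linear_form_borel_eval] by (simp add: mult_single)
  qed
  have "borel_eval \<psi> (r * (point (diag t) - scalar (\<psi> t))) = 0" if "t \<noteq> 0" for r t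
    using *[of "diag t" r] that by simp
  thus ?thesis
    unfolding borel_stable_def
    using *[of "upper _"] left_ideal_induced_ann mult_charD(1)[OF assms]
    by (auto simp: induced_ann_def form_kernel_def)
qed

lemma borel_stable_Int: "borel_stable \<psi> L \<Longrightarrow> borel_stable \<psi> L' \<Longrightarrow> borel_stable \<psi> (L \<inter> L')"
  by (auto simp: borel_stable_def left_ideal_def)

lemma borel_stable_mono: "borel_stable \<psi> L \<Longrightarrow> left_ideal L' \<Longrightarrow> L \<subseteq> L' \<Longrightarrow> borel_stable \<psi> L'"
  by (auto simp: borel_stable_def)

abbreviation upper_alg :: "('f::field \<Rightarrow>\<^sub>0 'k::field) \<Rightarrow> ('f sl2 \<Rightarrow>\<^sub>0 'k)" where
  "upper_alg \<equiv> push upper"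

lemma upper_alg_mult: "upper_alg (v * w) = upper_alg v * upper_alg w"
  by (rule push_mult) (rule upper_add)

lemma upper_alg_1 [simp]: "upper_alg 1 = 1"
  by (rule push_one) simp

text \<open>Every group element is \<open>b\<close> or \<open>upper x + weyl + b\<close> with
  \<open>b\<close> in the Borel subgroup, and \<open>b\<close> acts on the class of \<open>1\<close>
  by a scalar.\<close>

lemma borel_stable_normal_form:
  assumes "borel_stable \<psi> L"
  shows "\<exists>c w. a - (scalar c + upper_alg w * point weyl) \<in> L"
proof (induction a rule: single_add_induct)
  note L = left_idealD[OF borel_stableD(1)[OF assms]]
  case (single g c)
  show ?case
  proof (cases g rule: sl2_cases)
    case (1 x t)
    have "single (upper x) c * point (diag t) -
          scalar (\<psi> t) * single (upper x) c \<in> L"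
      by (rule borel_stableD(3)[OF assms 1(1)])
    moreover have "scalar (\<psi> t * c) * point (upper x) - scalar (\<psi> t * c) \<in> L"
      by (rule borel_stableD(2)[OF assms])
    ultimately have "single g c - scalar (\<psi> t * c) \<in> L"
      using L(2) unfolding 1(2) by (fastforce simp: mult_single)
    thus ?thesis by (intro exI[of _ "\<psi> t * c"] exI[of _ 0]) simp
  next
    case (2 x t y)
    have g: "g = upper x + (weyl + (diag (inverse t) + upper y))"
      unfolding 2(2) by (simp only: add.assoc diag_add_weyl[symmetric]) (simp only: add.assoc[symmetric] diag_add_weyl)
    have "single (upper x + weyl + diag (inverse t)) c * point (upper y) -
        single (upper x + weyl + diag (inverse t)) c \<in> L"
      by (rule borel_stableD(2)[OF assms])
    moreover have "single (upper x + weyl) c * point (diag (inverse t)) -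
        scalar (\<psi> (inverse t)) * single (upper x + weyl) c \<in> L"
      by (rule borel_stableD(3)[OF assms]) (use 2(1) in simp)
    ultimately have "single g c -
        single (upper x) (\<psi> (inverse t) * c) * point weyl \<in> L"
      using L(2) unfolding g by (fastforce simp: mult_single add.assoc)
    thus ?thesis
      by (intro exI[of _ 0] exI[of _ "single x (\<psi> (inverse t) * c)"]) simp
  qed
next
  case (add a b)
  then obtain c w c' w' where
    "a - (scalar c + upper_alg w * point weyl) \<in> L"
    "b - (scalar c' + upper_alg w' * point weyl) \<in> L" by blast
  from left_idealD(2)[OF borel_stableD(1)[OF assms] this] show ?case
    by (intro exI[of _ "c + c'"] exI[of _ "w + w'"]) (simp add: single_add push_add algebra_simps)
qed

text \<open>Uniqueness of the normal form: modulo \<open>induced_ann\<close> the class of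
  \<open>1\<close> and the \<open>U\<close>-translates of \<open>weyl\<close> are linearly
  independent.\<close>

lemma normal_form_in_induced_ann:
  assumes "mult_char \<psi>" "scalar c + upper_alg w * point weyl \<in> induced_ann \<psi>"
  shows "c = 0" "w = 0"
proof -
  have 0: "borel_eval \<psi> (r * (scalar c + upper_alg w * point weyl)) = 0" for r
    using assms(2) by (auto simp: induced_ann_def form_kernel_def)
  have "borel_eval \<psi> (upper_alg w * point weyl) = 0"
    by (induction w rule: single_add_induct)
      (auto simp: push_add distrib_right borel_eval_add mult_single borel_coeff_def)
  with 0[of 1] show c: "c = 0"
    using mult_charD(1)[OF assms(1)] by (simp add: borel_eval_add borel_coeff_def)
  \<comment> \<open>The factor is the inverse of \<open>upper y + weyl\<close>; it moves this
    element into the Borel subgroup and every \<open>upper x + weyl\<close> with another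
    \<open>x\<close> out of it.\<close>
  have "borel_eval \<psi> (point (- weyl + upper (- y)) * (upper_alg w * point weyl)) = lookup w y" for y
  proof (induction w rule: single_add_induct)
    case (single x d)
    show ?case using mult_charD(1)[OF assms(1)]
      by (simp add: mult_single borel_coeff_def lookup_single when_def)
  qed (simp add: push_add distrib_right distrib_left borel_eval_add lookup_add)
  with 0[of "point (- weyl + upper (- _))"] c show "w = 0"
    by (intro poly_mapping_eqI) simp
qed

text \<open>The universal property of the induced module. The normal form is taken modulo the
  intersection of both ideals, so an element of \<open>induced_ann\<close> has normal form zero and
  therefore lies in \<open>L\<close>.\<close>

lemma induced_ann_subset:
  assumes "mult_char \<psi>" "borel_stable \<psi> L"
  shows "induced_ann \<psi> \<subseteq> L"
proof
  fix a assume a: "a \<in> induced_ann \<psi>"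
  obtain c w where cw: "a - (scalar c + upper_alg w * point weyl) \<in> L \<inter> induced_ann \<psi>"
    using borel_stable_normal_form[OF borel_stable_Int[OF assms(2) borel_stable_induced_ann[OF assms(1)]]]
    by blast
  with a have "scalar c + upper_alg w * point weyl \<in> induced_ann \<psi>"
    using left_ideal_cong[OF left_ideal_induced_ann] by blast
  from normal_form_in_induced_ann[OF assms(1) this] cw show "a \<in> L" by simp
qed

section \<open>Simplicity of the induced modules and of the Steinberg module\<close>

text \<open>Invertibility of \<open>card V\<close> makes it possible to average over finite
  subgroups of \<open>U\<close>; it reflects that the two characteristics differ. Algebraic
  closedness provides square roots and infinitely many elements.\<close>

locale locally_finite_fields =
  fixes ff :: "'f::alg_closed_field itself" and kk :: "'k::field itself"
  assumes finite_subfield_exists: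
    "finite (A :: 'f set) \<Longrightarrow> \<exists>V. A \<subseteq> V \<and> finite_subfield V \<and> of_nat (card V) \<noteq> (0::'k)"
begin

lemma infinite_field: "infinite (UNIV :: 'f set)"
proof
  assume fin: "finite (UNIV :: 'f set)"
  define P where "P = (\<Prod>a\<in>(UNIV :: 'f set). [:- a, 1:]) + 1"
  have "Polynomial.degree (\<Prod>a\<in>(UNIV :: 'f set). [:- a, 1:]) = card (UNIV :: 'f set)"
    by (subst degree_prod_eq_sum_degree) auto
  moreover have "card (UNIV :: 'f set) > 0" using fin by (simp add: card_gt_0_iff)
  ultimately have "Polynomial.degree P > 0"
    unfolding P_def by (subst degree_add_eq_left) auto
  then obtain x where "poly P x = 0" using alg_closed_imp_poly_has_root by blast
  moreover have "poly (\<Prod>a\<in>(UNIV :: 'f set). [:- a, 1:]) x = 0"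
    using fin by (auto simp: poly_prod intro!: prod_zero bexI[of _ x])
  ultimately show False by (simp add: P_def)
qed

lemma exists_sqrt: obtains t :: 'f where "t\<^sup>2 = x"
  using nth_root_exists[of 2 x] by auto

lemma ex_not_in_finite: assumes "finite (A :: 'f set)" obtains z where "z \<notin> A"
  using infinite_field assms by (metis ex_new_if_finite)

lemma augmentation_in_dilation_ideal':
  fixes J :: "('f \<Rightarrow>\<^sub>0 'k) set"
  assumes "dilation_ideal J" "x \<in> J" "x \<noteq> 0"
  shows "1 - point a \<in> J"
proof -
  obtain z where z: "z \<notin> keys x" using ex_not_in_finite[OF finite_keys] .
  obtain V where "insert z (keys x) \<subseteq> V" "finite_subfield V" "of_nat (card V) \<noteq> (0::'k)"
    using finite_subfield_exists[of "insert z (keys x)"] by auto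
  thus ?thesis using augmentation_in_dilation_ideal[OF assms, of V z] z by auto
qed

text \<open>A nonzero function with finite support on an infinite group is not
  translation-invariant: some shift moves a gap \<open>z\<close> onto a support point
  \<open>k\<close>.\<close>

lemma point_shift_moves:
  fixes w :: "'f \<Rightarrow>\<^sub>0 'k"
  assumes "w \<noteq> 0"
  obtains x where "(1 - point x) * w \<noteq> 0"
proof -
  obtain z where z: "z \<notin> keys w" using ex_not_in_finite[OF finite_keys] .
  obtain k where k: "k \<in> keys w" using assms by fastforce
  have "lookup (point (k - z) * w) (k - z + y) = lookup w y" for y
    by (induction w rule: single_add_induct)
      (auto simp: mult_single distrib_left lookup_add lookup_single when_def)
  from this[of z] have "lookup ((1 - point (k - z)) * w) k = lookup w k"
    using z by (simp add: left_diff_distrib lookup_minus in_keys_iff)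
  thus thesis using k by (intro that[of "k - z"]) (auto simp: in_keys_iff)
qed

lemma diag_mult_upper_alg:
  assumes "t \<noteq> 0"
  shows "point (diag t) * upper_alg w = upper_alg (dilate (t\<^sup>2) w) * (point (diag t) :: 'f sl2 \<Rightarrow>\<^sub>0 'k)"
  by (induction w rule: single_add_induct)
    (auto simp: mult_single diag_add_upper[OF assms] push_add distrib_left distrib_right)

text \<open>Conjugation by \<open>diag t\<close> dilates \<open>U\<close> by the square of
  \<open>t\<close>, so \<open>t\<close> is taken to be a square root of \<open>l\<close>; the factor
  \<open>diag (inverse t)\<close> on the right is absorbed as a scalar by the eigenvector
  \<open>y\<close>.\<close>

lemma dilation_idealI:
  fixes L :: "('f sl2 \<Rightarrow>\<^sub>0 'k) set"
  assumes L: "left_ideal L"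
    and y: "\<And>t. t \<noteq> 0 \<Longrightarrow> \<exists>c. point (diag t) * y - scalar c * y \<in> L"
  shows "dilation_ideal {w. upper_alg w * y \<in> L}"
proof -
  note L' = left_idealD[OF L]
  have "upper_alg (dilate l w) * y \<in> L" if w: "upper_alg w * y \<in> L" and l: "l \<noteq> 0" for l w
  proof -
    obtain t where t: "t\<^sup>2 = l" by (rule exists_sqrt)
    with l have t0: "t \<noteq> 0" "inverse t \<noteq> 0" by auto
    obtain c where c: "point (diag (inverse t)) * y - scalar c * y \<in> L"
      using y[OF t0(2)] by blast
    have "diag t + diag (inverse t) = 0" using diag_mult[of t "inverse t"] t0 by simp
    hence "upper_alg (dilate l w) = point (diag t) * upper_alg w * point (diag (inverse t))"
      unfolding diag_mult_upper_alg[OF t0(1)] t mult.assoc by (simp add: mult_single)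
    hence "upper_alg (dilate l w) * y = point (diag t) * upper_alg w * (point (diag (inverse t)) * y - scalar c * y)
       + point (diag t) * (scalar c * (upper_alg w * y))"
      by (simp add: right_diff_distrib mult.assoc)
        (simp add: mult.assoc[symmetric] single_0_commutes)
    thus ?thesis using L'(2,3) c w by simp
  qed
  moreover have "upper_alg v * (upper_alg w * y) \<in> L" if "upper_alg w * y \<in> L" for v w
    using L'(3) that by blast
  ultimately show ?thesis
    using L'(1,2) by (auto simp: dilation_ideal_def push_add distrib_right upper_alg_mult mult.assoc)
qed

lemma borel_stable_diag_weyl:
  fixes L :: "('f sl2 \<Rightarrow>\<^sub>0 'k) set"
  assumes "borel_stable \<psi> L" "t \<noteq> 0"
  shows "point (diag t) * point weyl - scalar (\<psi> (inverse t)) * point weyl \<in> L"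
  using borel_stableD(3)[OF assms(1), of "inverse t" "point weyl"] assms(2)
  by (simp add: mult_single diag_add_weyl)

text \<open>Modulo a larger ideal \<open>U\<close> fixes the class of \<open>weyl\<close>. The
  rank-one relation then forces the class of \<open>1\<close> to be \<open>\<psi> x\<close> times
  that of \<open>weyl\<close> for every nonzero \<open>x\<close>, and two different values of
  \<open>\<psi>\<close> make both vanish.\<close>

theorem maximal_induced_ann:
  fixes \<psi> :: "'f \<Rightarrow> 'k"
  assumes \<psi>: "mult_char \<psi>" and nontriv: "x0 \<noteq> 0" "\<psi> x0 \<noteq> 1"
  shows "maximal_left_ideal (induced_ann \<psi>)"
  unfolding maximal_left_ideal_def
proof (intro conjI allI impI left_ideal_induced_ann one_notin_induced_ann \<psi>)
  fix L assume "left_ideal L \<and> induced_ann \<psi> \<subset> L"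
  hence L: "left_ideal L" and sub: "induced_ann \<psi> \<subset> L" by auto
  note L' = left_idealD[OF L]
  have bs: "borel_stable \<psi> L"
    using borel_stable_mono[OF borel_stable_induced_ann[OF \<psi>] L] sub by blast
  obtain a where a: "a \<in> L" "a \<notin> induced_ann \<psi>" using sub by blast
  obtain c w where cw: "a - (scalar c + upper_alg w * point weyl) \<in> induced_ann \<psi>"
    using borel_stable_normal_form[OF borel_stable_induced_ann[OF \<psi>]] by blast
  define b where "b = scalar c + upper_alg w * point weyl"
  have b: "b \<in> L" "b \<notin> induced_ann \<psi>"
    using a left_ideal_cong[OF L] left_ideal_cong[OF left_ideal_induced_ann] cw sub unfolding b_def by blast+
  show "1 \<in> L"
  proof (cases "w = 0")
    case True
    with b have "scalar c * 1 \<in> L" by (simp add: b_def)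
    moreover have "c \<noteq> 0" using b True left_idealD(1)[OF left_ideal_induced_ann[of \<psi>]] by (auto simp: b_def)
    ultimately show ?thesis by (rule in_left_ideal_single_cancel[OF L])
  next
    case False
    let ?J = "{w. upper_alg w * point weyl \<in> L}"
    have J: "dilation_ideal ?J"
      using borel_stable_diag_weyl[OF bs] by (intro dilation_idealI[OF L]) blast
    obtain x where x: "(1 - point x) * w \<noteq> 0" using point_shift_moves[OF False] .
    \<comment> \<open>\<open>U\<close> fixes the class of \<open>1\<close>, so this factor removes
      the scalar part of \<open>b\<close>; by the choice of \<open>x\<close> the other part
      survives.\<close>
    have "upper_alg (1 - point x) * b = upper_alg ((1 - point x) * w) * point weyl +
        (scalar c - scalar c * point (upper x))"
      by (simp add: b_def distrib_left upper_alg_mult mult.assoc push_diff left_diff_distrib right_diff_distrib single_0_commutes)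
    moreover have "scalar c - scalar c * point (upper x) \<in> L"
      using L'(4)[OF borel_stableD(2)[OF bs, of "scalar c" x]] by (simp add: single_0_commutes)
    ultimately have "(1 - point x) * w \<in> ?J"
      using L'(5)[OF L'(3)[OF b(1), of "upper_alg (1 - point x)"]] by fastforce
    hence aug: "point weyl - point (upper y + weyl) \<in> L" for y
      using augmentation_in_dilation_ideal'[OF J _ x, of y]
      by (simp add: push_diff left_diff_distrib mult_single)
    \<comment> \<open>Multiply \<open>aug\<close> by \<open>weyl\<close>: of the two resulting
      terms, \<open>weyl + weyl\<close> acts by \<open>\<psi> (- 1)\<close>, and the rank-one
      relation turns the other into \<open>\<psi> (- x)\<close> times \<open>weyl\<close>.\<close>
    have key: "1 - scalar (\<psi> x) * point weyl \<in> L" if x: "x \<noteq> 0" for x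
    proof -
      let ?u = "- inverse x"
      have "point (weyl + weyl) - point (weyl + upper x + weyl) \<in> L"
        using L'(3)[OF aug[of x], of "point weyl"] by (simp add: right_diff_distrib mult_single add.assoc)
      moreover have "point (weyl + weyl) - scalar (\<psi> (- 1)) \<in> L"
        using borel_stableD(3)[OF bs, of "-1" 1] by (simp add: weyl_add_weyl)
      moreover have "point (weyl + upper x + weyl) - scalar (\<psi> (- x)) * point weyl \<in> L"
      proof -
        have 1: "point (weyl + upper x + weyl) - point (upper ?u + weyl + diag (- x)) \<in> L"
          using borel_stableD(2)[OF bs, of "point (upper ?u + weyl + diag (- x))" ?u]
          unfolding weyl_upper_weyl[OF x] by (simp add: mult_single add.assoc)
        have 2: "point (upper ?u + weyl + diag (- x)) - scalar (\<psi> (- x)) * point (upper ?u + weyl) \<in> L"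
          using borel_stableD(3)[OF bs, of "- x" "point (upper ?u + weyl)"] x by (simp add: mult_single)
        have 3: "scalar (\<psi> (- x)) * point (upper ?u + weyl) - scalar (\<psi> (- x)) * point weyl \<in> L"
          using L'(4)[OF L'(3)[OF aug[of ?u], of "scalar (\<psi> (- x))"]] by (simp add: right_diff_distrib)
        show ?thesis using L'(2)[OF L'(2)[OF 1 2] 3] by simp
      qed
      ultimately have "scalar (\<psi> (- 1)) - scalar (\<psi> (- x)) * point weyl \<in> L"
        using L'(2,5) by (smt (verit, best) diff_add_cancel diff_diff_eq2 L'(4) minus_diff_eq)
      moreover have "\<psi> (- x) = \<psi> (- 1) * \<psi> x" using mult_charD(2)[OF \<psi>, of "-1" x] x by simp
      ultimately have "scalar (\<psi> (- 1)) * (1 - scalar (\<psi> x) * point weyl) \<in> L"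
        by (simp add: right_diff_distrib mult.assoc[symmetric] mult_single)
      thus ?thesis by (rule in_left_ideal_single_cancel[OF L]) (use mult_charD(3)[OF \<psi>, of "-1"] in simp)
    qed
    have "1 - point weyl \<in> L" using key[of 1] mult_charD(1)[OF \<psi>] by simp
    with key[OF nontriv(1)] have "(1 - point weyl) - (1 - scalar (\<psi> x0) * point weyl) \<in> L"
      using L'(5) by blast
    hence "scalar (\<psi> x0 - 1) * point weyl \<in> L"
      by (simp add: single_diff left_diff_distrib)
    hence "point weyl \<in> L"
      by (rule in_left_ideal_single_cancel[OF L]) (use nontriv(2) in simp)
    from L'(2)[OF \<open>1 - point weyl \<in> L\<close> this] show ?thesis by simp
  qed
qed

end

section \<open>The annihilator of \<open>eta_s\<close> and the simplicity of the Steinberg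
  module\<close>

definition steinberg_ann :: "('f::field sl2 \<Rightarrow>\<^sub>0 'k::field) set" where
  "steinberg_ann = colon (induced_ann (\<lambda>_. 1)) (1 - point weyl)"

lemma mult_char_trivial: "mult_char (\<lambda>_. 1)"
  by (simp add: mult_char_def)

lemma left_ideal_steinberg_ann: "left_ideal steinberg_ann"
  unfolding steinberg_ann_def by (intro left_ideal_colon left_ideal_induced_ann)

lemma borel_stable_trivial_right:
  fixes L :: "('f::field sl2 \<Rightarrow>\<^sub>0 'k::field) set"
  assumes "borel_stable (\<lambda>_. 1) L"
  shows "point (g + upper x) - point g \<in> L" "t \<noteq> 0 \<Longrightarrow> point (g + diag t) - point g \<in> L"
  using borel_stableD(2)[OF assms, of "point g" x] borel_stableD(3)[OF assms, of t "point g"]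
  by (simp_all add: mult_single)

text \<open>Since \<open>U\<close> fixes the generator of the induced module, the basis vector given
  by \<open>upper x + weyl\<close> is the generator minus the \<open>upper x\<close>-translate of
  \<open>eta_s\<close>.\<close>

lemma point_mod_steinberg:
  fixes g :: "'f::field sl2"
  shows "\<exists>w. point g - (1 - upper_alg w * (1 - point weyl)) \<in> (induced_ann (\<lambda>_. 1) :: ('f sl2 \<Rightarrow>\<^sub>0 'k::field) set)"
proof -
  let ?Z = "induced_ann (\<lambda>_. 1) :: ('f sl2 \<Rightarrow>\<^sub>0 'k) set"
  note bs = borel_stable_induced_ann[OF mult_char_trivial, where 'a = 'f and 'b = 'k]
  note Z = left_idealD[OF borel_stableD(1)[OF bs]]
  note r = borel_stable_trivial_right[OF bs]
  show ?thesis
  proof (cases g rule: sl2_cases)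
    case (1 x t)
    have "point g - 1 \<in> ?Z"
      using Z(2)[OF r(2)[OF 1(1), of "upper x"] r(1)[of 0 x]] unfolding 1(2) by simp
    thus ?thesis by (intro exI[of _ 0]) simp
  next
    case (2 x t y)
    have g: "g = upper x + weyl + diag (inverse t) + upper y"
      unfolding 2(2) by (metis add.assoc diag_add_weyl)
    have "point g - point (upper x + weyl) \<in> ?Z"
      using Z(2)[OF r(1)[of "upper x + weyl + diag (inverse t)" y] r(2)[of "inverse t" "upper x + weyl"]] 2(1)
      unfolding g by simp
    moreover have "point (upper x) - 1 \<in> ?Z" using r(1)[of 0 x] by simp
    ultimately have "point g - point (upper x + weyl) + (point (upper x) - 1) \<in> ?Z" by (rule Z(2))
    thus ?thesis
      by (intro exI[of _ "point x"]) (simp add: algebra_simps mult_single)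
  qed
qed

text \<open>This makes the span of the \<open>U\<close>-translates of \<open>eta_s\<close> stable
  under the whole group: \<open>g\<close> applied to \<open>1 - weyl\<close> is a difference of two
  group elements, and the two copies of the generator from \<open>point_mod_steinberg\<close>
  cancel.\<close>

lemma mod_steinberg:
  fixes a :: "'f::field sl2 \<Rightarrow>\<^sub>0 'k::field"
  shows "\<exists>w. a - upper_alg w \<in> steinberg_ann"
proof (induction a rule: single_add_induct)
  case (single g c)
  let ?Z = "induced_ann (\<lambda>_. 1) :: ('f sl2 \<Rightarrow>\<^sub>0 'k) set"
  note Z = left_idealD[OF left_ideal_induced_ann]
  obtain w w' where 1: "point g - (1 - upper_alg w * (1 - point weyl)) \<in> ?Z"
    and 2: "point (g + weyl) - (1 - upper_alg w' * (1 - point weyl)) \<in> ?Z"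
    using point_mod_steinberg by blast
  from Z(5)[OF 1 2] have "(point g - upper_alg (w' - w)) * (1 - point weyl) \<in> ?Z"
    by (simp add: push_diff algebra_simps mult_single)
  from Z(3)[OF this, of "scalar c"]
  have "(single g c - upper_alg (scalar c * (w' - w))) * (1 - point weyl) \<in> ?Z"
    by (simp only: upper_alg_mult push_single upper_0 mult.assoc[symmetric]
        right_diff_distrib[of "scalar c" "point g"] mult_single add_0 mult_1_right)
  thus ?case unfolding steinberg_ann_def colon_def by blast
next
  case (add a b)
  then obtain w w' where "a - upper_alg w \<in> steinberg_ann" "b - upper_alg w' \<in> steinberg_ann" by blast
  from left_idealD(2)[OF left_ideal_steinberg_ann this] show ?case
    by (intro exI[of _ "w + w'"]) (simp add: push_add algebra_simps)
qed

lemma one_minus_weyl_notin_induced_ann: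
  "1 - point weyl \<notin> (induced_ann (\<lambda>_. 1) :: ('f::field sl2 \<Rightarrow>\<^sub>0 'k::field) set)"
proof
  assume "1 - point weyl \<in> (induced_ann (\<lambda>_. 1) :: ('f sl2 \<Rightarrow>\<^sub>0 'k) set)"
  hence "scalar 1 + upper_alg (- 1) * point weyl \<in> (induced_ann (\<lambda>_. 1) :: ('f sl2 \<Rightarrow>\<^sub>0 'k) set)"
    by (simp add: push_uminus)
  from normal_form_in_induced_ann(1)[OF mult_char_trivial this] show False by simp
qed

lemma diag_minus_one_in_steinberg_ann:
  assumes "t \<noteq> 0"
  shows "point (diag t) - 1 \<in> (steinberg_ann :: ('f::field sl2 \<Rightarrow>\<^sub>0 'k::field) set)"
proof -
  note bs = borel_stable_induced_ann[OF mult_char_trivial, where 'a = 'f and 'b = 'k]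
  have "(point (diag t) - point 0) - (point (weyl + diag (inverse t)) - point weyl) \<in>
      (induced_ann (\<lambda>_. 1) :: ('f sl2 \<Rightarrow>\<^sub>0 'k) set)"
    using left_idealD(5)[OF borel_stableD(1)[OF bs] borel_stable_trivial_right(2)[OF bs, of t 0]
        borel_stable_trivial_right(2)[OF bs, of "inverse t" weyl]] assms by simp
  thus ?thesis
    unfolding steinberg_ann_def colon_def by (simp add: algebra_simps mult_single diag_add_weyl)
qed

text \<open>The rank-one relation read in the Steinberg module: \<open>weyl\<close> carries the
  element \<open>1 - upper x\<close> of the augmentation ideal, applied to \<open>eta_s\<close>, to
  minus a group element applied to \<open>eta_s\<close>.\<close>

lemma weyl_upper_in_steinberg_ann:
  fixes x :: "'f::field"
  assumes x: "x \<noteq> 0"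
  shows "point weyl * (1 - point (upper x)) + point (upper (- inverse x)) \<in>
    (steinberg_ann :: ('f sl2 \<Rightarrow>\<^sub>0 'k::field) set)"
proof -
  let ?Z = "induced_ann (\<lambda>_. 1) :: ('f sl2 \<Rightarrow>\<^sub>0 'k) set"
  let ?u = "upper (- inverse x)"
  note bs = borel_stable_induced_ann[OF mult_char_trivial, where 'a = 'f and 'b = 'k]
  note Z = left_idealD[OF borel_stableD(1)[OF bs]]
  note r = borel_stable_trivial_right[OF bs]
  have 1: "point (weyl + upper x) - point weyl \<in> ?Z" by (rule r)
  have 2: "point (weyl + weyl) - point 0 \<in> ?Z" using r(2)[of "-1" 0] by (simp add: weyl_add_weyl)
  have 3: "point ?u - point 0 \<in> ?Z" using r(1)[of 0] by simp
  have 4: "point (weyl + upper x + weyl) - point (?u + weyl) \<in> ?Z"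
    using Z(2)[OF r(1)[of "?u + weyl + diag (- x)" "- inverse x"] r(2)[of "- x" "?u + weyl"]] x
    unfolding weyl_upper_weyl[OF x] by (simp add: add.assoc)
  have "(point weyl * (1 - point (upper x)) + point ?u) * (1 - point weyl) =
     - (point (weyl + upper x) - point weyl) - (point (weyl + weyl) - point 0) + (point ?u - point 0) +
     (point (weyl + upper x + weyl) - (point (?u + weyl) :: 'f sl2 \<Rightarrow>\<^sub>0 'k))"
    by (simp add: algebra_simps mult_single)
  also have "\<dots> \<in> ?Z" by (intro Z(2) Z(5) Z(4) 1 2 3 4)
  finally show ?thesis unfolding steinberg_ann_def colon_def by simp
qed

text \<open>A larger left ideal meets the group algebra of \<open>U\<close> in a nonzero
  dilation-stable ideal, hence contains the augmentation ideal; the preceding relation at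
  \<open>1\<close> then yields a group element, which is a unit.\<close>

theorem (in locally_finite_fields) maximal_steinberg_ann:
  "maximal_left_ideal (steinberg_ann :: ('f sl2 \<Rightarrow>\<^sub>0 'k) set)"
  unfolding maximal_left_ideal_def
proof (intro conjI allI impI left_ideal_steinberg_ann)
  show "1 \<notin> (steinberg_ann :: ('f sl2 \<Rightarrow>\<^sub>0 'k) set)"
    using one_minus_weyl_notin_induced_ann by (auto simp: steinberg_ann_def colon_def)
  fix L :: "('f sl2 \<Rightarrow>\<^sub>0 'k) set"
  assume "left_ideal L \<and> steinberg_ann \<subset> L"
  hence L: "left_ideal L" and sub: "steinberg_ann \<subset> L" by auto
  note L' = left_idealD[OF L]
  let ?J = "{w. upper_alg w * 1 \<in> L}"
  have J: "dilation_ideal ?J"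
  proof (rule dilation_idealI[OF L])
    fix t :: 'f assume "t \<noteq> 0"
    from diag_minus_one_in_steinberg_ann[OF this] sub
    show "\<exists>c. point (diag t) * 1 - scalar c * 1 \<in> L" by (intro exI[of _ 1]) auto
  qed
  obtain a where a: "a \<in> L" "a \<notin> steinberg_ann" using sub by blast
  obtain w where w: "a - upper_alg w \<in> steinberg_ann" using mod_steinberg by blast
  hence "w \<in> ?J" using left_ideal_cong[OF L] a sub by auto
  moreover have "w \<noteq> 0" using w a by auto
  ultimately have "1 - point 1 \<in> ?J" by (rule augmentation_in_dilation_ideal'[OF J])
  hence "point weyl * (1 - point (upper 1)) \<in> L" using L'(3) by (simp add: push_diff)
  moreover have "point weyl * (1 - point (upper 1)) + point (upper (- 1)) \<in> L"
    using weyl_upper_in_steinberg_ann[of "1::'f", where 'k = 'k] sub by auto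
  ultimately have "point (upper (- 1)) \<in> L" using L'(5) by fastforce
  from L'(3)[OF this, of "point (upper 1)"] show "1 \<in> L"
    by (simp add: mult_single flip: upper_add)
qed

section \<open>Torus-stable lines in simple modules\<close>

lemma exists_linear_form:
  fixes W :: "('g::monoid_add \<Rightarrow>\<^sub>0 'k::field) set"
  assumes "0 \<in> W" "\<And>a b. a \<in> W \<Longrightarrow> b \<in> W \<Longrightarrow> a + b \<in> W"
    "\<And>c a. a \<in> W \<Longrightarrow> scalar c * a \<in> W" "r \<notin> W"
  obtains \<phi> where "linear_form \<phi>" "\<And>a. a \<in> W \<Longrightarrow> \<phi> a = 0" "\<phi> r = 1"
proof -
  interpret vector_space_pair "\<lambda>c (a :: 'g \<Rightarrow>\<^sub>0 'k). scalar c * a" "(*) :: 'k \<Rightarrow> 'k \<Rightarrow> 'k"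
    by unfold_locales (auto simp: algebra_simps single_add mult_single mult.assoc[symmetric])
  have sub: "vs1.subspace W" using assms unfolding vs1.subspace_def by auto
  obtain B where B: "B \<subseteq> W" "vs1.independent B" "W \<subseteq> vs1.span B"
    using vs1.maximal_independent_subset[of W] by blast
  have span: "vs1.span B = W" using B vs1.span_minimal[OF B(1) sub] by blast
  have "vs1.independent (insert r B)"
    using B(2) assms(4) span by (auto simp: vs1.independent_insert)
  then obtain \<phi> where \<phi>:
    "Vector_Spaces.linear (\<lambda>c a. scalar c * a) (*) \<phi>"
    "\<forall>x\<in>insert r B. \<phi> x = (if x = r then 1 else 0)"
    using linear_independent_extend[of "insert r B" "\<lambda>x. if x = r then 1 else 0"] by blast
  interpret \<phi>: Vector_Spaces.linear "\<lambda>c (a :: 'g \<Rightarrow>\<^sub>0 'k). scalar c * a" "(*) :: 'k \<Rightarrow> 'k \<Rightarrow> 'k" \<phi>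
    by (rule \<phi>(1))
  have "\<phi> x = 0" if "x \<in> B" for x using that \<phi>(2) B(1) assms(4) by auto
  hence "\<phi> a = 0" if "a \<in> W" for a
    using linear_eq_0_on_span[OF \<phi>(1), of B a] that span by blast
  moreover have "linear_form \<phi>" unfolding linear_form_def using \<phi>.add \<phi>.scale by blast
  moreover have "\<phi> r = 1" using \<phi>(2) by simp
  ultimately show thesis by (intro that)
qed

section \<open>The group algebra of the torus and the coinvariants of \<open>U\<close>\<close>

definition torus_alg :: "('f::field sl2 \<Rightarrow>\<^sub>0 'k::field) set" where
  "torus_alg = range (push diag)"

lemma torus_alg_induct [consumes 1, case_names single add]:
  assumes "a \<in> torus_alg" "\<And>t c. t \<noteq> 0 \<Longrightarrow> P (single (diag t) c)"
    "\<And>a b. P a \<Longrightarrow> P b \<Longrightarrow> P (a + b)"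
  shows "P a"
proof -
  obtain v where v: "a = push diag v" using assms(1) by (auto simp: torus_alg_def)
  have "P (single (diag t) c)" for t c
  proof (cases "t = 0")
    case True
    hence "diag t = diag 1" by (simp add: sl2_eq_iff)
    thus ?thesis using assms(2)[of 1 c] by simp
  qed (rule assms(2))
  thus ?thesis unfolding v
    by (induction v rule: single_add_induct) (auto simp: push_add assms(3))
qed

lemma torus_alg_single [simp]: "single (diag t) c \<in> torus_alg"
  unfolding torus_alg_def by (rule range_eqI[of _ _ "single t c"]) simp

lemma torus_alg_scalar [simp]: "scalar c \<in> torus_alg"
  using torus_alg_single[of 1 c] by simp

lemma torus_alg_zero [simp]: "0 \<in> torus_alg"
  using torus_alg_scalar[of 0] by simp

lemma torus_alg_one [simp]: "1 \<in> torus_alg"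
  using torus_alg_scalar[of 1] by simp

lemma torus_alg_add: "a \<in> torus_alg \<Longrightarrow> b \<in> torus_alg \<Longrightarrow> a + b \<in> torus_alg"
  by (auto simp: torus_alg_def push_add[symmetric])

lemma torus_alg_diff: "a \<in> torus_alg \<Longrightarrow> b \<in> torus_alg \<Longrightarrow> a - b \<in> torus_alg"
  by (auto simp: torus_alg_def push_diff[symmetric])

lemma torus_alg_mult:
  assumes "a \<in> torus_alg" "b \<in> torus_alg"
  shows "a * b \<in> torus_alg" "a * b = b * a"
  using assms(1)
proof (induction a rule: torus_alg_induct)
  case (single t c)
  case 1
  show ?case using assms(2)
    by (induction b rule: torus_alg_induct)
      (use single in \<open>auto simp: mult_single diag_mult[symmetric] distrib_left intro: torus_alg_add\<close>)
  case 2
  show ?case using assms(2)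
    by (induction b rule: torus_alg_induct)
      (use single in \<open>auto simp: mult_single diag_mult[symmetric] distrib_left distrib_right mult.commute\<close>)
qed (auto simp: distrib_left distrib_right intro: torus_alg_add)

text \<open>
  The quotient by this subspace is the module of coinvariants of the unipotent group on the quotient
  by \<open>L\<close>, because the cardinalities of the finite subgroups of that group are invertible.
\<close>
definition coinv_kernel :: "('f::field sl2 \<Rightarrow>\<^sub>0 'k::field) set \<Rightarrow> ('f sl2 \<Rightarrow>\<^sub>0 'k) set" where
  "coinv_kernel L = {r. \<exists>V. finite_subfield V \<and> of_nat (card V) \<noteq> (0::'k) \<and> upper_alg (subset_sum V) * r \<in> L}"

lemma subset_sum_absorb:
  assumes "finite_subfield V'" "V \<subseteq> V'"
  shows "subset_sum V' * subset_sum V = scalar (of_nat (card V)) * (subset_sum V' :: 'f::field \<Rightarrow>\<^sub>0 'k::field)"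
proof -
  have "subset_sum V' * subset_sum V = (\<Sum>v\<in>V. point v * (subset_sum V' :: 'f \<Rightarrow>\<^sub>0 'k))"
    by (simp add: subset_sum_def[of V] sum_distrib_left mult.commute)
  also have "\<dots> = (\<Sum>v\<in>V. subset_sum V')"
    using assms by (intro sum.cong refl point_mult_subset_sum) auto
  finally show ?thesis by simp
qed

text \<open>The sum over a larger subfield absorbs the sum over \<open>V\<close> up to the
  invertible factor \<open>card V\<close>; hence the union in \<open>coinv_kernel\<close> is
  directed and closed under addition.\<close>

lemma coinv_enlarge:
  fixes L :: "('f::field sl2 \<Rightarrow>\<^sub>0 'k::field) set"
  assumes L: "left_ideal L" and "of_nat (card V) \<noteq> (0::'k)" "upper_alg (subset_sum V) * r \<in> L"
    and "finite_subfield V'" "V \<subseteq> V'"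
  shows "upper_alg (subset_sum V') * r \<in> L"
proof -
  have "upper_alg (subset_sum V') * (upper_alg (subset_sum V) * r) \<in> L"
    using left_idealD(3)[OF L] assms(3) by blast
  hence "upper_alg (subset_sum V' * subset_sum V) * r \<in> L"
    by (simp add: upper_alg_mult mult.assoc)
  hence "scalar (of_nat (card V)) * (upper_alg (subset_sum V') * r) \<in> L"
    unfolding subset_sum_absorb[OF assms(4,5)] upper_alg_mult push_single upper_0 by (simp only: mult.assoc)
  thus ?thesis by (rule in_left_ideal_single_cancel[OF L]) (rule assms(2))
qed

lemma coinv_kernel_scalar:
  assumes "left_ideal L" "r \<in> coinv_kernel L"
  shows "scalar c * r \<in> coinv_kernel L"
proof -
  obtain V where V: "finite_subfield V" "of_nat (card V) \<noteq> (0::'b)" "upper_alg (subset_sum V) * r \<in> L"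
    using assms(2) by (auto simp: coinv_kernel_def)
  have "scalar c * (upper_alg (subset_sum V) * r) \<in> L" using left_idealD(3)[OF assms(1)] V(3) by blast
  thus ?thesis using V(1,2) unfolding coinv_kernel_def
    by (auto simp: mult.assoc[symmetric] single_0_commutes)
qed

context locally_finite_fields
begin

lemma coinv_kernel_superset:
  fixes L :: "('f sl2 \<Rightarrow>\<^sub>0 'k) set"
  assumes "left_ideal L"
  shows "L \<subseteq> coinv_kernel L"
  using finite_subfield_exists[of "{}"] left_idealD(3)[OF assms] unfolding coinv_kernel_def by blast

lemma coinv_kernel_add:
  fixes L :: "('f sl2 \<Rightarrow>\<^sub>0 'k) set"
  assumes L: "left_ideal L" and r: "r \<in> coinv_kernel L" "r' \<in> coinv_kernel L"
  shows "r + r' \<in> coinv_kernel L"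
proof -
  obtain V V' where V: "finite_subfield V" "of_nat (card V) \<noteq> (0::'k)" "upper_alg (subset_sum V) * r \<in> L"
    and V': "finite_subfield V'" "of_nat (card V') \<noteq> (0::'k)" "upper_alg (subset_sum V') * r' \<in> L"
    using r by (auto simp: coinv_kernel_def)
  obtain W where W: "V \<union> V' \<subseteq> W" "finite_subfield W" "of_nat (card W) \<noteq> (0::'k)"
    using finite_subfield_exists[of "V \<union> V'"] V(1) V'(1) finite_subfieldD(1) by blast
  have "upper_alg (subset_sum W) * r \<in> L" "upper_alg (subset_sum W) * r' \<in> L"
    using coinv_enlarge[OF L V(2,3) W(2)] coinv_enlarge[OF L V'(2,3) W(2)] W(1) by auto
  hence "upper_alg (subset_sum W) * (r + r') \<in> L"
    using left_idealD(2)[OF L] by (simp add: distrib_left)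
  thus ?thesis using W unfolding coinv_kernel_def by blast
qed

lemma coinv_kernel_diff:
  fixes L :: "('f sl2 \<Rightarrow>\<^sub>0 'k) set"
  assumes L: "left_ideal L" and r: "r \<in> coinv_kernel L" "r' \<in> coinv_kernel L"
  shows "r - r' \<in> coinv_kernel L"
  using coinv_kernel_add[OF L r(1) coinv_kernel_scalar[OF L r(2), of "-1"]]
  by (simp add: single_uminus)

text \<open>The sum over a subfield containing \<open>x\<close> absorbs translation by
  \<open>x\<close>.\<close>

lemma coinv_kernel_upper:
  fixes L :: "('f sl2 \<Rightarrow>\<^sub>0 'k) set"
  assumes "left_ideal L"
  shows "point (upper x) * r - r \<in> coinv_kernel L"
proof -
  obtain V where V: "{x} \<subseteq> V" "finite_subfield V" "of_nat (card V) \<noteq> (0::'k)"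
    using finite_subfield_exists[of "{x}"] by auto
  have "upper_alg (subset_sum V) * point (upper x) = upper_alg (subset_sum V * point x)"
    by (simp add: upper_alg_mult)
  also have "subset_sum V * point x = (subset_sum V :: 'f \<Rightarrow>\<^sub>0 'k)"
    using point_mult_subset_sum[OF V(2), of x, where 'k = 'k] V(1) by (simp add: mult.commute)
  finally have "upper_alg (subset_sum V) * (point (upper x) * r - r) = 0"
    by (simp add: right_diff_distrib mult.assoc[symmetric])
  thus ?thesis using V left_idealD(1)[OF assms] unfolding coinv_kernel_def by auto
qed

text \<open>If \<open>t\<close> lies in the subfield \<open>W\<close>, then its square permutes
  \<open>W\<close> by dilation, so \<open>diag t\<close> commutes with the sum over
  \<open>W\<close>.\<close>

lemma coinv_kernel_diag:
  fixes L :: "('f sl2 \<Rightarrow>\<^sub>0 'k) set"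
  assumes L: "left_ideal L" and "r \<in> coinv_kernel L" and t: "t \<noteq> 0"
  shows "point (diag t) * r \<in> coinv_kernel L"
proof -
  obtain V where V: "finite_subfield V" "of_nat (card V) \<noteq> (0::'k)" "upper_alg (subset_sum V) * r \<in> L"
    using assms(2) by (auto simp: coinv_kernel_def)
  obtain W where W: "insert t V \<subseteq> W" "finite_subfield W" "of_nat (card W) \<noteq> (0::'k)"
    using finite_subfield_exists[of "insert t V"] finite_subfieldD(1)[OF V(1)] by auto
  have "t\<^sup>2 \<in> W" "t\<^sup>2 \<noteq> 0" using finite_subfieldD(6)[OF W(2), of t t] W(1) t by (auto simp: power2_eq_square)
  hence "dilate (t\<^sup>2) (subset_sum W) = (subset_sum W :: 'f \<Rightarrow>\<^sub>0 'k)"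
    using sum.reindex_bij_betw[OF finite_subfield_mult_bij[OF W(2)], of "t\<^sup>2" "\<lambda>x. point x :: 'f \<Rightarrow>\<^sub>0 'k"]
    by (simp add: dilate_subset_sum) (simp add: subset_sum_def mult.commute)
  hence "upper_alg (subset_sum W) * (point (diag t) * r) = point (diag t) * (upper_alg (subset_sum W) * r)"
    using diag_mult_upper_alg[OF t, of "subset_sum W"] by (simp add: mult.assoc[symmetric])
  moreover have "upper_alg (subset_sum W) * r \<in> L"
    using coinv_enlarge[OF L V(2,3) W(2)] W(1) by auto
  ultimately show ?thesis
    using W left_idealD(3)[OF L] unfolding coinv_kernel_def by auto
qed

lemma coinv_kernel_torus:
  fixes L :: "('f sl2 \<Rightarrow>\<^sub>0 'k) set"
  assumes L: "left_ideal L" and r: "r \<in> coinv_kernel L" and "a \<in> torus_alg"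
  shows "a * r \<in> coinv_kernel L"
  using assms(3)
proof (induction a rule: torus_alg_induct)
  case (single t c)
  show ?case
    using coinv_kernel_scalar[OF L coinv_kernel_diag[OF L r single], of c]
    by (simp add: mult.assoc[symmetric] mult_single)
qed (simp add: distrib_right coinv_kernel_add[OF L])

end

text \<open>\<open>L\<close> is the annihilator of a torus eigenvector in a simple module and
  \<open>\<psi>\<close> is the weight of that vector.\<close>

locale torus_eigenvector = locally_finite_fields ff kk
  for ff :: "'f::alg_closed_field itself" and kk :: "'k::field itself" +
  fixes L :: "('f sl2 \<Rightarrow>\<^sub>0 'k) set" and \<psi> :: "'f \<Rightarrow> 'k"
  assumes maximal: "maximal_left_ideal L" and mult_char: "mult_char \<psi>"
    and diag: "t \<noteq> 0 \<Longrightarrow> point (diag t) - scalar (\<psi> t) \<in> L"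
begin

lemma left_ideal: "left_ideal L" and one_notin: "1 \<notin> L"
  using maximal by (auto simp: maximal_left_ideal_def)

lemmas L = left_idealD[OF left_ideal]

lemma right_diag: "t \<noteq> 0 \<Longrightarrow> r * point (diag t) - scalar (\<psi> t) * r \<in> L"
  using L(3)[OF diag, of t r] by (simp add: right_diff_distrib single_0_commutes)

text \<open>The elements of the group algebra of \<open>U\<close> that kill the eigenvector form a
  dilation-stable ideal. An element \<open>w\<close> outside the finite \<open>V\<close> exists, so
  \<open>one_in_dilation_ideal\<close> would put \<open>1\<close> into \<open>L\<close>.\<close>

lemma subset_sum_notin:
  assumes "finite_subfield V" "of_nat (card V) \<noteq> (0::'k)"
  shows "upper_alg (subset_sum V) \<notin> L"
proof
  assume *: "upper_alg (subset_sum V) \<in> L"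
  have J: "dilation_ideal {w. upper_alg w * 1 \<in> L}"
    by (rule dilation_idealI[OF left_ideal]) (use diag in auto)
  obtain w where "w \<notin> V" using ex_not_in_finite[OF finite_subfieldD(1)[OF assms(1)]] .
  from one_in_dilation_ideal[OF J assms _ this] * one_notin show False by simp
qed

lemma one_notin_coinv_kernel: "1 \<notin> coinv_kernel L"
  using subset_sum_notin by (auto simp: coinv_kernel_def)

text \<open>On the torus algebra \<open>borel_eval \<psi>\<close> is the algebra homomorphism
  extending \<open>\<psi>\<close>, through which this algebra acts on the class of
  \<open>1\<close>.\<close>

lemma torus_alg_mod:
  assumes "a \<in> torus_alg"
  shows "a - scalar (borel_eval \<psi> a) \<in> L"
  using assms
proof (induction a rule: torus_alg_induct)
  case (single t c)
  show ?case
    using L(3)[OF diag[OF single], of "scalar c"] single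
    by (simp add: right_diff_distrib mult_single borel_coeff_def)
next
  case (add a b)
  from L(2)[OF add] show ?case by (simp add: borel_eval_add single_add algebra_simps)
qed

lemma borel_eval_torus_mult:
  assumes "a \<in> torus_alg"
  shows "borel_eval \<psi> (a * r) = borel_eval \<psi> a * borel_eval \<psi> r"
  using assms
proof (induction a rule: torus_alg_induct)
  case (single t c)
  show ?case
    using borel_formD(3)[OF borel_form_borel_eval[OF mult_char] single, of r] single
    by (subst single_eq_scalar_mult_point)
      (simp add: mult.assoc linear_formD[OF linear_form_borel_eval] borel_coeff_def)
qed (simp add: distrib_right borel_eval_add)

text \<open>In the coinvariants \<open>U\<close> disappears on the left, and on the right the torus
  acts on the eigenvector by scalars. For nonzero \<open>y\<close> a square root of \<open>y\<close>
  moves \<open>weyl + upper y\<close> to \<open>weyl + upper 1\<close>, at the price of a torus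
  factor on the left.\<close>

lemma coinv_normal_form:
  "\<exists>c d a. a \<in> torus_alg \<and> r - (scalar c + scalar d * point weyl +
     a * point (weyl + upper 1)) \<in> coinv_kernel L"
proof (induction r rule: single_add_induct)
  note K = coinv_kernel_add[OF left_ideal] coinv_kernel_upper[OF left_ideal]
  note LK = subsetD[OF coinv_kernel_superset[OF left_ideal]]
  case (single g k)
  have u: "single (upper x + h) k - r \<in> coinv_kernel L"
    if "single h k - r \<in> coinv_kernel L" for x h r
    using K(1)[OF K(2)[of x "single h k"] that] by (simp add: mult_single)
  show ?case
  proof (cases g rule: sl2_cases)
    case (1 x t)
    have "single (diag t) k - scalar (\<psi> t * k) \<in> L"
      using right_diag[OF 1(1), of "scalar k"] by (simp add: mult_single)
    note * = u[OF LK[OF this], of x]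
    show ?thesis
      unfolding 1(2)
      by (rule exI[of _ "\<psi> t * k"], rule exI[of _ 0], rule exI[of _ 0]) (use * in simp)
  next
    case (2 x t y)
    show ?thesis
    proof (cases "y = 0")
      case True
      have "single (diag t + weyl) k - scalar (\<psi> (inverse t) * k) * point weyl \<in> L"
        using right_diag[of "inverse t" "single weyl k"] 2(1)
        by (simp add: mult_single diag_add_weyl)
      note * = u[OF LK[OF this], of x]
      show ?thesis
        unfolding 2(2) True
        by (rule exI[of _ 0], rule exI[of _ "\<psi> (inverse t) * k"], rule exI[of _ 0]) (use * in \<open>simp add: add.assoc\<close>)
    next
      case False
      obtain s where s: "s\<^sup>2 = y" by (rule exists_sqrt)
      with False have s0: "s \<noteq> 0" by auto
      have "weyl + upper y = diag (inverse s) + (weyl + upper 1 + diag (inverse s))"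
        using weyl_upper_dilate[OF s0, of 1] s by simp
      hence g: "diag t + (weyl + upper y) = diag (t * inverse s) + (weyl + upper 1) + diag (inverse s)"
        using diag_mult[of t "inverse s"] 2(1) s0 by (simp add: add.assoc)
      have "single (diag t + (weyl + upper y)) k -
        single (diag (t * inverse s)) (\<psi> (inverse s) * k) * point (weyl + upper 1) \<in> L"
        unfolding g
        using right_diag[of "inverse s" "single (diag (t * inverse s) + (weyl + upper 1)) k"] s0
        by (simp add: mult_single)
      note * = u[OF LK[OF this], of x]
      show ?thesis
        unfolding 2(2)
        by (rule exI[of _ 0], rule exI[of _ 0],
            rule exI[of _ "single (diag (t * inverse s)) (\<psi> (inverse s) * k)"])
          (use * in \<open>simp add: add.assoc\<close>)
    qed
  qed
next
  case (add r r')
  then obtain c d a c' d' a' where *: "a \<in> torus_alg" "a' \<in> torus_alg"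
    "r - (scalar c + scalar d * point weyl +
     a * point (weyl + upper 1)) \<in> coinv_kernel L"
    "r' - (scalar c' + scalar d' * point weyl +
     a' * point (weyl + upper 1)) \<in> coinv_kernel L" by blast
  have "r - (scalar c + scalar d * point weyl + a * point (weyl + upper 1)) +
    (r' - (scalar c' + scalar d' * point weyl + a' * point (weyl + upper 1))) =
    r + r' - (scalar (c + c') + scalar (d + d') * point weyl +
      (a + a') * point (weyl + upper 1))"
    by (simp add: single_add distrib_right)
  with coinv_kernel_add[OF left_ideal *(3,4)] torus_alg_add[OF *(1,2)] show ?case by metis
qed

text \<open>
  In the coinvariants, \<open>1\<close> and \<open>weyl\<close> are eigenvectors of the torus, and together with
  \<open>weyl + upper 1\<close> they generate over the torus. This is the subspace spanned by the differences
  between the torus action and the action through \<open>\<psi>\<close>.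
\<close>
definition weight_kernel :: "('f sl2 \<Rightarrow>\<^sub>0 'k) set" where
  "weight_kernel = {r. \<exists>c a. a \<in> torus_alg \<and> borel_eval \<psi> a = 0 \<and>
     ((\<forall>t. t \<noteq> 0 \<longrightarrow> \<psi> (inverse t) = \<psi> t) \<longrightarrow> c = 0) \<and>
     r - (scalar c * point weyl + a * point (weyl + upper 1)) \<in> coinv_kernel L}"

lemma weight_kernel_superset: "coinv_kernel L \<subseteq> weight_kernel"
proof
  fix r assume "r \<in> coinv_kernel L"
  thus "r \<in> weight_kernel" unfolding weight_kernel_def
    by (auto intro!: exI[of _ 0] simp: linear_formD(3)[OF linear_form_borel_eval])
qed

lemma weight_kernel_add:
  assumes "r \<in> weight_kernel" "r' \<in> weight_kernel"
  shows "r + r' \<in> weight_kernel"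
proof -
  let ?P = "\<lambda>c. (\<forall>t. t \<noteq> 0 \<longrightarrow> \<psi> (inverse t) = \<psi> t) \<longrightarrow> c = 0"
  from assms obtain c a c' a' where *: "a \<in> torus_alg" "a' \<in> torus_alg"
    "borel_eval \<psi> a = 0" "borel_eval \<psi> a' = 0" "?P c" "?P c'"
    "r - (scalar c * point weyl + a * point (weyl + upper 1)) \<in> coinv_kernel L"
    "r' - (scalar c' * point weyl + a' * point (weyl + upper 1)) \<in> coinv_kernel L"
    unfolding weight_kernel_def by blast
  have "r - (scalar c * point weyl + a * point (weyl + upper 1)) +
    (r' - (scalar c' * point weyl + a' * point (weyl + upper 1))) =
    r + r' - (scalar (c + c') * point weyl + (a + a') * point (weyl + upper 1))"
    by (simp add: single_add distrib_right)
  with coinv_kernel_add[OF left_ideal *(7,8)] have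
    "r + r' - (scalar (c + c') * point weyl + (a + a') * point (weyl + upper 1)) \<in> coinv_kernel L"
    by simp
  moreover have "?P (c + c')" using *(5,6) by auto
  moreover have "borel_eval \<psi> (a + a') = 0" using *(3,4) by (simp add: borel_eval_add)
  ultimately show ?thesis using torus_alg_add[OF *(1,2)] unfolding weight_kernel_def by blast
qed

lemma weight_kernel_scalar:
  assumes "r \<in> weight_kernel"
  shows "scalar k * r \<in> weight_kernel"
proof -
  let ?P = "\<lambda>c. (\<forall>t. t \<noteq> 0 \<longrightarrow> \<psi> (inverse t) = \<psi> t) \<longrightarrow> c = 0"
  from assms obtain c a where *: "a \<in> torus_alg" "borel_eval \<psi> a = 0" "?P c"
    "r - (scalar c * point weyl + a * point (weyl + upper 1)) \<in> coinv_kernel L"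
    unfolding weight_kernel_def by blast
  have "scalar k * r - (scalar (k * c) * point weyl +
      (scalar k * a) * point (weyl + upper 1)) \<in> coinv_kernel L"
    using coinv_kernel_scalar[OF left_ideal *(4), of k]
    by (simp add: right_diff_distrib distrib_left mult.assoc[symmetric] mult_single)
  moreover have "?P (k * c)" using *(3) by auto
  moreover have "borel_eval \<psi> (scalar k * a) = 0"
    using *(2) by (simp add: linear_formD(2)[OF linear_form_borel_eval])
  ultimately show ?thesis using torus_alg_mult(1)[OF torus_alg_scalar *(1)] unfolding weight_kernel_def by blast
qed

lemma weight_kernel_diag:
  assumes t: "t \<noteq> 0"
  shows "point (diag t) * r - scalar (\<psi> t) * r \<in> weight_kernel"
proof -
  let ?D = "point (diag t) - scalar (\<psi> t)"
  have D: "?D \<in> torus_alg" by (intro torus_alg_diff) auto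
  obtain c d a where *: "a \<in> torus_alg"
    "r - (scalar c + scalar d * point weyl + a * point (weyl + upper 1)) \<in> coinv_kernel L"
    using coinv_normal_form by blast
  have "?D * scalar c \<in> L"
    using L(3)[OF diag[OF t], of "scalar c"] by (simp add: single_0_commutes)
  hence 1: "?D * scalar c \<in> coinv_kernel L" using coinv_kernel_superset[OF left_ideal] by blast
  \<comment> \<open>On the class of \<open>weyl\<close> the torus has weight
    \<open>\<psi> (inverse t)\<close>, which produces the factor
    \<open>\<psi> (inverse t) - \<psi> t\<close>. It vanishes for all nonzero \<open>t\<close>
    exactly when the definition of \<open>weight_kernel\<close> forces the coefficient of
    \<open>weyl\<close> to be zero.\<close>
  have "scalar d * (point weyl * point (diag (inverse t)) - scalar (\<psi> (inverse t)) * point weyl) \<in> L"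
    using right_diag[of "inverse t" "point weyl"] t L(3) by auto
  moreover have "scalar d * (point weyl * point (diag (inverse t)) - scalar (\<psi> (inverse t)) * point weyl) =
    ?D * (scalar d * point weyl) - scalar (d * (\<psi> (inverse t) - \<psi> t)) * point weyl"
    by (simp add: left_diff_distrib right_diff_distrib mult.assoc[symmetric] mult_single single_diff diag_add_weyl mult.commute)
  ultimately have 2: "?D * (scalar d * point weyl) -
      scalar (d * (\<psi> (inverse t) - \<psi> t)) * point weyl \<in> coinv_kernel L"
    using coinv_kernel_superset[OF left_ideal] by auto
  have 3: "?D * (r - (scalar c + scalar d * point weyl + a * point (weyl + upper 1))) \<in> coinv_kernel L"
    by (rule coinv_kernel_torus[OF left_ideal *(2) D])
  have "?D * r - (scalar (d * (\<psi> (inverse t) - \<psi> t)) * point weyl + (?D * a) * point (weyl + upper 1)) =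
    ?D * (r - (scalar c + scalar d * point weyl + a * point (weyl + upper 1))) +
    (?D * (scalar d * point weyl) - scalar (d * (\<psi> (inverse t) - \<psi> t)) * point weyl) +
    ?D * scalar c"
    unfolding right_diff_distrib[of ?D] distrib_left[of ?D] mult.assoc by simp
  also have "\<dots> \<in> coinv_kernel L"
    by (intro coinv_kernel_add[OF left_ideal] 1 2 3)
  finally have 4: "?D * r - (scalar (d * (\<psi> (inverse t) - \<psi> t)) * point weyl + (?D * a) * point (weyl + upper 1)) \<in> coinv_kernel L" .
  have "borel_eval \<psi> ?D = 0"
    using t by (simp add: linear_formD(5)[OF linear_form_borel_eval] borel_coeff_def mult_charD(1)[OF mult_char])
  hence "borel_eval \<psi> (?D * a) = 0" by (simp add: borel_eval_torus_mult[OF D])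
  with 4 torus_alg_mult(1)[OF D *(1)] t have "?D * r \<in> weight_kernel"
    unfolding weight_kernel_def mem_Collect_eq
    by (intro exI[of _ "d * (\<psi> (inverse t) - \<psi> t)"] exI[of _ "?D * a"]) auto
  thus ?thesis by (simp add: left_diff_distrib)
qed

text \<open>The determinant trick of Nakayama's lemma, applied to the three generators.\<close>
lemma weight_kernel_proper: "weight_kernel \<noteq> UNIV"
proof
  assume U: "weight_kernel = UNIV"
  let ?n = "point (weyl + upper 1) :: 'f sl2 \<Rightarrow>\<^sub>0 'k"
  let ?P = "\<lambda>c. (\<forall>t. t \<noteq> 0 \<longrightarrow> \<psi> (inverse t) = \<psi> t) \<longrightarrow> c = 0"
  let ?s = "\<lambda>c. scalar c * point weyl :: 'f sl2 \<Rightarrow>\<^sub>0 'k"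
  note K = coinv_kernel_add[OF left_ideal] coinv_kernel_torus[OF left_ideal] coinv_kernel_diff[OF left_ideal]
  note LK = subsetD[OF coinv_kernel_superset[OF left_ideal]]
  obtain c a where a: "a \<in> torus_alg" "borel_eval \<psi> a = 0" "?P c" "?n - (?s c + a * ?n) \<in> coinv_kernel L"
    using U unfolding weight_kernel_def by blast
  obtain c' a' where a': "a' \<in> torus_alg" "borel_eval \<psi> a' = 0" "?P c'" "1 - (?s c' + a' * ?n) \<in> coinv_kernel L"
    using U unfolding weight_kernel_def by blast
  \<comment> \<open>An element that kills the multiples of \<open>weyl\<close> allowed in
    \<open>weight_kernel\<close> but acts on the class of \<open>1\<close> by a nonzero scalar. If
    \<open>\<psi>\<close> is its own inverse there are no such multiples and \<open>1\<close>
    serves; otherwise a \<open>t\<close> that separates the two weights does.\<close>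
  obtain \<tau> where \<tau>: "\<tau> \<in> torus_alg" "borel_eval \<psi> \<tau> \<noteq> 0" "\<And>c. ?P c \<Longrightarrow> \<tau> * ?s c \<in> coinv_kernel L"
  proof (cases "\<forall>t. t \<noteq> 0 \<longrightarrow> \<psi> (inverse t) = \<psi> t")
    case True
    show thesis
    proof (rule that[of 1])
      show "borel_eval \<psi> 1 \<noteq> 0"
        using borel_eval_single[of \<psi> 0 1] by (simp add: borel_coeff_def mult_charD(1)[OF mult_char])
    qed (use True LK[OF L(1)] in auto)
  next
    case False
    then obtain t where t: "t \<noteq> 0" "\<psi> (inverse t) \<noteq> \<psi> t" by blast
    let ?\<tau> = "point (diag t) - scalar (\<psi> (inverse t)) :: 'f sl2 \<Rightarrow>\<^sub>0 'k"
    show thesis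
    proof (rule that[of ?\<tau>])
      show "?\<tau> \<in> torus_alg" by (intro torus_alg_diff) auto
      show "borel_eval \<psi> ?\<tau> \<noteq> 0"
        using t by (simp add: linear_formD(5)[OF linear_form_borel_eval] borel_coeff_def mult_charD(1)[OF mult_char])
      fix c
      have "scalar c * (point weyl * point (diag (inverse t)) - scalar (\<psi> (inverse t)) * point weyl) \<in> L"
        using right_diag[of "inverse t" "point weyl"] t L(3) by auto
      moreover have "scalar c * (point weyl * point (diag (inverse t)) - scalar (\<psi> (inverse t)) * point weyl) = ?\<tau> * ?s c"
        by (simp add: left_diff_distrib right_diff_distrib mult.assoc[symmetric] mult_single diag_add_weyl mult.commute)
      ultimately show "?\<tau> * ?s c \<in> coinv_kernel L" using LK by auto
    qed
  qed
  \<comment> \<open>The relation for \<open>?n\<close> says that \<open>1 - a\<close> takes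
    \<open>?n\<close> to a multiple of \<open>weyl\<close>, which \<tau> kills; so \<open>e\<close>
    kills \<open>?n\<close>. As \<open>a\<close> has value zero under \<psi>, the value of
    \<open>e\<close> is that of \<tau>.\<close>
  define e where "e = \<tau> * (1 - a)"
  have e: "e \<in> torus_alg" unfolding e_def by (intro torus_alg_mult(1) \<tau>(1) torus_alg_diff torus_alg_one a(1))
  have e': "e = (1 - a) * \<tau>" unfolding e_def
    by (intro torus_alg_mult(2) \<tau>(1) torus_alg_diff torus_alg_one a(1))
  have ee: "borel_eval \<psi> e = borel_eval \<psi> \<tau>"
  proof -
    have "borel_eval \<psi> 1 = 1"
      using borel_eval_single[of \<psi> 0 1] by (simp add: borel_coeff_def mult_charD(1)[OF mult_char])
    thus ?thesis unfolding e_def borel_eval_torus_mult[OF \<tau>(1)]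
      by (simp add: linear_formD(5)[OF linear_form_borel_eval] a(2))
  qed
  have "\<tau> * (?n - (?s c + a * ?n)) + \<tau> * ?s c \<in> coinv_kernel L"
    by (intro K(1) K(2) a(4) \<tau>(1) \<tau>(3)[OF a(3)])
  moreover have "\<tau> * (?n - (?s c + a * ?n)) + \<tau> * ?s c = e * ?n"
    unfolding e_def right_diff_distrib distrib_left left_diff_distrib mult_1_right mult_1_left mult.assoc by simp
  ultimately have en: "e * ?n \<in> coinv_kernel L" by simp
  \<comment> \<open>The relation for \<open>1\<close> expresses it through \<open>weyl\<close> and
    \<open>?n\<close>, both killed by \<open>e\<close>, so \<open>e\<close> is zero in the
    coinvariants. But \<open>e\<close> is a nonzero scalar modulo \<open>L\<close>, which
    contradicts \<open>one_notin_coinv_kernel\<close>.\<close>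
  have "e * (1 - (?s c' + a' * ?n)) + ((1 - a) * (\<tau> * ?s c') + a' * (e * ?n)) \<in> coinv_kernel L"
    by (intro K(1) K(2) a'(4) e \<tau>(3)[OF a'(3)] en a'(1) torus_alg_diff torus_alg_one a(1))
  moreover have "e * (1 - (?s c' + a' * ?n)) + ((1 - a) * (\<tau> * ?s c') + a' * (e * ?n)) = e"
  proof -
    have "(1 - a) * (\<tau> * ?s c') = e * ?s c'" "a' * (e * ?n) = e * (a' * ?n)"
      using torus_alg_mult(2)[OF a'(1) e] by (simp_all only: e' mult.assoc[symmetric])
    thus ?thesis by (simp only: right_diff_distrib distrib_left mult_1_right) simp
  qed
  ultimately have "e \<in> coinv_kernel L" by simp
  hence "e - (e - scalar (borel_eval \<psi> e)) \<in> coinv_kernel L"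
    by (rule K(3)[OF _ LK[OF torus_alg_mod[OF e]]])
  hence "scalar (borel_eval \<psi> \<tau>) \<in> coinv_kernel L" by (simp add: ee)
  from coinv_kernel_scalar[OF left_ideal this, of "inverse (borel_eval \<psi> \<tau>)"] \<tau>(2) one_notin_coinv_kernel
  show False by (simp add: mult_single)
qed

text \<open>A form that vanishes on \<open>weight_kernel\<close> is equivariant under the Borel
  subgroup. Its \<open>form_kernel\<close> contains \<open>L\<close> and is proper because the form
  is nonzero, so maximality gives equality.\<close>

lemma exists_borel_form:
  obtains \<phi> where "borel_form \<psi> \<phi>" "L = form_kernel \<phi>"
proof -
  obtain r where r: "r \<notin> weight_kernel" using weight_kernel_proper by blast
  obtain \<phi> where \<phi>: "linear_form \<phi>" "\<And>a. a \<in> weight_kernel \<Longrightarrow> \<phi> a = 0" "\<phi> r = 1"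
    using exists_linear_form[OF _ weight_kernel_add weight_kernel_scalar r]
      weight_kernel_superset coinv_kernel_superset[OF left_ideal] L(1) by blast
  have "borel_form \<psi> \<phi>"
    unfolding borel_form_def
  proof (intro conjI allI impI \<phi>(1))
    fix x a
    have "\<phi> (point (upper x) * a - a) = 0"
      using \<phi>(2) weight_kernel_superset coinv_kernel_upper[OF left_ideal] by blast
    thus "\<phi> (point (upper x) * a) = \<phi> a" by (simp add: linear_formD(5)[OF \<phi>(1)])
  next
    fix t :: 'f and a assume "t \<noteq> 0"
    from \<phi>(2)[OF weight_kernel_diag[OF this, of a]]
    show "\<phi> (point (diag t) * a) = \<psi> t * \<phi> a"
      by (simp add: linear_formD[OF \<phi>(1)])
  qed
  moreover have "L = form_kernel \<phi>"
  proof -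
    have "\<phi> a = 0" if "a \<in> L" for a
      using that \<phi>(2) weight_kernel_superset coinv_kernel_superset[OF left_ideal] by blast
    hence "L \<subseteq> form_kernel \<phi>" using L(3) unfolding form_kernel_def by blast
    moreover have "1 \<notin> form_kernel \<phi>" using \<phi>(3) unfolding form_kernel_def by force
    ultimately show ?thesis
      using maximal left_ideal_form_kernel[OF \<phi>(1)] unfolding maximal_left_ideal_def by blast
  qed
  ultimately show thesis by (rule that)
qed

end

section \<open>Matching a simple module having a torus eigenvector with one of the models\<close>

lemma induced_ann_cong:
  fixes \<psi> \<psi>' :: "'f::field \<Rightarrow> 'k::field"
  assumes "\<And>t. t \<noteq> 0 \<Longrightarrow> \<psi> t = \<psi>' t"
  shows "induced_ann \<psi> = induced_ann \<psi>'"
proof -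
  have "borel_coeff \<psi> g = borel_coeff \<psi>' g" for g
    unfolding borel_coeff_def using assms borel_decomp(2)[of g] by auto
  hence "borel_eval \<psi> a = borel_eval \<psi>' a" for a by (simp only: borel_eval_def)
  thus ?thesis by (simp add: induced_ann_def form_kernel_def)
qed

text \<open>Multiplication by \<open>weyl\<close> separates the two terms:
  \<open>weyl + weyl\<close> lies in the Borel subgroup, \<open>weyl + upper 1 + weyl\<close> does
  not.\<close>

lemma upper_weyl_notin_induced_ann:
  fixes \<psi> :: "'f::field \<Rightarrow> 'k::field"
  assumes "mult_char \<psi>"
  shows "(point (upper 1) - 1) * point weyl \<notin> induced_ann \<psi>"
proof
  let ?e = "(point (upper 1) - 1) * point weyl :: 'f sl2 \<Rightarrow>\<^sub>0 'k"
  assume "?e \<in> induced_ann \<psi>"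
  hence "borel_eval \<psi> (point weyl * ?e) = 0" by (simp add: induced_ann_def form_kernel_def)
  moreover have "point weyl * ?e = point (weyl + upper 1 + weyl) - point (weyl + weyl)"
    by (simp add: left_diff_distrib right_diff_distrib mult_single add.assoc)
  ultimately have "borel_eval \<psi> (point (weyl + upper 1 + weyl)) - borel_eval \<psi> (point (weyl + weyl)) = 0"
    by (simp only: linear_formD[OF linear_form_borel_eval])
  thus False using mult_charD(3)[OF assms, of "- 1"] by (simp add: borel_coeff_def)
qed

text \<open>Because \<open>upper 1\<close> fixes the generator of the induced module with trivial
  character, \<open>1 - upper 1\<close> applied to \<open>eta_s\<close> and
  \<open>upper 1 - 1\<close> applied to the \<open>weyl\<close>-translate of the generator are the
  same vector.\<close>

lemma mult_upper_in_steinberg_ann_iff: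
  fixes a :: "'f::field sl2 \<Rightarrow>\<^sub>0 'k::field"
  shows "a * (1 - point (upper 1)) \<in> steinberg_ann \<longleftrightarrow>
    a * ((point (upper 1) - 1) * point weyl) \<in> induced_ann (\<lambda>_. 1)"
proof -
  let ?u = "point (upper 1) :: 'f sl2 \<Rightarrow>\<^sub>0 'k"
  let ?Z = "induced_ann (\<lambda>_. 1) :: ('f sl2 \<Rightarrow>\<^sub>0 'k) set"
  have "1 - ?u \<in> ?Z"
    using left_idealD(4)[OF left_ideal_induced_ann
        borel_stableD(2)[OF borel_stable_induced_ann[OF mult_char_trivial], of 1 1]] by simp
  hence "a * (1 - ?u) \<in> ?Z" by (rule left_idealD(3)[OF left_ideal_induced_ann])
  moreover have "a * ((1 - ?u) * (1 - point weyl)) - a * ((?u - 1) * point weyl) = a * (1 - ?u)"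
    by (simp add: algebra_simps)
  ultimately show ?thesis
    unfolding steinberg_ann_def colon_def mem_Collect_eq mult.assoc
    by (intro left_ideal_cong[OF left_ideal_induced_ann]) simp
qed

text \<open>In the last two cases \<open>y\<close> and \<open>z\<close> represent nonzero vectors of
  the given module and of the model with nested annihilators; \<open>module_isomorphic_colon\<close>
  turns this into an isomorphism.\<close>

lemma (in torus_eigenvector) eigenvector_cases:
  obtains (trivial) "\<And>g. point g - 1 \<in> L"
  | (steinberg) y z where "y \<notin> L" "z \<notin> (steinberg_ann :: ('f sl2 \<Rightarrow>\<^sub>0 'k) set)" "colon steinberg_ann z \<subseteq> colon L y"
  | (induced) \<psi>' x y z where "mult_char \<psi>'" "x \<noteq> 0" "\<psi>' x \<noteq> (1::'k)" "y \<notin> L" "z \<notin> induced_ann \<psi>'"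
      "colon (induced_ann \<psi>') z \<subseteq> colon L y"
proof -
  obtain \<phi> where \<phi>: "borel_form \<psi> \<phi>" and L_eq: "L = form_kernel \<phi>" by (rule exists_borel_form)
  note lin = linear_formD[OF borel_formD(1)[OF \<phi>]]
  note \<psi> = mult_charD[OF mult_char]
  let ?Z = "induced_ann (\<lambda>_. 1) :: ('f sl2 \<Rightarrow>\<^sub>0 'k) set"
  let ?u = "\<lambda>x. point (upper x) :: 'f sl2 \<Rightarrow>\<^sub>0 'k"
  let ?s = "point weyl :: 'f sl2 \<Rightarrow>\<^sub>0 'k"
  have L0: "\<phi> a = 0" if "a \<in> L" for a
    using that unfolding L_eq form_kernel_def by (metis (mono_tags) mem_Collect_eq mult_1_left)
  have mul: "point g * (?u x * a) = point (g + upper x) * a" for g x a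
    by (simp add: mult_single mult.assoc[symmetric])
  have pp: "point g * point h = (point (g + h) :: 'f sl2 \<Rightarrow>\<^sub>0 'k)" for g h
    by (simp add: mult_single)
  have rd: "\<phi> (point (g + diag t)) = \<psi> t * \<phi> (point g)" if "t \<noteq> 0" for g t
    using L0[OF right_diag[OF that, of "point g"]] by (simp add: lin pp)
  have ld: "\<phi> (point (diag t + g)) = \<psi> t * \<phi> (point g)" if "t \<noteq> 0" for g t
    using borel_formD(3)[OF \<phi> that, of "point g"] by (simp add: pp)
  have lu: "\<phi> (point (upper x + g)) = \<phi> (point g)" for g x
    using borel_formD(2)[OF \<phi>, of x "point g"] by (simp add: pp)
  \<comment> \<open>The function obtained from the form by translation with \<open>weyl\<close>, at
    the second fixed point of the torus and on the open orbit. On the latter it is constant, since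
    the weights \<open>\<psi> (inverse t)\<close> and \<open>\<psi> t\<close> from the two sides
    cancel.\<close>
  define \<alpha> \<beta> where "\<alpha> = \<phi> (point (weyl + weyl))" and "\<beta> = \<phi> (point (weyl + upper 1 + weyl))"
  have \<beta>: "\<phi> (point (weyl + upper y + weyl)) = \<beta>" if "y \<noteq> 0" for y
  proof -
    obtain t where t: "t\<^sup>2 = y" by (rule exists_sqrt)
    with that have t0: "t \<noteq> 0" by auto
    have "weyl + upper y + weyl = diag (inverse t) + ((weyl + upper 1 + weyl) + diag t)"
      using weyl_upper_dilate[OF t0, of 1] t by (simp add: add.assoc diag_add_weyl)
    thus ?thesis
      using ld[of "inverse t"] rd[OF t0] t0 by (simp add: \<beta>_def \<psi>(4) \<psi>(3))
  qed
  have big: "\<phi> (point (weyl + upper y + weyl)) = (if y = 0 then \<alpha> else \<beta>)" for y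
    using \<beta> by (simp add: \<alpha>_def)
  let ?e = "(?u 1 - 1) * ?s"
  show thesis
  proof (cases "\<alpha> = \<beta>")
    case False
    have \<psi>1: "\<psi> (- 1) \<noteq> 0" by (rule \<psi>(3)) simp
    \<comment> \<open>For \<open>borel_eval\<close> the two values are \<open>\<psi> (- 1)\<close>
      and \<open>0\<close>; \<kappa> is the ratio of the jumps.\<close>
    define \<kappa> where "\<kappa> = (\<alpha> - \<beta>) / \<psi> (- 1)"
    have \<kappa>: "\<kappa> \<noteq> 0" "\<kappa> * \<psi> (- 1) = \<alpha> - \<beta>" using False \<psi>1 by (auto simp: \<kappa>_def)
    have ev: "borel_eval \<psi> (point (weyl + upper y + weyl)) = (if y = 0 then \<psi> (- 1) else 0)" for y
      by (simp add: borel_coeff_def)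
    note evl = linear_formD[OF linear_form_borel_eval, of \<psi>]
    \<comment> \<open>The element \<open>?e\<close> is a difference of two
      \<open>U\<close>-translates, so only the jump between the two values matters and the forms
      become proportional.\<close>
    have eq: "\<phi> (r * ?e) = \<kappa> * borel_eval \<psi> (r * ?e)" for r
    proof (rule borel_form_eq_on_mult[OF \<phi> borel_form_borel_eval[OF mult_char]])
      show "\<phi> ?e = \<kappa> * borel_eval \<psi> ?e"
        by (simp add: left_diff_distrib lin evl pp lu) (simp add: borel_coeff_def)
      fix y
      have *: "point (weyl + upper y) * ?e = point (weyl + upper (y + 1) + weyl) - point (weyl + upper y + weyl)"
        by (simp add: left_diff_distrib right_diff_distrib pp upper_add add.assoc)
      show "\<phi> (point (weyl + upper y) * ?e) = \<kappa> * borel_eval \<psi> (point (weyl + upper y) * ?e)"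
        unfolding * lin evl big ev using \<kappa>(2) by (auto simp: right_diff_distrib)
    qed
    have Z_eq: "colon (induced_ann \<psi>) ?e = colon L ?e"
    proof -
      have "borel_eval \<psi> (r * a * ?e) = 0 \<longleftrightarrow> \<phi> (r * a * ?e) = 0" for r a
        using eq[of "r * a"] \<kappa>(1) by simp
      thus ?thesis
        unfolding colon_def L_eq induced_ann_def form_kernel_def by (simp add: mult.assoc)
    qed
    have e: "?e \<notin> induced_ann \<psi>" by (rule upper_weyl_notin_induced_ann[OF mult_char])
    moreover have "1 \<in> colon (induced_ann \<psi>) ?e \<longleftrightarrow> 1 \<in> colon L ?e" by (simp only: Z_eq)
    ultimately have e': "?e \<notin> L" by (simp add: colon_def)
    show thesis
    proof (cases "\<exists>x. x \<noteq> 0 \<and> \<psi> x \<noteq> 1")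
      case True
      then obtain x where "x \<noteq> 0" "\<psi> x \<noteq> 1" by blast
      from induced[OF mult_char this e' e] Z_eq show thesis by simp
    next
      case False
      hence Z: "induced_ann \<psi> = ?Z" by (intro induced_ann_cong) auto
      show thesis
      proof (rule steinberg[OF e'])
        show "1 - ?u 1 \<notin> steinberg_ann"
          using mult_upper_in_steinberg_ann_iff[of "1 :: 'f sl2 \<Rightarrow>\<^sub>0 'k"] e by (simp add: Z)
        show "colon steinberg_ann (1 - ?u 1) \<subseteq> colon L ?e"
          unfolding Z_eq[symmetric] Z by (auto simp: colon_def mult_upper_in_steinberg_ann_iff)
      qed
    qed
  next
    case True
    \<comment> \<open>Without a jump, differences of \<open>U\<close>-translates vanish, so
      \<open>U\<close> fixes the class of \<open>weyl\<close> and that class spans a line stable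
      under the Borel subgroup.\<close>
    have "\<phi> (r * ((?u x - 1) * ?s)) = 0" for r x
    proof (rule borel_form_zero_on_mult[OF \<phi>])
      show "\<phi> ((?u x - 1) * ?s) = 0" by (simp add: left_diff_distrib lin pp lu)
      fix y
      have "point (weyl + upper y) * ((?u x - 1) * ?s) = point (weyl + upper (y + x) + weyl) - point (weyl + upper y + weyl)"
        by (simp add: left_diff_distrib right_diff_distrib pp upper_add add.assoc)
      thus "\<phi> (point (weyl + upper y) * ((?u x - 1) * ?s)) = 0"
        by (simp only: lin big True) simp
    qed
    hence us: "(?u x - 1) * ?s \<in> L" for x by (simp add: L_eq form_kernel_def)
    have s: "?s \<notin> L"
    proof
      assume "?s \<in> L"
      from L(3)[OF this, of "point (- weyl)"] one_notin show False by (simp add: pp)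
    qed
    show thesis
    proof (cases "\<exists>x. x \<noteq> 0 \<and> \<psi> x \<noteq> 1")
      case True
      then obtain x where x: "x \<noteq> 0" "\<psi> x \<noteq> 1" by blast
      \<comment> \<open>Conjugation by \<open>weyl\<close> inverts the torus, so the line has the
        inverse character.\<close>
      define \<psi>' where "\<psi>' t = \<psi> (inverse t)" for t
      have \<psi>': "mult_char \<psi>'" unfolding mult_char_def \<psi>'_def using \<psi> by auto
      have "borel_stable \<psi>' (colon L ?s)"
        unfolding borel_stable_def
      proof (intro conjI allI impI left_ideal_colon left_ideal)
        fix t :: 'f assume "t \<noteq> 0"
        thus "point (diag t) - scalar (\<psi>' t) \<in> colon L ?s"
          using right_diag[of "inverse t" ?s] by (simp add: colon_def left_diff_distrib pp diag_add_weyl \<psi>'_def)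
      qed (use us in \<open>simp add: colon_def\<close>)
      from induced_ann_subset[OF \<psi>' this] have "colon (induced_ann \<psi>') 1 \<subseteq> colon L ?s"
        by (auto simp: colon_def)
      moreover have "\<psi>' (inverse x) \<noteq> 1" "inverse x \<noteq> 0" using x by (auto simp: \<psi>'_def)
      ultimately show thesis using induced[OF \<psi>' _ _ s one_notin_induced_ann[OF \<psi>']] by blast
    next
      case False
      hence \<psi>1: "\<psi> t = 1" if "t \<noteq> 0" for t using that by auto
      \<comment> \<open>For the trivial character the untranslated function is constant on the open
        orbit as well.\<close>
      define \<gamma> \<delta> where "\<gamma> = \<phi> ?s" and "\<delta> = \<phi> (point (weyl + upper 1))"
      have big': "\<phi> (point (weyl + upper y)) = (if y = 0 then \<gamma> else \<delta>)" for y
      proof (cases "y = 0")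
        case False
        obtain t where t: "t\<^sup>2 = y" by (rule exists_sqrt)
        with False have t0: "t \<noteq> 0" by auto
        have "weyl + upper y = diag (inverse t) + (weyl + upper 1 + diag (inverse t))"
          using weyl_upper_dilate[OF t0, of 1] t by simp
        thus ?thesis
          using ld[of "inverse t"] rd[of "inverse t"] t0 False by (simp add: \<delta>_def \<psi>1)
      qed (simp add: \<gamma>_def)
      show thesis
      proof (cases "\<gamma> = \<delta>")
        case False
        note evl = linear_formD[OF linear_form_borel_eval, of "\<lambda>_. 1"]
        have ev: "borel_eval (\<lambda>_. 1) (point (weyl + upper y + weyl)) = (if y = 0 then 1 else (0::'k))" for y
          by (simp add: borel_coeff_def)
        have \<phi>1: "borel_form (\<lambda>_. 1) \<phi>" using \<phi> \<psi>1 by (auto simp: borel_form_def)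
        \<comment> \<open>The jump of the form between \<open>weyl\<close> and the open orbit is
          matched with the jump of \<open>borel_eval\<close> at \<open>weyl + weyl\<close>;
          translation by \<open>weyl\<close> is now needed on one side only.\<close>
        have eq: "\<phi> (r * (?u 1 - 1)) = (\<gamma> - \<delta>) * borel_eval (\<lambda>_. 1) (r * ?e)" for r
        proof (rule borel_form_eq_on_mult[OF \<phi>1 borel_form_borel_eval[OF mult_char_trivial]])
          show "\<phi> (?u 1 - 1) = (\<gamma> - \<delta>) * borel_eval (\<lambda>_. 1) ?e"
            using lu[of 1 0] by (simp add: left_diff_distrib lin evl pp borel_coeff_def)
          fix y
          have 1: "point (weyl + upper y) * (?u 1 - 1) = point (weyl + upper (y + 1)) - point (weyl + upper y)"
            by (simp add: right_diff_distrib pp upper_add add.assoc)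
          have 2: "point (weyl + upper y) * ?e = point (weyl + upper (y + 1) + weyl) - point (weyl + upper y + weyl)"
            by (simp add: left_diff_distrib right_diff_distrib pp upper_add add.assoc)
          show "\<phi> (point (weyl + upper y) * (?u 1 - 1)) =
              (\<gamma> - \<delta>) * borel_eval (\<lambda>_. 1) (point (weyl + upper y) * ?e)"
            unfolding 1 2 lin evl ev big' by auto
        qed
        have Z_eq: "colon L (?u 1 - 1) = colon ?Z ?e"
        proof -
          have "\<phi> (r * a * (?u 1 - 1)) = 0 \<longleftrightarrow> borel_eval (\<lambda>_. 1) (r * a * ?e) = 0" for r a
            using eq[of "r * a"] False by simp
          thus ?thesis
            unfolding colon_def L_eq induced_ann_def form_kernel_def by (simp add: mult.assoc)
        qed
        have e: "?e \<notin> ?Z" by (rule upper_weyl_notin_induced_ann[OF mult_char_trivial])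
        moreover have "1 \<in> colon L (?u 1 - 1) \<longleftrightarrow> 1 \<in> colon ?Z ?e" by (simp only: Z_eq)
        ultimately have e': "?u 1 - 1 \<notin> L" by (simp add: colon_def)
        show thesis
        proof (rule steinberg[OF e'])
          show "1 - ?u 1 \<notin> steinberg_ann"
            using mult_upper_in_steinberg_ann_iff[of "1 :: 'f sl2 \<Rightarrow>\<^sub>0 'k"] e by simp
          show "colon steinberg_ann (1 - ?u 1) \<subseteq> colon L (?u 1 - 1)"
            unfolding Z_eq by (auto simp: colon_def mult_upper_in_steinberg_ann_iff)
        qed
      next
        case \<gamma>\<delta>: True
        have \<alpha>0: "\<alpha> = \<phi> 1"
          using ld[of "- 1" 0] \<psi>1[of "-1"] by (simp add: \<alpha>_def weyl_add_weyl)
        \<comment> \<open>The rank-one relation puts \<open>weyl + upper 1 + weyl\<close> into the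
          big cell, where the form has the single value \<gamma>. As \<alpha> is the value at the
          identity, \<open>\<alpha> = \<beta>\<close> joins the base point to the big cell and the
          function is constant.\<close>
        have "\<beta> = \<gamma>"
        proof -
          have "weyl + upper 1 + weyl = upper (- 1 :: 'f) + (weyl + diag (- 1) + upper (- 1))"
            using weyl_upper_weyl[of "1::'f"] by (simp add: add.assoc)
          also have "\<dots> = upper (- 1) + (diag (- 1) + (weyl + upper (- 1)))"
            by (simp add: weyl_add_diag add.assoc)
          finally show ?thesis unfolding \<beta>_def using big'[of "- 1"] \<gamma>\<delta> \<psi>1[of "-1"] ld[of "-1"] by (simp add: lu)
        qed
        with \<alpha>0 \<open>\<alpha> = \<beta>\<close> big' \<gamma>\<delta> have c: "\<phi> (point (weyl + upper y)) = \<phi> 1" for y by simp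
        have const: "\<phi> (point g) = \<phi> 1" for g
        proof (cases g rule: sl2_cases)
          case (1 x t)
          show ?thesis using ld[OF 1(1), of 0] \<psi>1[OF 1(1)] unfolding 1(2) by (simp add: lu)
        next
          case (2 x t y)
          have "g = upper x + (diag t + (weyl + upper y))" unfolding 2(2) by (simp add: add.assoc)
          thus ?thesis using ld[OF 2(1), of "weyl + upper y"] \<psi>1[OF 2(1)] c by (simp add: lu)
        qed
        have "\<phi> (r * (point g - 1)) = 0" for r g
          by (rule linear_form_zero_on_mult[OF borel_formD(1)[OF \<phi>]])
            (simp add: right_diff_distrib lin pp const)
        hence "point g - 1 \<in> L" for g by (simp add: L_eq form_kernel_def)
        thus thesis by (rule trivial)
      qed
    qed
  qed
qed

section \<open>Finite subfields of an algebraic closure of a prime field\<close>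

text \<open>In an algebraic closure of the prime field this is the finite field of degree
  \<open>n\<close> over it.\<close>

definition frobenius_fixed :: "nat \<Rightarrow> 'f::field set" where
  "frobenius_fixed n = {x. x ^ (CHAR('f) ^ n) = x}"

lemma frobenius_add:
  fixes x y :: "'f::field"
  assumes "Factorial_Ring.prime CHAR('f)"
  shows "(x + y) ^ (CHAR('f) ^ n) = x ^ (CHAR('f) ^ n) + y ^ (CHAR('f) ^ n)"
  using assms by (rule freshmans_dream') simp

lemma frobenius_diff:
  fixes x y :: "'f::field"
  assumes "Factorial_Ring.prime CHAR('f)"
  shows "(x - y) ^ (CHAR('f) ^ n) = x ^ (CHAR('f) ^ n) - y ^ (CHAR('f) ^ n)"
  using frobenius_add[OF assms, of "x - y" y n] by (simp add: algebra_simps)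

lemma finite_subfield_frobenius_fixed:
  assumes "Factorial_Ring.prime CHAR('f::field)" "n > 0"
  shows "finite_subfield (frobenius_fixed n :: 'f set)"
proof -
  let ?q = "CHAR('f) ^ n"
  have q: "?q > 1" using prime_gt_1_nat[OF assms(1)] assms(2) by (rule one_less_power)
  let ?P = "Polynomial.monom 1 ?q - Polynomial.monom 1 1 :: 'f poly"
  have "Polynomial.coeff ?P ?q = 1" using q by simp
  hence "?P \<noteq> 0" by (metis coeff_0 zero_neq_one)
  from poly_roots_finite[OF this] have "finite (frobenius_fixed n :: 'f set)"
    by (simp add: frobenius_fixed_def poly_monom)
  thus ?thesis
    by (auto simp: finite_subfield_def frobenius_fixed_def frobenius_diff[OF assms(1)] power_mult_distrib power_inverse)
qed

text \<open>Iterating the Frobenius power shows it. Two such fields thus lie in the one belonging to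
  the product of their exponents, so finite sets can be collected in a single field.\<close>

lemma frobenius_fixed_mult: "frobenius_fixed n \<subseteq> (frobenius_fixed (n * m) :: 'f::field set)"
proof
  fix x :: 'f assume "x \<in> frobenius_fixed n"
  hence "x ^ (CHAR('f) ^ n) = x" by (simp add: frobenius_fixed_def)
  hence "x ^ ((CHAR('f) ^ n) ^ m) = x" by (induction m) (simp_all add: power_mult)
  thus "x \<in> frobenius_fixed (n * m)" by (simp add: frobenius_fixed_def power_mult)
qed

text \<open>The Frobenius map permutes the finitely many roots of a polynomial over the prime field.\<close>
lemma ex_frobenius_fixed:
  fixes x :: "'p::prime_card Fp_closure"
  shows "\<exists>n>0. x \<in> frobenius_fixed n"
proof -
  define p where "p = CHAR('p Fp_closure)"
  have p: "p = CARD('p)" "Factorial_Ring.prime p" by (simp_all add: p_def prime_card)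
  note dream = freshmans_dream_sum[OF p(2)[unfolded p_def] p_def]
  obtain q :: "'p mod_ring poly" where q: "q \<noteq> 0" "poly (map_poly to_ac q) x = 0"
    by (rule alg_closure_algebraic)
  let ?P = "map_poly to_ac q"
  \<comment> \<open>The coefficients come from the prime field, so the Frobenius map fixes
    them.\<close>
  have c: "Polynomial.coeff ?P i ^ p = Polynomial.coeff ?P i" for i
    using finite_field_power_card_eq_same[of "Polynomial.coeff q i"]
    by (simp add: coeff_map_poly p(1) flip: to_ac_power)
  have "poly ?P (y ^ p) = poly ?P y ^ p" for y
  proof -
    have "poly ?P y ^ p = (\<Sum>i\<le>Polynomial.degree ?P. (Polynomial.coeff ?P i * y ^ i) ^ p)"
      unfolding poly_altdef by (rule dream)
    also have "\<dots> = poly ?P (y ^ p)"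
      unfolding poly_altdef by (intro sum.cong refl) (simp add: power_mult_distrib c flip: power_mult, simp add: mult.commute)
    finally show ?thesis ..
  qed
  note P = this
  have "poly ?P (x ^ (p ^ i)) = 0" for i
  proof (induction i)
    case (Suc i)
    have "x ^ (p ^ Suc i) = (x ^ (p ^ i)) ^ p" by (simp add: mult.commute flip: power_mult)
    with Suc P[of "x ^ (p ^ i)"] p(2) show ?case
      by (simp add: prime_gt_0_nat)
  qed (use q(2) in simp)
  hence "range (\<lambda>i. x ^ (p ^ i)) \<subseteq> {y. poly ?P y = 0}" by auto
  moreover have "?P \<noteq> 0"
    using q(1) by (auto simp: poly_eq_iff coeff_map_poly)
  ultimately have "finite (range (\<lambda>i. x ^ (p ^ i)))"
    using poly_roots_finite finite_subset by blast
  hence "\<not> inj (\<lambda>i. x ^ (p ^ i))" using finite_imageD infinite_UNIV_nat by blast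
  then obtain i j where ij: "i < j" "x ^ (p ^ i) = x ^ (p ^ j)"
    by (metis (no_types, lifting) injI linorder_neqE_nat)
  \<comment> \<open>A coincidence among the iterates is pulled back to the start: powers of
    Frobenius are additive and, in a field, injective.\<close>
  have "(x ^ (p ^ (j - i)) - x) ^ (p ^ i) = x ^ (p ^ (j - i) * p ^ i) - x ^ (p ^ i)"
    using frobenius_diff[OF p(2)[unfolded p_def], of "x ^ (p ^ (j - i))" x i] by (simp add: p_def power_mult)
  also have "p ^ (j - i) * p ^ i = p ^ j" using ij(1) by (simp flip: power_add)
  finally have "x ^ (p ^ (j - i)) = x" using ij(2) by simp
  thus ?thesis using ij(1) by (intro exI[of _ "j - i"]) (simp add: frobenius_fixed_def p_def)
qed

text \<open>If the characteristic of \<open>'k\<close> divided \<open>card V\<close>, it would be a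
  prime \<open>?r\<close> because \<open>card V\<close> is positive, and Sylow's theorem would give
  a subgroup of order \<open>?r\<close> in the additive group. Its elements are killed by
  \<open>?r\<close>, which is invertible in \<open>'f\<close>.\<close>

lemma card_finite_subfield_neq_0:
  assumes V: "finite_subfield (V :: 'f::field set)" and F: "Factorial_Ring.prime CHAR('f)" and ne: "CHAR('k::field) \<noteq> CHAR('f)"
  shows "of_nat (card V) \<noteq> (0::'k)"
proof
  note V' = finite_subfieldD[OF V]
  let ?r = "CHAR('k)"
  assume "of_nat (card V) = (0::'k)"
  hence dvd: "?r dvd card V" by (simp add: of_nat_eq_0_iff_char_dvd)
  moreover have "card V > 0" using V' by (auto simp: card_gt_0_iff)
  ultimately have "?r > 0" by (auto intro: Nat.gr0I)
  hence r: "Factorial_Ring.prime ?r" by (rule prime_CHAR_semidom)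
  define G where "G = \<lparr>carrier = V, monoid.mult = (+), one = (0::'f)\<rparr>"
  interpret G: group G
    by (rule groupI) (use V' in \<open>auto simp: G_def add.assoc intro!: bexI[of _ "- _"]\<close>)
  obtain m where "card V = ?r * m" using dvd by blast
  then obtain H where H: "subgroup H G" "card H = ?r"
    using sylow_thm[of ?r G 1 m] r V' G.group_axioms by (auto simp: G_def order_def)
  have "H \<subseteq> {0}"
  proof
    fix x assume "x \<in> H"
    interpret H: group "G\<lparr>carrier := H\<rparr>" by (rule subgroup.subgroup_is_group[OF H(1) G.group_axioms])
    have "x [^]\<^bsub>G\<lparr>carrier := H\<rparr>\<^esub> order (G\<lparr>carrier := H\<rparr>) = 0"
      using H.pow_order_eq_1[of x] \<open>x \<in> H\<close> by (simp add: G_def)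
    moreover have "x [^]\<^bsub>G\<lparr>carrier := H\<rparr>\<^esub> (k::nat) = of_nat k * x" for k
      by (induction k) (simp_all add: G_def nat_pow_def algebra_simps)
    ultimately have "of_nat ?r * x = 0" using H(2) by (simp add: order_def)
    moreover have "of_nat ?r \<noteq> (0::'f)"
      using r F ne primes_dvd_imp_eq[of "CHAR('f)" ?r] by (auto simp: of_nat_eq_0_iff_char_dvd)
    ultimately show "x \<in> {0}" by simp
  qed
  hence "card H \<le> card {0::'f}" by (intro card_mono) auto
  with H(2) prime_gt_1_nat[OF r] show False by simp
qed

lemma locally_finite_Fp_closure:
  assumes "CHAR('k::field) \<noteq> CARD('p::prime_card)"
  shows "locally_finite_fields TYPE('p Fp_closure) TYPE('k)"
proof
  fix A :: "'p Fp_closure set" assume "finite A"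
  hence "\<exists>n>0. A \<subseteq> frobenius_fixed n"
  proof (induction A)
    case empty
    show ?case by (intro exI[of _ 1]) simp
  next
    case (insert x A)
    obtain n m where "n > 0" "A \<subseteq> frobenius_fixed n" "m > 0" "x \<in> frobenius_fixed m"
      using insert.IH ex_frobenius_fixed by blast
    moreover have "frobenius_fixed n \<subseteq> (frobenius_fixed (n * m) :: 'p Fp_closure set)"
      "frobenius_fixed m \<subseteq> (frobenius_fixed (n * m) :: 'p Fp_closure set)"
      using frobenius_fixed_mult[of n m] frobenius_fixed_mult[of m n] by (simp_all add: mult.commute)
    ultimately show ?case by (intro exI[of _ "n * m"]) auto
  qed
  then obtain n where n: "n > 0" "A \<subseteq> frobenius_fixed n" by blast
  have "finite_subfield (frobenius_fixed n :: 'p Fp_closure set)"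
    by (rule finite_subfield_frobenius_fixed[OF _ n(1)]) (simp add: prime_card)
  moreover from card_finite_subfield_neq_0[OF this, where 'k = 'k] assms
  have "of_nat (card (frobenius_fixed n :: 'p Fp_closure set)) \<noteq> (0::'k)" by (simp add: prime_card)
  ultimately show "\<exists>V. A \<subseteq> V \<and> finite_subfield V \<and> of_nat (card V) \<noteq> (0::'k)" using n by blast
qed

section \<open>Cyclic modules and their annihilators\<close>

text \<open>The bridge from the group algebra with convolution product over the type
  \<open>sl2\<close> to \<open>group_algebra SL2\<close> over matrices.\<close>

abbreviation sl2_to_mat :: "('f::field sl2 \<Rightarrow>\<^sub>0 'k::field) \<Rightarrow> ('f ^ 2 ^ 2 \<Rightarrow>\<^sub>0 'k)" where
  "sl2_to_mat \<equiv> push matrix_of"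

lemma matrix_of_zero: "matrix_of 0 = Finite_Cartesian_Product.mat 1"
  by (simp add: zero_sl2.rep_eq)

lemma matrix_of_plus: "matrix_of (g + h) = matrix_of g ** matrix_of h"
  by (simp add: plus_sl2.rep_eq)

lemma inj_matrix_of: "inj matrix_of"
  by (auto intro: injI simp: matrix_of_inject)

lemma SL2_simps [simp]:
  "carrier SL2 = {A. Determinants.det A = 1}" "x \<otimes>\<^bsub>SL2\<^esub> y = x ** y" "\<one>\<^bsub>SL2\<^esub> = Finite_Cartesian_Product.mat 1"
  by (simp_all add: SL2_def)

lemma group_algebra_simps [simp]:
  "carrier (group_algebra G) = {a. keys a \<subseteq> carrier G}"
  "\<zero>\<^bsub>group_algebra G\<^esub> = 0" "\<one>\<^bsub>group_algebra G\<^esub> = single \<one>\<^bsub>G\<^esub> 1"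
  "a \<oplus>\<^bsub>group_algebra G\<^esub> b = a + b"
  by (simp_all add: group_algebra_def)

lemma sl2_to_mat_inject: "sl2_to_mat a = sl2_to_mat b \<longleftrightarrow> a = b"
  using push_eq_0_iff[OF inj_matrix_of, of "a - b"] by (simp add: push_diff)

lemma push_onto:
  assumes "keys a \<subseteq> h ` S"
  obtains b where "a = push h b" "keys b \<subseteq> S"
proof -
  let ?h = "inv_into S h"
  have h: "h (?h x) = x" "?h x \<in> S" if "x \<in> keys a" for x
    using that assms by (auto intro!: f_inv_into_f inv_into_into)
  let ?b = "push ?h a"
  have "push h ?b = (\<Sum>x\<in>keys a. single (h (?h x)) (lookup a x))"
    by (subst push_def[of ?h]) (simp add: push_sum)
  also have "\<dots> = (\<Sum>x\<in>keys a. single x (lookup a x))"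
    by (intro sum.cong refl) (simp add: h)
  also have "\<dots> = a" using poly_mapping_eq_sum_single[OF finite_keys order_refl, of a] by simp
  finally have "a = push h ?b" ..
  moreover have "keys ?b \<subseteq> S" using keys_push[of ?h a] h(2) by blast
  ultimately show thesis by (rule that)
qed

lemma range_matrix_of: "range matrix_of = carrier SL2"
  using type_definition.Rep_range[OF type_definition_sl2] by simp

lemma sl2_to_mat_in_carrier [simp]: "sl2_to_mat a \<in> carrier (group_algebra SL2)"
  using keys_push[of matrix_of a] range_matrix_of by auto

lemma carrier_group_algebra_SL2:
  "carrier (group_algebra SL2 :: ('f::field ^ 2 ^ 2 \<Rightarrow>\<^sub>0 'k::field) ring) = range sl2_to_mat"
proof
  show "carrier (group_algebra SL2 :: ('f ^ 2 ^ 2 \<Rightarrow>\<^sub>0 'k) ring) \<subseteq> range sl2_to_mat"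
  proof
    fix a :: "'f ^ 2 ^ 2 \<Rightarrow>\<^sub>0 'k" assume "a \<in> carrier (group_algebra SL2)"
    hence "keys a \<subseteq> matrix_of ` UNIV" unfolding range_matrix_of by simp
    thus "a \<in> range sl2_to_mat" by (rule push_onto) auto
  qed
  show "range sl2_to_mat \<subseteq> carrier (group_algebra SL2 :: ('f ^ 2 ^ 2 \<Rightarrow>\<^sub>0 'k) ring)"
    using sl2_to_mat_in_carrier by blast
qed

lemma group_algebra_mult_eq_sum:
  assumes "finite S" "keys a \<subseteq> S" "finite T" "keys b \<subseteq> T"
  shows "a \<otimes>\<^bsub>group_algebra G\<^esub> b = (\<Sum>x\<in>S. \<Sum>y\<in>T.
    single (x \<otimes>\<^bsub>G\<^esub> y) (lookup a x * lookup b y))"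
proof -
  have "(\<Sum>x\<in>S. \<Sum>y\<in>T. single (x \<otimes>\<^bsub>G\<^esub> y) (lookup a x * lookup b y)) =
    (\<Sum>x\<in>S. \<Sum>y\<in>keys b.
      single (x \<otimes>\<^bsub>G\<^esub> y) (lookup a x * lookup b y))"
    using assms by (intro sum.cong refl sum.mono_neutral_right) (auto simp: in_keys_iff)
  also have "\<dots> = (\<Sum>x\<in>keys a. \<Sum>y\<in>keys b.
      single (x \<otimes>\<^bsub>G\<^esub> y) (lookup a x * lookup b y))"
    using assms by (intro sum.mono_neutral_right) (auto simp: in_keys_iff)
  finally show ?thesis by (simp add: group_algebra_def)
qed

lemma group_algebra_mult_single:
  "single x c \<otimes>\<^bsub>group_algebra G\<^esub> single y d = single (x \<otimes>\<^bsub>G\<^esub> y) (c * d)"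
  by (subst group_algebra_mult_eq_sum[of "{x}" _ "{y}"]) auto

lemma group_algebra_mult_add_left:
  "(a + a') \<otimes>\<^bsub>group_algebra G\<^esub> b = a \<otimes>\<^bsub>group_algebra G\<^esub> b + a' \<otimes>\<^bsub>group_algebra G\<^esub> b"
  using Poly_Mapping.keys_add[of a a']
  by (subst (1 2 3) group_algebra_mult_eq_sum[of "keys a \<union> keys a'" _ "keys b"])
    (auto simp: lookup_add distrib_right single_add sum.distrib)

lemma group_algebra_mult_add_right:
  "a \<otimes>\<^bsub>group_algebra G\<^esub> (b + b') = a \<otimes>\<^bsub>group_algebra G\<^esub> b + a \<otimes>\<^bsub>group_algebra G\<^esub> b'"
  using Poly_Mapping.keys_add[of b b']
  by (subst (1 2 3) group_algebra_mult_eq_sum[of "keys a" _ "keys b \<union> keys b'"])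
    (auto simp: lookup_add distrib_left single_add sum.distrib)

lemma sl2_to_mat_mult: "sl2_to_mat (a * b) = sl2_to_mat a \<otimes>\<^bsub>group_algebra SL2\<^esub> sl2_to_mat b"
proof (induction a rule: single_add_induct)
  case (single x c)
  show ?case
    by (induction b rule: single_add_induct)
      (simp_all add: mult_single group_algebra_mult_single matrix_of_plus distrib_left push_add group_algebra_mult_add_right)
qed (simp add: distrib_right push_add group_algebra_mult_add_left)

lemma sl2_to_mat_one: "sl2_to_mat 1 = \<one>\<^bsub>group_algebra SL2\<^esub>"
  unfolding single_one[symmetric] push_single by (simp add: matrix_of_zero)

lemma ring_group_algebra_SL2: "Ring.ring (group_algebra SL2 :: ('f::field ^ 2 ^ 2 \<Rightarrow>\<^sub>0 'k::field) ring)"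
proof (rule ringI)
  let ?A = "group_algebra SL2 :: ('f ^ 2 ^ 2 \<Rightarrow>\<^sub>0 'k) ring"
  have ex: "\<exists>a'. a = sl2_to_mat a'" if "a \<in> carrier ?A" for a
    using that carrier_group_algebra_SL2 by blast
  have neg: "- a \<in> carrier ?A" if "a \<in> carrier ?A" for a using that by simp
  show "abelian_group ?A"
  proof (rule abelian_groupI)
    fix a b assume "a \<in> carrier ?A" "b \<in> carrier ?A"
    thus "a \<oplus>\<^bsub>?A\<^esub> b \<in> carrier ?A" using Poly_Mapping.keys_add[of a b] by auto
  next
    fix a assume "a \<in> carrier ?A"
    thus "\<exists>y\<in>carrier ?A. y \<oplus>\<^bsub>?A\<^esub> a = \<zero>\<^bsub>?A\<^esub>" using neg by (intro bexI[of _ "- a"]) auto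
  qed (auto simp: add_ac)
  show "Group.monoid ?A"
  proof (rule Group.monoidI)
    fix a b c assume *: "a \<in> carrier ?A" "b \<in> carrier ?A"
    then obtain a' b' where ab: "a = sl2_to_mat a'" "b = sl2_to_mat b'" using ex by metis
    show "a \<otimes>\<^bsub>?A\<^esub> b \<in> carrier ?A" unfolding ab sl2_to_mat_mult[symmetric] by (rule sl2_to_mat_in_carrier)
    assume "c \<in> carrier ?A"
    then obtain c' where c: "c = sl2_to_mat c'" using ex by metis
    show "a \<otimes>\<^bsub>?A\<^esub> b \<otimes>\<^bsub>?A\<^esub> c = a \<otimes>\<^bsub>?A\<^esub> (b \<otimes>\<^bsub>?A\<^esub> c)"
      unfolding ab c sl2_to_mat_mult[symmetric] by (simp add: mult.assoc)
  next
    show "\<one>\<^bsub>?A\<^esub> \<in> carrier ?A" unfolding sl2_to_mat_one[symmetric] by (rule sl2_to_mat_in_carrier)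
  next
    fix a assume "a \<in> carrier ?A"
    then obtain a' where a: "a = sl2_to_mat a'" using ex by metis
    show "\<one>\<^bsub>?A\<^esub> \<otimes>\<^bsub>?A\<^esub> a = a" "a \<otimes>\<^bsub>?A\<^esub> \<one>\<^bsub>?A\<^esub> = a"
      unfolding a sl2_to_mat_one[symmetric] sl2_to_mat_mult[symmetric] by simp_all
  qed
qed (simp_all only: group_algebra_simps(4) group_algebra_mult_add_left group_algebra_mult_add_right)

text \<open>A surjective linear map from the group algebra onto \<open>M\<close>, in other words a
  choice of the cyclic generator \<open>\<pi> 1\<close>. Simplicity and isomorphism questions about
  \<open>M\<close> thereby become questions about the left ideal \<open>ann \<pi>\<close>.\<close>

definition presents ::
    "(('f::field sl2 \<Rightarrow>\<^sub>0 'k::field) \<Rightarrow> 'm) \<Rightarrow> ('f ^ 2 ^ 2 \<Rightarrow>\<^sub>0 'k, 'm) module \<Rightarrow> bool" where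
  "presents \<pi> M \<longleftrightarrow> carrier M = range \<pi> \<and> \<pi> 0 = \<zero>\<^bsub>M\<^esub> \<and>
     (\<forall>a b. \<pi> (a + b) = \<pi> a \<oplus>\<^bsub>M\<^esub> \<pi> b) \<and> (\<forall>a b. \<pi> (a * b) = sl2_to_mat a \<odot>\<^bsub>M\<^esub> \<pi> b)"

text \<open>Phrased with \<open>\<pi> 0\<close>, so that the ideal does not mention the
  module.\<close>

definition ann :: "(('f::field sl2 \<Rightarrow>\<^sub>0 'k::field) \<Rightarrow> 'm) \<Rightarrow> ('f sl2 \<Rightarrow>\<^sub>0 'k) set" where
  "ann \<pi> = {a. \<pi> a = \<pi> 0}"

lemma presentsD:
  assumes "presents \<pi> M"
  shows "carrier M = range \<pi>" "\<pi> 0 = \<zero>\<^bsub>M\<^esub>" "\<pi> (a + b) = \<pi> a \<oplus>\<^bsub>M\<^esub> \<pi> b"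
    "sl2_to_mat a \<odot>\<^bsub>M\<^esub> \<pi> b = \<pi> (a * b)"
  using assms by (auto simp: presents_def)

lemma left_module_presented:
  fixes M :: "('f::field ^ 2 ^ 2 \<Rightarrow>\<^sub>0 'k::field, 'm) module"
  assumes "presents \<pi> M"
  shows "left_module (group_algebra SL2) M"
proof -
  note P = presentsD[OF assms]
  have ab: "abelian_group M"
  proof (rule abelian_groupI)
    have ex: "\<exists>a. x = \<pi> a" if "x \<in> carrier M" for x using that P(1) by blast
    show "\<zero>\<^bsub>M\<^esub> \<in> carrier M" using P(1,2) by (metis rangeI)
    fix x assume "x \<in> carrier M"
    then obtain a where x: "x = \<pi> a" using ex by blast
    show "\<exists>y\<in>carrier M. y \<oplus>\<^bsub>M\<^esub> x = \<zero>\<^bsub>M\<^esub>"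
      using P(3)[of "- a" a] P(1,2) by (intro bexI[of _ "\<pi> (- a)"]) (auto simp: x)
    show "\<zero>\<^bsub>M\<^esub> \<oplus>\<^bsub>M\<^esub> x = x" using P(3)[of 0 a] P(2) by (simp add: x)
    fix y assume "y \<in> carrier M"
    then obtain b where y: "y = \<pi> b" using ex by blast
    show "x \<oplus>\<^bsub>M\<^esub> y \<in> carrier M" using P(3)[of a b] P(1) by (metis x y rangeI)
    show "x \<oplus>\<^bsub>M\<^esub> y = y \<oplus>\<^bsub>M\<^esub> x" using P(3)[of a b] P(3)[of b a] by (simp add: x y add.commute)
    fix z assume "z \<in> carrier M"
    then obtain c where z: "z = \<pi> c" using ex by blast
    show "x \<oplus>\<^bsub>M\<^esub> y \<oplus>\<^bsub>M\<^esub> z = x \<oplus>\<^bsub>M\<^esub> (y \<oplus>\<^bsub>M\<^esub> z)"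
      unfolding x y z P(3)[symmetric] add.assoc ..
  qed
  let ?A = "group_algebra SL2 :: ('f ^ 2 ^ 2 \<Rightarrow>\<^sub>0 'k) ring"
  have exA: "\<exists>a'. a = sl2_to_mat a'" if "a \<in> carrier ?A" for a
    using that carrier_group_algebra_SL2 by blast
  have exM: "\<exists>a. x = \<pi> a" if "x \<in> carrier M" for x using that P(1) by blast
  show ?thesis
  proof (intro left_module.intro left_module_axioms.intro ring_group_algebra_SL2 ab)
    fix a x assume "a \<in> carrier ?A" "x \<in> carrier M"
    then obtain a' x' where ax: "a = sl2_to_mat a'" "x = \<pi> x'" using exA exM by metis
    show "a \<odot>\<^bsub>M\<^esub> x \<in> carrier M" unfolding ax P(4) P(1) by (rule rangeI)
    fix y assume "y \<in> carrier M"
    then obtain y' where y: "y = \<pi> y'" using exM by metis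
    show "a \<odot>\<^bsub>M\<^esub> (x \<oplus>\<^bsub>M\<^esub> y) = a \<odot>\<^bsub>M\<^esub> x \<oplus>\<^bsub>M\<^esub> a \<odot>\<^bsub>M\<^esub> y"
      unfolding ax y P(3)[symmetric] P(4) distrib_left ..
  next
    fix a b x assume "a \<in> carrier ?A" "b \<in> carrier ?A" "x \<in> carrier M"
    then obtain a' b' x' where abx: "a = sl2_to_mat a'" "b = sl2_to_mat b'" "x = \<pi> x'" using exA exM by metis
    show "(a \<oplus>\<^bsub>?A\<^esub> b) \<odot>\<^bsub>M\<^esub> x = a \<odot>\<^bsub>M\<^esub> x \<oplus>\<^bsub>M\<^esub> b \<odot>\<^bsub>M\<^esub> x"
      unfolding abx group_algebra_simps push_add[symmetric] P(4) P(3)[symmetric] distrib_right ..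
    show "(a \<otimes>\<^bsub>?A\<^esub> b) \<odot>\<^bsub>M\<^esub> x = a \<odot>\<^bsub>M\<^esub> (b \<odot>\<^bsub>M\<^esub> x)"
      unfolding abx sl2_to_mat_mult[symmetric] P(4) mult.assoc ..
  next
    fix x assume "x \<in> carrier M"
    then obtain x' where x: "x = \<pi> x'" using exM by metis
    show "\<one>\<^bsub>?A\<^esub> \<odot>\<^bsub>M\<^esub> x = x" unfolding x sl2_to_mat_one[symmetric] P(4) by simp
  qed
qed

lemma presented_diff_eq_0:
  assumes "presents \<pi> M"
  shows "a - b \<in> ann \<pi> \<longleftrightarrow> \<pi> a = \<pi> b"
proof
  note P = presentsD[OF assms]
  assume "a - b \<in> ann \<pi>"
  hence "\<pi> (a - b) = \<pi> 0" by (simp add: ann_def)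
  thus "\<pi> a = \<pi> b" using P(3)[of "a - b" b] P(3)[of 0 b] by simp
next
  note P = presentsD[OF assms]
  assume "\<pi> a = \<pi> b"
  thus "a - b \<in> ann \<pi>"
    using P(3)[of a "- b"] P(3)[of b "- b"] by (simp add: ann_def)
qed

lemma left_ideal_ann:
  assumes "presents \<pi> M"
  shows "left_ideal (ann \<pi>)"
  unfolding left_ideal_def ann_def
proof (intro conjI ballI allI)
  note P = presentsD[OF assms]
  fix x y a
  assume x: "x \<in> {a. \<pi> a = \<pi> 0}"
  show "a * x \<in> {a. \<pi> a = \<pi> 0}" using P(4)[of a x] P(4)[of a 0] x by simp
  assume "y \<in> {a. \<pi> a = \<pi> 0}"
  thus "x + y \<in> {a. \<pi> a = \<pi> 0}" using P(3)[of x y] P(3)[of 0 0] x by simp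
qed simp

lemma submodule_presented:
  fixes M :: "('f::field ^ 2 ^ 2 \<Rightarrow>\<^sub>0 'k::field, 'm) module"
  assumes "presents \<pi> M" "left_ideal L"
  shows "submodule (\<pi> ` L) (group_algebra SL2) M"
proof -
  note P = presentsD[OF assms(1)] and L = left_idealD[OF assms(2)]
  interpret left_module "group_algebra SL2" M by (rule left_module_presented[OF assms(1)])
  show ?thesis
  proof (intro submodule.intro subgroup.intro submodule_axioms.intro)
    fix x assume "x \<in> \<pi> ` L"
    then obtain a where a: "a \<in> L" "x = \<pi> a" by blast
    have "inv\<^bsub>add_monoid M\<^esub> x = \<pi> (- a)"
      using P(3)[of "- a" a] P(1,2) by (intro group.inv_equality[OF M.a_group]) (auto simp: a(2))
    thus "inv\<^bsub>add_monoid M\<^esub> x \<in> \<pi> ` L" using L(4)[OF a(1)] by blast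
  next
    fix a x assume "a \<in> carrier (group_algebra SL2 :: ('f ^ 2 ^ 2 \<Rightarrow>\<^sub>0 'k) ring)" "x \<in> \<pi> ` L"
    then obtain a' b where "a = sl2_to_mat a'" "b \<in> L" "x = \<pi> b"
      unfolding carrier_group_algebra_SL2 by blast
    thus "a \<odot>\<^bsub>M\<^esub> x \<in> \<pi> ` L" using P(4) L(3) by auto
  qed (use P L in \<open>auto simp: P(3)[symmetric] P(2)[symmetric]\<close>)
qed

lemma left_ideal_preimage:
  assumes "presents \<pi> M" "submodule H (group_algebra SL2) M"
  shows "left_ideal {a. \<pi> a \<in> H}"
proof -
  note P = presentsD[OF assms(1)]
  interpret H: submodule H "group_algebra SL2" M by (rule assms(2))
  show ?thesis
    unfolding left_ideal_def
    using H.one_closed H.m_closed H.smult_closed[OF sl2_to_mat_in_carrier] P(2,3) by (auto simp: P(4)[symmetric])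
qed

text \<open>Preimages of submodules are left ideals containing \<open>ann \<pi>\<close>, and by
  maximality such an ideal is \<open>ann \<pi>\<close> or everything.\<close>

lemma simple_module_presented:
  fixes M :: "('f::field ^ 2 ^ 2 \<Rightarrow>\<^sub>0 'k::field, 'm) module"
  assumes "presents \<pi> M" "maximal_left_ideal (ann \<pi>)"
  shows "simple_module (group_algebra SL2) M"
  unfolding simple_module_def
proof (intro conjI allI impI left_module_presented[OF assms(1)])
  note P = presentsD[OF assms(1)]
  have "\<pi> 1 \<noteq> \<pi> 0" using assms(2) by (auto simp: maximal_left_ideal_def ann_def)
  thus "carrier M \<noteq> {\<zero>\<^bsub>M\<^esub>}" using P(1,2) by auto
  fix H assume H: "submodule H (group_algebra SL2) M"
  interpret H: submodule H "group_algebra SL2" M by (rule H)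
  let ?L = "{a. \<pi> a \<in> H}"
  have z: "\<pi> 0 \<in> H" using H.one_closed P(2) by simp
  have li: "left_ideal ?L" by (rule left_ideal_preimage[OF assms(1) H])
  have sub: "H \<subseteq> range \<pi>" using H.subset P(1) by simp
  show "H = {\<zero>\<^bsub>M\<^esub>} \<or> H = carrier M"
  proof (cases "?L = ann \<pi>")
    case True
    have "H \<subseteq> {\<pi> 0}"
    proof
      fix x assume "x \<in> H"
      then obtain a where "x = \<pi> a" "\<pi> a \<in> H" using sub by blast
      with True show "x \<in> {\<pi> 0}" by (auto simp: ann_def)
    qed
    with z show ?thesis using P(2) by auto
  next
    case False
    hence "ann \<pi> \<subset> ?L" using z by (auto simp: ann_def)
    hence "1 \<in> ?L" using assms(2) li by (auto simp: maximal_left_ideal_def)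
    hence "a * 1 \<in> ?L" for a by (rule left_idealD(3)[OF li])
    thus ?thesis using sub P(1) by auto
  qed
qed

lemma presents_cyclic:
  fixes M :: "('f::field ^ 2 ^ 2 \<Rightarrow>\<^sub>0 'k::field, 'm) module"
  assumes "simple_module (group_algebra SL2) M" "m \<in> carrier M" "m \<noteq> \<zero>\<^bsub>M\<^esub>"
  defines "\<pi> \<equiv> \<lambda>a. sl2_to_mat a \<odot>\<^bsub>M\<^esub> m"
  shows "presents \<pi> M" "maximal_left_ideal (ann \<pi>)"
proof -
  let ?A = "group_algebra SL2 :: ('f ^ 2 ^ 2 \<Rightarrow>\<^sub>0 'k) ring"
  interpret left_module ?A M using assms(1) by (simp add: simple_module_def)
  have simple: "H = {\<zero>\<^bsub>M\<^esub>} \<or> H = carrier M" if "submodule H ?A M" for H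
    using assms(1) that by (simp add: simple_module_def)
  have cl: "sl2_to_mat a \<in> carrier ?A" for a :: "'f sl2 \<Rightarrow>\<^sub>0 'k" by (rule sl2_to_mat_in_carrier)
  have m1: "\<pi> 1 = m" unfolding \<pi>_def sl2_to_mat_one using assms(2) by (rule smult_one)
  have add: "\<pi> (a + b) = \<pi> a \<oplus>\<^bsub>M\<^esub> \<pi> b" for a b
    using smult_l_distr[OF cl cl assms(2), of a b] by (simp add: \<pi>_def push_add)
  have mult: "\<pi> (a * b) = sl2_to_mat a \<odot>\<^bsub>M\<^esub> \<pi> b" for a b
    unfolding \<pi>_def sl2_to_mat_mult using cl assms(2) by (intro smult_assoc1)
  have in_M: "\<pi> a \<in> carrier M" for a using cl assms(2) unfolding \<pi>_def by blast
  have zero: "\<pi> 0 = \<zero>\<^bsub>M\<^esub>" using add[of 0 0] in_M[of 0] M.add.r_cancel_one' by auto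
  have "submodule (range \<pi>) ?A M"
  proof (intro submodule.intro subgroup.intro submodule_axioms.intro)
    fix x assume "x \<in> range \<pi>"
    then obtain a where a: "x = \<pi> a" by blast
    have "inv\<^bsub>add_monoid M\<^esub> x = \<pi> (- a)"
      using add[of "- a" a] zero in_M by (intro group.inv_equality[OF M.a_group]) (auto simp: a)
    thus "inv\<^bsub>add_monoid M\<^esub> x \<in> range \<pi>" by blast
  next
    fix a x assume "a \<in> carrier ?A" "x \<in> range \<pi>"
    then obtain a' b where "a = sl2_to_mat a'" "x = \<pi> b"
      unfolding carrier_group_algebra_SL2 by blast
    thus "a \<odot>\<^bsub>M\<^esub> x \<in> range \<pi>" using mult by (metis rangeI)
  qed (auto simp: in_M add[symmetric] zero[symmetric])
  moreover have "range \<pi> \<noteq> {\<zero>\<^bsub>M\<^esub>}" using m1 assms(3) by (metis rangeI singletonD)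
  ultimately have "carrier M = range \<pi>" using simple by blast
  thus P: "presents \<pi> M" using zero add mult by (simp add: presents_def)
  show "maximal_left_ideal (ann \<pi>)"
    unfolding maximal_left_ideal_def
  proof (intro conjI allI impI left_ideal_ann[OF P])
    show "1 \<notin> ann \<pi>" using m1 assms(3) zero by (simp add: ann_def)
    fix L assume "left_ideal L \<and> ann \<pi> \<subset> L"
    hence L: "left_ideal L" and sub: "ann \<pi> \<subset> L" by auto
    then obtain a where "a \<in> L" "\<pi> a \<noteq> \<pi> 0" by (auto simp: ann_def)
    hence "\<pi> ` L \<noteq> {\<zero>\<^bsub>M\<^esub>}" using zero by auto
    with simple[OF submodule_presented[OF P L]] have "\<pi> 1 \<in> \<pi> ` L" using in_M by auto
    then obtain b where b: "b \<in> L" "\<pi> 1 = \<pi> b" by blast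
    hence "1 - b \<in> L" using presented_diff_eq_0[OF P, of 1 b] sub by auto
    from left_idealD(2)[OF L this b(1)] show "1 \<in> L" by simp
  qed
qed

text \<open>In the simple quotient by \<open>L\<close> the set \<open>Q\<close> applied to the class
  of \<open>y\<close> is a nonzero submodule, hence everything.\<close>

lemma maximal_left_ideal_split:
  assumes "maximal_left_ideal L" "left_ideal Q" "q0 \<in> Q" "q0 * y \<notin> L"
  obtains q l where "q \<in> Q" "l \<in> L" "1 = q * y + l"
proof -
  have L: "left_ideal L" using assms(1) by (simp add: maximal_left_ideal_def)
  note L' = left_idealD[OF L] and Q = left_idealD[OF assms(2)]
  let ?S = "{q * y + l |q l. q \<in> Q \<and> l \<in> L}"
  have "left_ideal ?S"
    unfolding left_ideal_def
  proof (intro conjI ballI allI)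
    show "0 \<in> ?S" using Q(1) L'(1) by force
    fix x x' assume "x \<in> ?S" "x' \<in> ?S"
    then obtain q l q' l' where *: "x = q * y + l" "x' = q' * y + l'" "q \<in> Q" "q' \<in> Q" "l \<in> L" "l' \<in> L" by blast
    hence "x + x' = (q + q') * y + (l + l')" by (simp add: algebra_simps)
    thus "x + x' \<in> ?S" using Q(2)[OF *(3,4)] L'(2)[OF *(5,6)] by blast
  next
    fix a x assume "x \<in> ?S"
    then obtain q l where *: "x = q * y + l" "q \<in> Q" "l \<in> L" by blast
    hence "a * x = (a * q) * y + a * l" by (simp add: algebra_simps)
    thus "a * x \<in> ?S" using Q(3)[OF *(2)] L'(3)[OF *(3)] by blast
  qed
  moreover have "L \<subset> ?S"
  proof -
    have "l \<in> ?S" if "l \<in> L" for l using that Q(1) by force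
    moreover have "q0 * y \<in> ?S" using L'(1) assms(3) by force
    ultimately show ?thesis using assms(4) by blast
  qed
  ultimately have "1 \<in> ?S" using assms(1) unfolding maximal_left_ideal_def by blast
  thus thesis using that by blast
qed

text \<open>The annihilator of any nonzero vector of a simple module is maximal.\<close>

lemma maximal_left_ideal_colon:
  assumes "maximal_left_ideal L" "y \<notin> L"
  shows "maximal_left_ideal (colon L y)"
  unfolding maximal_left_ideal_def
proof (intro conjI allI impI)
  have L: "left_ideal L" using assms(1) by (simp add: maximal_left_ideal_def)
  show "left_ideal (colon L y)" by (rule left_ideal_colon[OF L])
  show "1 \<notin> colon L y" using assms(2) by (simp add: colon_def)
  fix Q assume Q': "left_ideal Q \<and> colon L y \<subset> Q"
  hence Q: "left_ideal Q" by simp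
  obtain q0 where "q0 \<in> Q" "q0 * y \<notin> L" using Q' by (auto simp: colon_def)
  then obtain q l where *: "q \<in> Q" "l \<in> L" "1 = q * y + l"
    using maximal_left_ideal_split[OF assms(1) Q] by metis
  have "l = 1 - q * y" using *(3) by (simp add: algebra_simps)
  \<comment> \<open>Since \<open>q\<close> takes the class of \<open>y\<close> to that of
    \<open>1\<close>, the product \<open>y * q\<close> fixes the class of \<open>y\<close>; thus
    \<open>1 - y * q\<close> annihilates it and lies in \<open>Q\<close>, as does
    \<open>y * q\<close>.\<close>
  hence "(1 - y * q) * y = y * l" by (simp only: left_diff_distrib right_diff_distrib mult.assoc mult_1_left mult_1_right)
  hence "1 - y * q \<in> colon L y" using left_idealD(3)[OF L *(2), of y] by (simp add: colon_def)
  hence "1 - y * q \<in> Q" using Q' by blast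
  from left_idealD(2)[OF Q this left_idealD(3)[OF Q *(1), of y]] show "1 \<in> Q" by simp
qed

lemma presents_colon:
  fixes M :: "('f::field ^ 2 ^ 2 \<Rightarrow>\<^sub>0 'k::field, 'm) module"
  assumes "presents \<pi> M" "maximal_left_ideal (ann \<pi>)" "y \<notin> ann \<pi>"
  shows "presents (\<lambda>a. \<pi> (a * y)) M" "ann (\<lambda>a. \<pi> (a * y)) = colon (ann \<pi>) y"
proof -
  note P = presentsD[OF assms(1)]
  show "ann (\<lambda>a. \<pi> (a * y)) = colon (ann \<pi>) y"
    by (auto simp: ann_def colon_def)
  have "\<exists>b. \<pi> a = \<pi> (b * y)" for a
  proof -
    have U: "left_ideal UNIV" by (simp add: left_ideal_def)
    have "1 * y \<notin> ann \<pi>" using assms(3) by simp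
    then obtain q l where *: "l \<in> ann \<pi>" "1 = q * y + l"
      using maximal_left_ideal_split[OF assms(2) U UNIV_I] by metis
    have "a - (a * q) * y = a * (1 - q * y)" by (simp add: right_diff_distrib mult.assoc)
    also have "1 - q * y = l" using *(2) by (simp add: algebra_simps)
    finally have "a - (a * q) * y \<in> ann \<pi>"
      using left_idealD(3)[OF left_ideal_ann[OF assms(1)] *(1)] by simp
    hence "\<pi> a = \<pi> ((a * q) * y)" using presented_diff_eq_0[OF assms(1)] by blast
    thus ?thesis ..
  qed
  hence "range \<pi> = range (\<lambda>a. \<pi> (a * y))" by blast
  thus "presents (\<lambda>a. \<pi> (a * y)) M"
    using P unfolding presents_def by (auto simp: distrib_right mult.assoc)
qed

lemma module_isomorphic_presented:
  fixes M :: "('f::field ^ 2 ^ 2 \<Rightarrow>\<^sub>0 'k::field, 'm) module" and N :: "('f ^ 2 ^ 2 \<Rightarrow>\<^sub>0 'k, 'n) module"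
  assumes M: "presents \<pi> M" and N: "presents \<rho> N" and eq: "ann \<pi> = ann \<rho>"
  shows "module_isomorphic (group_algebra SL2) M N"
proof -
  note P = presentsD[OF M] and Q = presentsD[OF N]
  have iff: "\<pi> a = \<pi> b \<longleftrightarrow> \<rho> a = \<rho> b" for a b
    using presented_diff_eq_0[OF M, of a b] presented_diff_eq_0[OF N, of a b] eq by simp
  define h where "h x = \<rho> (inv_into UNIV \<pi> x)" for x
  have h: "h (\<pi> a) = \<rho> a" for a
    unfolding h_def iff[symmetric] by (simp add: f_inv_into_f)
  have "h \<in> iso (add_monoid M) (add_monoid N)"
    unfolding iso_def hom_def bij_betw_def
    using iff by (auto simp: P(1) Q(1) h P(3)[symmetric] Q(3)[symmetric] inj_on_def image_iff)
  moreover have "h (a \<odot>\<^bsub>M\<^esub> x) = a \<odot>\<^bsub>N\<^esub> h x"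
    if ax: "a \<in> carrier (group_algebra SL2 :: ('f ^ 2 ^ 2 \<Rightarrow>\<^sub>0 'k) ring)" "x \<in> carrier M" for a x
  proof -
    obtain a' b where "a = sl2_to_mat a'" "x = \<pi> b"
      using ax unfolding carrier_group_algebra_SL2 P(1) by blast
    thus ?thesis by (simp add: P(4) Q(4) h)
  qed
  ultimately show ?thesis unfolding module_isomorphic_def by blast
qed

text \<open>One inclusion suffices because both annihilators are maximal. Matching a single pair of
  nonzero vectors therefore identifies two simple modules.\<close>

lemma module_isomorphic_colon:
  fixes M :: "('f::field ^ 2 ^ 2 \<Rightarrow>\<^sub>0 'k::field, 'm) module" and N :: "('f ^ 2 ^ 2 \<Rightarrow>\<^sub>0 'k, 'n) module"
  assumes M: "presents \<pi> M" "maximal_left_ideal (ann \<pi>)" "y \<notin> ann \<pi>"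
    and N: "presents \<rho> N" "maximal_left_ideal (ann \<rho>)" "z \<notin> ann \<rho>"
    and sub: "colon (ann \<rho>) z \<subseteq> colon (ann \<pi>) y"
  shows "module_isomorphic (group_algebra SL2) M N"
proof (rule module_isomorphic_presented[OF presents_colon(1)[OF M] presents_colon(1)[OF N]])
  show "ann (\<lambda>a. \<pi> (a * y)) = ann (\<lambda>a. \<rho> (a * z))"
    unfolding presents_colon(2)[OF M] presents_colon(2)[OF N]
    using maximal_left_ideal_colon[OF M(2,3)] maximal_left_ideal_colon[OF N(2,3)] sub
    unfolding maximal_left_ideal_def by blast
qed

section \<open>Extension of scalars\<close>

text \<open>The additive extension of \<open>f\<close> to the free abelian group, used to test
  elements of the tensor product against biadditive maps.\<close>

definition int_extend :: "('b \<Rightarrow> 'z::ring_1) \<Rightarrow> ('b \<Rightarrow>\<^sub>0 int) \<Rightarrow> 'z" where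
  "int_extend f u = (\<Sum>x\<in>keys u. of_int (lookup u x) * f x)"

lemma int_extend_eq_sum:
  assumes "finite S" "keys u \<subseteq> S"
  shows "int_extend f u = (\<Sum>x\<in>S. of_int (lookup u x) * f x)"
  unfolding int_extend_def using assms by (intro sum.mono_neutral_left) (auto simp: in_keys_iff)

lemma int_extend_frag_of [simp]: "int_extend f (frag_of x) = f x"
  by (subst int_extend_eq_sum[where S = "{x}"]) auto

lemma int_extend_zero [simp]: "int_extend f 0 = 0"
  by (simp add: int_extend_def)

lemma int_extend_add: "int_extend f (u + v) = int_extend f u + int_extend f v"
  using Poly_Mapping.keys_add[of u v]
  by (subst (1 2 3) int_extend_eq_sum[where S = "keys u \<union> keys v"])
    (auto simp: lookup_add distrib_right sum.distrib)

lemma int_extend_uminus: "int_extend f (- u) = - int_extend f u"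
  using int_extend_add[of f u "- u"] by (simp add: eq_neg_iff_add_eq_0 add.commute)

lemma int_extend_diff: "int_extend f (u - v) = int_extend f u - int_extend f v"
  using int_extend_add[of f u "- v"] by (simp add: int_extend_uminus)

locale scalar_extension = S: Ring.ring S for S :: "('r, 'x) ring_scheme" +
  fixes R :: "('r, 'y) ring_scheme" and N :: "('r, 'n) module"
  assumes R_subset: "carrier R \<subseteq> carrier S"
    and N_add: "\<lbrakk>n \<in> carrier N; m \<in> carrier N\<rbrakk> \<Longrightarrow> n \<oplus>\<^bsub>N\<^esub> m \<in> carrier N"
    and N_smult: "\<lbrakk>r \<in> carrier R; n \<in> carrier N\<rbrakk> \<Longrightarrow> r \<odot>\<^bsub>N\<^esub> n \<in> carrier N"
begin

abbreviation "F \<equiv> free_Abelian_group (carrier S \<times> carrier N)"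
abbreviation "K \<equiv> tensor_null S R N"
abbreviation "cls \<equiv> tensor_class S R N"
abbreviation "E \<equiv> extend_scalars S R N"
abbreviation "act a \<equiv> frag_extend (\<lambda>(b, n). frag_of (a \<otimes>\<^bsub>S\<^esub> b, n))"

lemma F_diff: "u \<in> carrier F \<Longrightarrow> v \<in> carrier F \<Longrightarrow> u - v \<in> carrier F"
  using keys_diff[of u v] by auto

lemma F_add: "u \<in> carrier F \<Longrightarrow> v \<in> carrier F \<Longrightarrow> u + v \<in> carrier F"
  using Poly_Mapping.keys_add[of u v] by auto

lemma tensor_relations_subset: "tensor_relations S R N \<subseteq> carrier F"
  unfolding tensor_relations_def
  using R_subset N_add N_smult by (auto simp del: carrier_free_Abelian_group_iff intro!: F_diff)

lemma subgroup_K: "subgroup K F"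
  unfolding tensor_null_def by (rule group.generate_is_subgroup[OF group_free_Abelian_group tensor_relations_subset])

lemma K_subset: "K \<subseteq> carrier F" by (rule subgroup.subset[OF subgroup_K])

lemma K_closed: "0 \<in> K" "u \<in> K \<Longrightarrow> v \<in> K \<Longrightarrow> u + v \<in> K" "u \<in> K \<Longrightarrow> - u \<in> K"
  "u \<in> K \<Longrightarrow> v \<in> K \<Longrightarrow> u - v \<in> K"
proof -
  show 1: "0 \<in> K" "u \<in> K \<Longrightarrow> v \<in> K \<Longrightarrow> u + v \<in> K" for u v
    using subgroup.one_closed[OF subgroup_K] subgroup.m_closed[OF subgroup_K, of u v] by auto
  show 2: "u \<in> K \<Longrightarrow> - u \<in> K" for u
    using subgroup.m_inv_closed[OF subgroup_K, of u] K_subset by fastforce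
  show "u \<in> K \<Longrightarrow> v \<in> K \<Longrightarrow> u - v \<in> K" using 1(2)[OF _ 2, of u v] by simp
qed

lemma K_relation: "u \<in> tensor_relations S R N \<Longrightarrow> u \<in> K"
  unfolding tensor_null_def by (rule generate.incl)

lemma K_induct:
  assumes "u \<in> K" "\<And>v. v \<in> tensor_relations S R N \<Longrightarrow> P v" "P 0"
    "\<And>v w. v \<in> carrier F \<Longrightarrow> w \<in> carrier F \<Longrightarrow> P v \<Longrightarrow> P w \<Longrightarrow> P (v - w)"
  shows "P u"
proof -
  let ?H = "{v \<in> carrier F. P v}"
  have neg: "P (- w)" if "w \<in> carrier F" "P w" for w using assms(4)[of 0 w] assms(3) that by simp
  have "subgroup ?H F"
  proof (rule subgroup.intro)
    fix v w assume v: "v \<in> ?H" and w: "w \<in> ?H"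
    have "P (v - - w)" using v w neg by (intro assms(4)) auto
    thus "v \<otimes>\<^bsub>F\<^esub> w \<in> ?H" using v w F_add by simp
  next
    fix v assume v: "v \<in> ?H"
    thus "inv\<^bsub>F\<^esub> v \<in> ?H" using neg by simp
  qed (use assms(3) in auto)
  moreover have "tensor_relations S R N \<subseteq> ?H" using tensor_relations_subset assms(2) by blast
  ultimately have "K \<subseteq> ?H"
    unfolding tensor_null_def by (intro group.generate_subgroup_incl[OF group_free_Abelian_group])
  with assms(1) show ?thesis by blast
qed

lemma cls_eq: "cls u = {h + u | h. h \<in> K}"
  by (auto simp: tensor_class_def r_coset_def)

lemma cls_eq_iff: "cls u = cls v \<longleftrightarrow> u - v \<in> K"
proof
  assume "cls u = cls v"
  moreover have "u \<in> cls u" using K_closed(1) by (force simp: cls_eq)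
  ultimately obtain h where "h \<in> K" "u = h + v" by (auto simp: cls_eq)
  thus "u - v \<in> K" by simp
next
  assume uv: "u - v \<in> K"
  show "cls u = cls v"
  proof (intro equalityI subsetI)
    fix x assume "x \<in> cls u"
    then obtain h where h: "h \<in> K" "x = h + u" by (auto simp: cls_eq)
    hence "x = (h + (u - v)) + v" by simp
    thus "x \<in> cls v" using K_closed(2)[OF h(1) uv] unfolding cls_eq by blast
  next
    fix x assume "x \<in> cls v"
    then obtain h where h: "h \<in> K" "x = h + v" by (auto simp: cls_eq)
    hence "x = (h - (u - v)) + u" by simp
    thus "x \<in> cls u" using K_closed(4)[OF h(1) uv] unfolding cls_eq by blast
  qed
qed

lemma carrier_E: "carrier E = cls ` carrier F"
  by (auto simp: extend_scalars_def RCOSETS_def tensor_class_def Let_def)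

lemma zero_E: "\<zero>\<^bsub>E\<^esub> = cls 0"
  by (simp add: extend_scalars_def cls_eq Let_def)

lemma add_E: "cls u \<oplus>\<^bsub>E\<^esub> cls v = cls (u + v)"
proof -
  have "cls u \<oplus>\<^bsub>E\<^esub> cls v = {h + u + (k + v) | h k. h \<in> K \<and> k \<in> K}"
    by (auto simp: extend_scalars_def set_mult_def cls_eq Let_def)
  also have "\<dots> = {h + (u + v) | h. h \<in> K}"
  proof (intro equalityI subsetI)
    fix x assume "x \<in> {h + u + (k + v) | h k. h \<in> K \<and> k \<in> K}"
    then obtain h k where "x = h + u + (k + v)" "h \<in> K" "k \<in> K" by blast
    thus "x \<in> {h + (u + v) | h. h \<in> K}"
      using K_closed(2)[of h k] by (intro CollectI exI[of _ "h + k"]) (simp add: add_ac)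
  next
    fix x assume "x \<in> {h + (u + v) | h. h \<in> K}"
    then obtain h where *: "x = h + (u + v)" "h \<in> K" by blast
    show "x \<in> {h + u + (k + v) | h k. h \<in> K \<and> k \<in> K}"
      by (intro CollectI, rule exI[of _ h], rule exI[of _ 0]) (use * K_closed(1) in \<open>simp add: add_ac\<close>)
  qed
  finally show ?thesis by (simp add: cls_eq)
qed

text \<open>Left multiplication sends each defining relation to one of the same kind, so the action
  on cosets is well defined.\<close>

lemma act_K:
  assumes a: "a \<in> carrier S" and "u \<in> K"
  shows "act a u \<in> K"
  using assms(2)
proof (rule K_induct)
  fix v assume "v \<in> tensor_relations S R N"
  from this[unfolded tensor_relations_def] have "act a v \<in> tensor_relations S R N"
  proof (elim UnE CollectE exE conjE)
    fix b c n assume 1: "v = frag_of (b \<oplus>\<^bsub>S\<^esub> c, n) - frag_of (b, n) - frag_of (c, n)"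
      "b \<in> carrier S" "c \<in> carrier S" "n \<in> carrier N"
    have eq: "act a v = frag_of (a \<otimes>\<^bsub>S\<^esub> b \<oplus>\<^bsub>S\<^esub> a \<otimes>\<^bsub>S\<^esub> c, n) - frag_of (a \<otimes>\<^bsub>S\<^esub> b, n) - frag_of (a \<otimes>\<^bsub>S\<^esub> c, n)"
      using 1 a by (simp add: frag_extend_diff S.r_distr)
    have cl: "a \<otimes>\<^bsub>S\<^esub> b \<in> carrier S" "a \<otimes>\<^bsub>S\<^esub> c \<in> carrier S" using 1 a by auto
    show ?thesis
      unfolding tensor_relations_def by (rule UnI1, rule UnI1, intro CollectI exI conjI, rule eq) (use 1 cl in auto)
  next
    fix b n m assume 2: "v = frag_of (b, n \<oplus>\<^bsub>N\<^esub> m) - frag_of (b, n) - frag_of (b, m)"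
      "b \<in> carrier S" "n \<in> carrier N" "m \<in> carrier N"
    have eq: "act a v = frag_of (a \<otimes>\<^bsub>S\<^esub> b, n \<oplus>\<^bsub>N\<^esub> m) - frag_of (a \<otimes>\<^bsub>S\<^esub> b, n) - frag_of (a \<otimes>\<^bsub>S\<^esub> b, m)"
      using 2 by (simp add: frag_extend_diff)
    have cl: "a \<otimes>\<^bsub>S\<^esub> b \<in> carrier S" using 2 a by auto
    show ?thesis
      unfolding tensor_relations_def by (rule UnI1, rule UnI2, intro CollectI exI conjI, rule eq) (use 2 cl in auto)
  next
    fix b r n assume 3: "v = frag_of (b \<otimes>\<^bsub>S\<^esub> r, n) - frag_of (b, r \<odot>\<^bsub>N\<^esub> n)"
      "b \<in> carrier S" "r \<in> carrier R" "n \<in> carrier N"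
    have eq: "act a v = frag_of (a \<otimes>\<^bsub>S\<^esub> b \<otimes>\<^bsub>S\<^esub> r, n) - frag_of (a \<otimes>\<^bsub>S\<^esub> b, r \<odot>\<^bsub>N\<^esub> n)"
      using 3 a R_subset by (simp add: frag_extend_diff S.m_assoc subset_iff)
    have cl: "a \<otimes>\<^bsub>S\<^esub> b \<in> carrier S" using 3 a by auto
    show ?thesis
      unfolding tensor_relations_def by (rule UnI2, intro CollectI exI conjI, rule eq) (use 3 cl in auto)
  qed
  thus "act a v \<in> K" by (rule K_relation)
qed (simp_all add: K_closed frag_extend_diff)

lemma smult_E:
  assumes "a \<in> carrier S"
  shows "a \<odot>\<^bsub>E\<^esub> cls u = cls (act a u)"
proof -
  have "cls (act a v) = cls (act a u)" if v: "v \<in> cls u" for v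
  proof -
    obtain h where "h \<in> K" "v = h + u" using v by (auto simp: cls_eq)
    thus ?thesis using act_K[OF assms, of h] by (simp add: cls_eq_iff frag_extend_add)
  qed
  hence "(\<Union>v\<in>cls u. cls (act a v)) = (\<Union>v\<in>cls u. cls (act a u))" by (rule SUP_cong[OF refl])
  also have "\<dots> = cls (act a u)" using K_closed(1) by (simp add: cls_eq)
  finally show ?thesis by (simp add: extend_scalars_def Let_def)
qed

lemma smult_pure_tensor:
  assumes "a \<in> carrier S"
  shows "a \<odot>\<^bsub>E\<^esub> pure_tensor S R N b n = pure_tensor S R N (a \<otimes>\<^bsub>S\<^esub> b) n"
  using smult_E[OF assms] by (simp add: pure_tensor_def)

lemma pure_tensor_add_left:
  assumes "a \<in> carrier S" "b \<in> carrier S" "n \<in> carrier N"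
  shows "pure_tensor S R N (a \<oplus>\<^bsub>S\<^esub> b) n = pure_tensor S R N a n \<oplus>\<^bsub>E\<^esub> pure_tensor S R N b n"
  unfolding pure_tensor_def add_E cls_eq_iff
  by (rule K_relation) (use assms in \<open>auto simp: tensor_relations_def algebra_simps\<close>)

lemma pure_tensor_balanced:
  assumes "a \<in> carrier S" "r \<in> carrier R" "n \<in> carrier N"
  shows "pure_tensor S R N (a \<otimes>\<^bsub>S\<^esub> r) n = pure_tensor S R N a (r \<odot>\<^bsub>N\<^esub> n)"
  unfolding pure_tensor_def cls_eq_iff
  by (rule K_relation) (use assms in \<open>auto simp: tensor_relations_def\<close>)

lemma pure_tensor_zero:
  assumes "n \<in> carrier N"
  shows "pure_tensor S R N \<zero>\<^bsub>S\<^esub> n = \<zero>\<^bsub>E\<^esub>"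
proof -
  have "frag_of (\<zero>\<^bsub>S\<^esub> \<oplus>\<^bsub>S\<^esub> \<zero>\<^bsub>S\<^esub>, n) - frag_of (\<zero>\<^bsub>S\<^esub>, n) - frag_of (\<zero>\<^bsub>S\<^esub>, n) \<in> K"
    unfolding tensor_null_def tensor_relations_def
    by (intro generate.incl UnI1 CollectI exI conjI, rule refl) (use assms in auto)
  hence "- frag_of (\<zero>\<^bsub>S\<^esub>, n) \<in> K" by simp
  from K_closed(3)[OF this] show ?thesis by (simp add: pure_tensor_def zero_E cls_eq_iff)
qed

text \<open>Ring elements can be moved across the tensor sign, so every generator becomes a pure
  tensor with second factor \<open>e\<close>, and these are closed under differences.\<close>

lemma carrier_E_cyclic:
  assumes "e \<in> carrier N" "\<And>n. n \<in> carrier N \<Longrightarrow> \<exists>r\<in>carrier R. n = r \<odot>\<^bsub>N\<^esub> e"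
  shows "carrier E = (\<lambda>a. pure_tensor S R N a e) ` carrier S"
proof (intro equalityI subsetI)
  fix x assume "x \<in> carrier E"
  then obtain u where u: "keys u \<subseteq> carrier S \<times> carrier N" "x = cls u"
    by (auto simp: carrier_E)
  from u(1) have "\<exists>a\<in>carrier S. cls u = pure_tensor S R N a e"
  proof (induction u rule: frag_induction)
    case zero
    show ?case using pure_tensor_zero[OF assms(1)] zero_E by (intro bexI[of _ "\<zero>\<^bsub>S\<^esub>"]) auto
  next
    case (diff u v)
    then obtain a b where ab: "a \<in> carrier S" "b \<in> carrier S" "cls u = pure_tensor S R N a e" "cls v = pure_tensor S R N b e"
      by blast
    define c where "c = a \<ominus>\<^bsub>S\<^esub> b"
    have c: "c \<in> carrier S" "a = c \<oplus>\<^bsub>S\<^esub> b" using ab by (auto simp: c_def S.minus_eq S.a_assoc S.l_neg)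
    have "u - (frag_of (c, e) + frag_of (b, e)) \<in> K" "v - frag_of (b, e) \<in> K"
      using pure_tensor_add_left[OF c(1) ab(2) assms(1)] ab(3,4) add_E
      by (simp_all add: c(2) pure_tensor_def flip: cls_eq_iff)
    from K_closed(4)[OF this] have "cls (u - v) = pure_tensor S R N c e"
      by (simp add: pure_tensor_def cls_eq_iff algebra_simps)
    thus ?case using c(1) by blast
  next
    case (one p)
    then obtain a n where p: "p = (a, n)" "a \<in> carrier S" "n \<in> carrier N" by auto
    obtain r where r: "r \<in> carrier R" "n = r \<odot>\<^bsub>N\<^esub> e" using assms(2)[OF p(3)] by blast
    have "cls (frag_of p) = pure_tensor S R N (a \<otimes>\<^bsub>S\<^esub> r) e"
      using pure_tensor_balanced[OF p(2) r(1) assms(1)] r(2) by (simp add: p(1) pure_tensor_def)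
    thus ?case using p(2) r(1) R_subset by blast
  qed
  thus "x \<in> (\<lambda>a. pure_tensor S R N a e) ` carrier S" using u(2) by blast
next
  fix x assume "x \<in> (\<lambda>a. pure_tensor S R N a e) ` carrier S"
  thus "x \<in> carrier E" using assms(1) by (auto simp: carrier_E pure_tensor_def intro!: imageI)
qed

text \<open>The universal property in the form used below: a balanced biadditive \<open>f\<close>
  extends to a homomorphism killing all relations, so a nonzero value of \<open>f\<close> proves a
  tensor nonzero.\<close>

lemma pure_tensor_eq_0_imp:
  fixes f :: "'r \<Rightarrow> 'n \<Rightarrow> 'z::ring_1"
  assumes "pure_tensor S R N a n = \<zero>\<^bsub>E\<^esub>"
    and "\<And>a b n. a \<in> carrier S \<Longrightarrow> b \<in> carrier S \<Longrightarrow> n \<in> carrier N \<Longrightarrow> f (a \<oplus>\<^bsub>S\<^esub> b) n = f a n + f b n"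
    and "\<And>a n m. a \<in> carrier S \<Longrightarrow> n \<in> carrier N \<Longrightarrow> m \<in> carrier N \<Longrightarrow> f a (n \<oplus>\<^bsub>N\<^esub> m) = f a n + f a m"
    and "\<And>a r n. a \<in> carrier S \<Longrightarrow> r \<in> carrier R \<Longrightarrow> n \<in> carrier N \<Longrightarrow> f (a \<otimes>\<^bsub>S\<^esub> r) n = f a (r \<odot>\<^bsub>N\<^esub> n)"
  shows "f a n = 0"
proof -
  have "frag_of (a, n) \<in> K" using assms(1) by (simp add: pure_tensor_def zero_E cls_eq_iff)
  hence "int_extend (case_prod f) (frag_of (a, n)) = 0"
  proof (rule K_induct)
    fix v assume "v \<in> tensor_relations S R N"
    thus "int_extend (case_prod f) v = 0"
      unfolding tensor_relations_def using assms(2-4) by (auto simp: int_extend_diff)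
  qed (simp_all add: int_extend_diff)
  thus ?thesis by simp
qed

end

section \<open>Torus characters and weights\<close>

text \<open>The character in the coordinate \<open>t\<close>. At \<open>0\<close> it takes its value
  at the identity, which makes \<open>diag_char_trivial\<close> an equality of total
  functions.\<close>

definition diag_char :: "('f::field ^ 2 ^ 2 \<Rightarrow> 'k) \<Rightarrow> 'f \<Rightarrow> 'k" where
  "diag_char \<theta> t = \<theta> (matrix_of (diag t))"

lemma matrix_of_diag_entries:
  "matrix_of (diag t) $ 1 $ 1 = (if t = 0 then 1 else t)" "matrix_of (diag t) $ 1 $ 2 = 0"
  "matrix_of (diag t) $ 2 $ 1 = 0" "matrix_of (diag t) $ 2 $ 2 = (if t = 0 then 1 else inverse t)"
  using entry_diag[of t] unfolding entry_def by auto

lemma diag_in_torus [simp]: "matrix_of (diag t) \<in> carrier torus"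
  by (simp add: torus_def matrix_of_diag_entries)

lemma torus_cases:
  assumes "A \<in> carrier torus"
  obtains t where "t \<noteq> 0" "A = matrix_of (diag t)"
proof -
  have A: "A \<in> range matrix_of" "A $ 1 $ 2 = 0" "A $ 2 $ 1 = 0"
    using assms unfolding range_matrix_of by (auto simp: torus_def)
  then obtain g where g: "A = matrix_of g" by blast
  have "entry g 2 1 = 0" "entry g 1 2 = 0" using A by (auto simp: g entry_def)
  from borel_decomp[OF this(1)] this(2) that[of "entry g 1 1"] show thesis by (simp add: g)
qed

lemma ball_torus_iff:
  fixes Q :: "'f::field ^ 2 ^ 2 \<Rightarrow> bool"
  shows "(\<forall>A\<in>carrier torus. Q A) \<longleftrightarrow> (\<forall>t. t \<noteq> 0 \<longrightarrow> Q (matrix_of (diag t)))"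
proof (intro iffI ballI)
  fix A :: "'f ^ 2 ^ 2"
  assume *: "\<forall>t. t \<noteq> 0 \<longrightarrow> Q (matrix_of (diag t))" "A \<in> carrier torus"
  from *(2) obtain t where "t \<noteq> 0" "A = matrix_of (diag t)" by (rule torus_cases)
  thus "Q A" using *(1) by blast
qed simp

lemma mult_char_diag_char:
  fixes \<theta> :: "'f::field ^ 2 ^ 2 \<Rightarrow> 'k::field"
  assumes "\<theta> \<in> linear_characters torus"
  shows "mult_char (diag_char \<theta>)"
proof -
  have hom: "\<theta> \<in> hom torus (mult_of ring_of_type_algebra)"
    using assms by (simp add: linear_characters_def)
  have m: "\<theta> (matrix_of (g + h)) = \<theta> (matrix_of g) * \<theta> (matrix_of h)"
    if "matrix_of g \<in> carrier torus" "matrix_of h \<in> carrier torus" for g h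
    using hom_mult[OF hom that] by (simp add: torus_def SL2_def matrix_of_plus mult_of_def ring_of_type_algebra_def)
  have nz: "diag_char \<theta> t \<noteq> 0" for t
    using hom_in_carrier[OF hom diag_in_torus[of t]] by (simp add: diag_char_def mult_of_def ring_of_type_algebra_def)
  have "diag_char \<theta> (s * t) = diag_char \<theta> s * diag_char \<theta> t" if "s \<noteq> 0" "t \<noteq> 0" for s t
    using m[OF diag_in_torus diag_in_torus] by (simp add: diag_char_def diag_mult[OF that])
  moreover from this[of 1 1] nz[of 1] have "diag_char \<theta> 1 = 1" by simp
  ultimately show ?thesis by (simp add: mult_char_def)
qed

lemma diag_char_nontrivial:
  assumes "\<theta> \<in> linear_characters torus" "\<theta> \<noteq> trivial_character"
  obtains t where "t \<noteq> 0" "diag_char \<theta> t \<noteq> 1"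
proof -
  have "\<theta> \<in> extensional (carrier torus)" "trivial_character \<in> extensional (carrier torus)"
    using assms(1) by (auto simp: linear_characters_def trivial_character_def)
  then obtain A where A: "A \<in> carrier torus" "\<theta> A \<noteq> trivial_character A"
    using assms(2) extensionalityI by metis
  from A(1) obtain t where "t \<noteq> 0" "A = matrix_of (diag t)" by (rule torus_cases)
  with A that[of t] show thesis by (auto simp: trivial_character_def diag_char_def)
qed

lemma diag_char_trivial: "diag_char trivial_character = (\<lambda>_. 1)"
  by (auto simp: diag_char_def trivial_character_def)

definition torus_char :: "('f::field \<Rightarrow> 'k::field) \<Rightarrow> 'f ^ 2 ^ 2 \<Rightarrow> 'k" where
  "torus_char \<psi> = (\<lambda>A \<in> carrier torus. \<psi> (A $ 1 $ 1))"

lemma diag_char_torus_char: "t \<noteq> 0 \<Longrightarrow> diag_char (torus_char \<psi>) t = \<psi> t"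
  by (simp add: diag_char_def torus_char_def matrix_of_diag_entries)

lemma torus_char_linear:
  fixes \<psi> :: "'f::field \<Rightarrow> 'k::field"
  assumes "mult_char \<psi>"
  shows "torus_char \<psi> \<in> linear_characters torus"
  unfolding linear_characters_def
proof (intro IntI homI)
  note \<psi> = mult_charD[OF assms]
  fix A :: "'f ^ 2 ^ 2" assume A: "A \<in> carrier torus"
  then obtain s where s: "s \<noteq> 0" "A = matrix_of (diag s)" by (rule torus_cases)
  show "torus_char \<psi> A \<in> carrier (mult_of ring_of_type_algebra)"
    using A s \<psi>(3) by (simp add: torus_char_def mult_of_def ring_of_type_algebra_def matrix_of_diag_entries)
  fix B :: "'f ^ 2 ^ 2" assume B: "B \<in> carrier torus"
  then obtain t where t: "t \<noteq> 0" "B = matrix_of (diag t)" by (rule torus_cases)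
  have "A \<otimes>\<^bsub>torus\<^esub> B = matrix_of (diag (s * t))"
    by (simp add: s t torus_def SL2_def diag_mult matrix_of_plus)
  thus "torus_char \<psi> (A \<otimes>\<^bsub>torus\<^esub> B) = torus_char \<psi> A \<otimes>\<^bsub>mult_of ring_of_type_algebra\<^esub> torus_char \<psi> B"
    using s t \<psi>(2) by (simp add: torus_char_def mult_of_def ring_of_type_algebra_def matrix_of_diag_entries)
qed (simp add: torus_char_def)

lemma trivial_character_linear:
  "(trivial_character :: 'f::field ^ 2 ^ 2 \<Rightarrow> 'k::field) \<in> linear_characters torus"
proof -
  have eq: "(trivial_character :: 'f ^ 2 ^ 2 \<Rightarrow> 'k) = torus_char (\<lambda>_. 1)"
    by (simp add: trivial_character_def torus_char_def)
  show ?thesis unfolding eq by (rule torus_char_linear[OF mult_char_trivial])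
qed

lemma weight_space_presented:
  assumes "presents \<pi> M"
  shows "\<pi> a \<in> weight_space M \<theta> \<longleftrightarrow>
    (\<forall>t. t \<noteq> 0 \<longrightarrow> (point (diag t) - scalar (diag_char \<theta> t)) * a \<in> ann \<pi>)"
proof -
  note P = presentsD[OF assms]
  have "single (matrix_of (diag t)) 1 \<odot>\<^bsub>M\<^esub> \<pi> a = \<pi> (point (diag t) * a)" for t
    using P(4)[of "point (diag t)" a] by simp
  moreover have "single \<one>\<^bsub>SL2\<^esub> (\<theta> (matrix_of (diag t))) \<odot>\<^bsub>M\<^esub> \<pi> a =
      \<pi> (scalar (diag_char \<theta> t) * a)" for t
    using P(4)[of "scalar (diag_char \<theta> t)" a] by (simp add: matrix_of_zero diag_char_def)
  moreover have "\<pi> a \<in> carrier M" using P(1) by simp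
  ultimately have "\<pi> a \<in> weight_space M \<theta> \<longleftrightarrow>
      (\<forall>t. t \<noteq> 0 \<longrightarrow> \<pi> (point (diag t) * a) = \<pi> (scalar (diag_char \<theta> t) * a))"
    unfolding weight_space_def mem_Collect_eq ball_torus_iff by simp
  thus ?thesis by (simp add: left_diff_distrib presented_diff_eq_0[OF assms])
qed

lemma admits_T_stable_linesI:
  fixes M :: "('f::field ^ 2 ^ 2 \<Rightarrow>\<^sub>0 'k::field, 'm) module"
  assumes "presents \<pi> M" "1 \<notin> ann \<pi>" "\<theta> \<in> linear_characters torus"
    "\<And>t. t \<noteq> 0 \<Longrightarrow> point (diag t) - scalar (diag_char \<theta> t) \<in> ann \<pi>"
  shows "admits_T_stable_lines M"
proof -
  note P = presentsD[OF assms(1)]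
  interpret left_module "group_algebra SL2" M by (rule left_module_presented[OF assms(1)])
  have w: "\<pi> 1 \<in> weight_space M \<theta>"
    using weight_space_presented[OF assms(1), of 1 \<theta>] assms(4) by simp
  have c: "\<pi> 1 \<in> carrier M" using P(1) by simp
  have "(\<Oplus>\<^bsub>M\<^esub>\<eta>\<in>{\<theta>}. \<pi> 1) = \<pi> 1" using c by simp
  hence "\<pi> 1 \<in> torus_weight_sum M"
    unfolding torus_weight_sum_def using w assms(3)
    by (intro CollectI exI[of _ "{\<theta>}"] exI[of _ "\<lambda>_. \<pi> 1"]) auto
  moreover have "\<pi> 1 \<noteq> \<zero>\<^bsub>M\<^esub>" using assms(2) P(2) by (simp add: ann_def)
  ultimately show ?thesis by (auto simp: admits_T_stable_lines_def)
qed

text \<open>A nonzero sum of weight vectors has a nonzero summand, and that summand generates the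
  simple module.\<close>

lemma admits_T_stable_linesE:
  fixes M :: "('f::field ^ 2 ^ 2 \<Rightarrow>\<^sub>0 'k::field, 'm) module"
  assumes "simple_module (group_algebra SL2) M" "admits_T_stable_lines M"
  obtains \<pi> \<theta> where "presents \<pi> M" "maximal_left_ideal (ann \<pi>)"
    "\<theta> \<in> linear_characters torus"
    "\<And>t. t \<noteq> 0 \<Longrightarrow> point (diag t) - scalar (diag_char \<theta> t) \<in> ann \<pi>"
proof -
  interpret left_module "group_algebra SL2" M using assms(1) by (simp add: simple_module_def)
  have "\<zero>\<^bsub>M\<^esub> \<in> torus_weight_sum M"
    unfolding torus_weight_sum_def by (intro CollectI exI[of _ "{}"] exI[of _ "\<lambda>_. \<zero>\<^bsub>M\<^esub>"]) auto
  with assms(2) obtain x where "x \<in> torus_weight_sum M" "x \<noteq> \<zero>\<^bsub>M\<^esub>"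
    by (auto simp: admits_T_stable_lines_def)
  then obtain F m where F: "finite F" "F \<subseteq> linear_characters torus" "m \<in> (\<Pi> \<theta>\<in>F. weight_space M \<theta>)"
    "(\<Oplus>\<^bsub>M\<^esub>\<theta>\<in>F. m \<theta>) \<noteq> \<zero>\<^bsub>M\<^esub>" unfolding torus_weight_sum_def by blast
  have "\<exists>\<theta>\<in>F. m \<theta> \<noteq> \<zero>\<^bsub>M\<^esub>"
  proof (rule ccontr)
    assume "\<not> ?thesis"
    hence "(\<Oplus>\<^bsub>M\<^esub>\<theta>\<in>F. m \<theta>) = (\<Oplus>\<^bsub>M\<^esub>\<theta>\<in>F. \<zero>\<^bsub>M\<^esub>)"
      by (intro M.finsum_cong') auto
    with F(4) show False by simp
  qed
  then obtain \<theta> where \<theta>: "\<theta> \<in> F" "m \<theta> \<noteq> \<zero>\<^bsub>M\<^esub>" by blast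
  have w: "m \<theta> \<in> weight_space M \<theta>" using F(3) \<theta>(1) by auto
  hence c: "m \<theta> \<in> carrier M" by (simp add: weight_space_def)
  let ?\<pi> = "\<lambda>a. sl2_to_mat a \<odot>\<^bsub>M\<^esub> m \<theta>"
  note pres = presents_cyclic[OF assms(1) c \<theta>(2)]
  have "?\<pi> 1 = m \<theta>" unfolding sl2_to_mat_one using c by (rule smult_one)
  hence "point (diag t) - scalar (diag_char \<theta> t) \<in> ann ?\<pi>" if "t \<noteq> 0" for t
    using weight_space_presented[OF pres(1), of 1 \<theta>] w that by simp
  thus thesis using that[OF pres] \<theta>(1) F(2) by blast
qed

section \<open>The modules of the classification\<close>

lemma one_dim_module_simps:
  "carrier (one_dim_module \<mu>) = UNIV" "\<zero>\<^bsub>one_dim_module \<mu>\<^esub> = 0" "x \<oplus>\<^bsub>one_dim_module \<mu>\<^esub> y = x + y"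
  by (simp_all add: one_dim_module_def)

lemma one_dim_module_smult:
  "sl2_to_mat a \<odot>\<^bsub>one_dim_module \<mu>\<^esub> c = (\<Sum>g\<in>keys a. lookup a g * \<mu> (matrix_of g)) * c"
proof -
  have "(\<Sum>x\<in>keys (sl2_to_mat a). lookup (sl2_to_mat a) x * \<mu> x) =
    (\<Sum>x\<in>matrix_of ` keys a. lookup (sl2_to_mat a) x * \<mu> x)"
    using keys_push[of matrix_of a] by (intro sum.mono_neutral_left) (auto simp: in_keys_iff)
  also have "\<dots> = (\<Sum>g\<in>keys a. lookup a g * \<mu> (matrix_of g))"
    using inj_matrix_of
    by (subst sum.reindex) (auto intro: inj_on_subset simp: lookup_push_inj[OF inj_matrix_of])
  finally show ?thesis by (simp add: one_dim_module_def)
qed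

definition augmentation :: "('a \<Rightarrow>\<^sub>0 'k::comm_monoid_add) \<Rightarrow> 'k" where
  "augmentation a = (\<Sum>g\<in>keys a. lookup a g)"

lemma augmentation_single [simp]: "augmentation (single g c) = c"
  by (simp add: augmentation_def)

lemma augmentation_add:
  fixes a b :: "'a \<Rightarrow>\<^sub>0 'k::comm_monoid_add"
  shows "augmentation (a + b) = augmentation a + augmentation b"
proof -
  have *: "augmentation a = sum (lookup a) S" if "finite S" "keys a \<subseteq> S"
    for S and a :: "'a \<Rightarrow>\<^sub>0 'k"
    unfolding augmentation_def using that by (intro sum.mono_neutral_left) (auto simp: in_keys_iff)
  show ?thesis
    using Poly_Mapping.keys_add[of a b]
    by (subst (1 2 3) *[of "keys a \<union> keys b"]) (auto simp: lookup_add sum.distrib)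
qed

lemma augmentation_mult:
  "augmentation (a * b) = augmentation a * augmentation (b :: 'a::monoid_add \<Rightarrow>\<^sub>0 'k::semiring_0)"
proof (induction a rule: single_add_induct)
  case (single g c)
  show ?case
    by (induction b rule: single_add_induct)
      (auto simp: mult_single distrib_left augmentation_add)
qed (simp add: distrib_right augmentation_add)

lemma augmentation_zero [simp]: "augmentation 0 = 0"
  by (simp add: augmentation_def)

lemma augmentation_diff:
  "augmentation (a - b) = augmentation a - augmentation (b :: 'a \<Rightarrow>\<^sub>0 'k::ab_group_add)"
  using augmentation_add[of "a - b" b] by (simp add: algebra_simps)

lemma presents_trivial_module:
  "presents (augmentation :: ('f::field sl2 \<Rightarrow>\<^sub>0 'k::field) \<Rightarrow> 'k) trivial_module"
proof -
  have "c \<in> range (augmentation :: ('f sl2 \<Rightarrow>\<^sub>0 'k) \<Rightarrow> 'k)" for c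
    by (rule range_eqI[of _ _ "scalar c"]) simp
  thus ?thesis
    unfolding presents_def trivial_module_def one_dim_module_simps one_dim_module_smult
    by (auto simp: augmentation_add augmentation_mult augmentation_def[symmetric])
qed

lemma ann_augmentation: "ann augmentation = {a. augmentation a = 0}"
  by (simp add: ann_def)

lemma maximal_ann_augmentation:
  "maximal_left_ideal (ann (augmentation :: ('f::field sl2 \<Rightarrow>\<^sub>0 'k::field) \<Rightarrow> 'k))"
  unfolding maximal_left_ideal_def
proof (intro conjI allI impI left_ideal_ann[OF presents_trivial_module])
  show "1 \<notin> ann (augmentation :: ('f sl2 \<Rightarrow>\<^sub>0 'k) \<Rightarrow> 'k)"
    using augmentation_single[of "0::'f sl2" "1::'k"] by (simp add: ann_augmentation)
  fix L :: "('f sl2 \<Rightarrow>\<^sub>0 'k) set"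
  assume L: "left_ideal L \<and> ann augmentation \<subset> L"
  then obtain a where a: "a \<in> L" "augmentation a \<noteq> 0" by (auto simp: ann_augmentation)
  have "a - scalar (augmentation a) \<in> ann augmentation"
    by (simp add: ann_augmentation augmentation_diff)
  hence "a - scalar (augmentation a) \<in> L" using L by blast
  hence "scalar (augmentation a) * 1 \<in> L"
    using L left_ideal_cong[of L a "scalar (augmentation a)"] a(1) by simp
  thus "1 \<in> L" using in_left_ideal_single_cancel[of L] L a(2) by blast
qed

lemma ann_augmentation_subset:
  fixes L :: "('f::field sl2 \<Rightarrow>\<^sub>0 'k::field) set"
  assumes "left_ideal L" "\<And>g. point g - 1 \<in> L"
  shows "ann augmentation \<subseteq> L"
proof
  note L = left_idealD[OF assms(1)]
  fix a :: "'f sl2 \<Rightarrow>\<^sub>0 'k" assume a: "a \<in> ann augmentation"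
  have "a - scalar (augmentation a) \<in> L"
  proof (induction a rule: single_add_induct)
    case (single g c)
    show ?case using L(3)[OF assms(2)[of g], of "scalar c"]
      by (simp add: right_diff_distrib mult_single)
  next
    case (add a b)
    from L(2)[OF add] show ?case by (simp add: augmentation_add single_add algebra_simps)
  qed
  thus "a \<in> L" using a by (simp add: ann_augmentation)
qed

lemma borel_eval_sum: "borel_eval \<psi> (sum f S) = (\<Sum>x\<in>S. borel_eval \<psi> (f x))"
  by (induction S rule: infinite_finite_induct)
    (auto simp: borel_eval_add linear_formD(3)[OF linear_form_borel_eval])

text \<open>On the group algebra of the Borel subgroup \<open>borel_eval\<close> is multiplicative;
  this is the balancing condition needed for maps out of the tensor product.\<close>

lemma borel_eval_mult_borel:
  assumes \<psi>: "mult_char \<psi>" and r: "keys r \<subseteq> {g. entry g 2 1 = 0}"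
  shows "borel_eval \<psi> (a * r) = borel_eval \<psi> a * borel_eval \<psi> r"
proof (induction a rule: single_add_induct)
  case (single g c)
  have *: "borel_coeff \<psi> (g + h) = borel_coeff \<psi> g * borel_coeff \<psi> h" if "h \<in> keys r" for h
    using borel_coeff_mult(2)[OF \<psi>, of h g] r that by (auto simp: borel_coeff_def[of _ h])
  have "borel_eval \<psi> (single g c * r) =
    (\<Sum>h\<in>keys r. c * lookup r h * borel_coeff \<psi> (g + h))"
    by (subst poly_mapping_eq_sum_single[OF finite_keys order_refl, of r])
      (simp add: sum_distrib_left mult_single borel_eval_sum)
  also have "\<dots> = (\<Sum>h\<in>keys r. c * borel_coeff \<psi> g * (lookup r h * borel_coeff \<psi> h))"
    by (intro sum.cong refl) (simp add: * mult_ac)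
  also have "\<dots> = borel_eval \<psi> (single g c) * borel_eval \<psi> r"
    by (simp add: borel_eval_def[of _ r] sum_distrib_left)
  finally show ?case .
qed (simp add: distrib_right borel_eval_add)

lemma carrier_borel_subgroup: "carrier borel_subgroup = matrix_of ` {g. entry g 2 1 = 0}"
proof -
  have "carrier borel_subgroup = {A \<in> range matrix_of. A $ 2 $ 1 = 0}"
    unfolding range_matrix_of by (simp add: borel_subgroup_def)
  thus ?thesis by (auto simp: entry_def)
qed

lemma torus_part_matrix_of:
  assumes "entry g 2 1 = 0"
  shows "torus_part (matrix_of g) = matrix_of (diag (entry g 1 1))"
proof -
  have "matrix_of g $ 1 $ 1 \<noteq> 0" using borel_decomp(2)[OF assms] by (simp add: entry_def)
  moreover have "matrix_of g $ 1 $ 1 * matrix_of g $ 2 $ 2 = 1"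
    using entry_det[of g] assms by (simp add: entry_def)
  ultimately show ?thesis
    by (simp add: torus_part_def vec_eq_iff forall_2 matrix_of_diag_entries entry_def inverse_unique)
qed

lemma borel_module_smult:
  assumes "keys r \<subseteq> {g. entry g 2 1 = 0}"
  shows "sl2_to_mat r \<odot>\<^bsub>borel_module \<theta>\<^esub> c = borel_eval (diag_char \<theta>) r * c"
  unfolding borel_module_def one_dim_module_smult borel_eval_def
  using assms by (intro arg_cong[of _ _ "\<lambda>x. x * c"] sum.cong refl)
    (auto simp: torus_part_matrix_of borel_coeff_def diag_char_def)

lemma carrier_group_algebra_borel:
  assumes "r \<in> carrier (group_algebra borel_subgroup)"
  obtains r' where "r = sl2_to_mat r'" "keys r' \<subseteq> {g. entry g 2 1 = 0}"
  using assms push_onto[of r matrix_of "{g. entry g 2 1 = 0}"] by (auto simp: carrier_borel_subgroup)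

lemma sl2_to_mat_in_borel:
  "keys r \<subseteq> {g. entry g 2 1 = 0} \<Longrightarrow> sl2_to_mat r \<in> carrier (group_algebra borel_subgroup)"
  unfolding group_algebra_simps mem_Collect_eq carrier_borel_subgroup
  by (rule order_trans[OF keys_push image_mono])

lemma carrier_borel_module [simp]: "carrier (borel_module \<theta>) = UNIV"
  by (simp add: borel_module_def one_dim_module_simps)

lemma scalar_extension_borel_module:
  "scalar_extension (group_algebra SL2) (group_algebra borel_subgroup) (borel_module \<theta>)"
  by (intro scalar_extension.intro scalar_extension_axioms.intro ring_group_algebra_SL2)
    (auto simp: borel_subgroup_def)

definition induced_presentation ::
    "('f::field ^ 2 ^ 2 \<Rightarrow> 'k::field) \<Rightarrow> ('f sl2 \<Rightarrow>\<^sub>0 'k) \<Rightarrow> ('f, 'k) induced_carrier" where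
  "induced_presentation \<theta> a =
     pure_tensor (group_algebra SL2) (group_algebra borel_subgroup) (borel_module \<theta>) (sl2_to_mat a) 1"

lemma presents_induced_module:
  fixes \<theta> :: "'f::field ^ 2 ^ 2 \<Rightarrow> 'k::field"
  assumes "\<theta> \<in> linear_characters torus"
  shows "presents (induced_presentation \<theta>) (induced_module \<theta>)"
proof -
  have \<psi>: "diag_char \<theta> 1 = 1" by (rule mult_charD(1)[OF mult_char_diag_char[OF assms]])
  have "\<exists>r\<in>carrier (group_algebra borel_subgroup). n = r \<odot>\<^bsub>borel_module \<theta>\<^esub> 1" for n
    using borel_module_smult[of "scalar n" \<theta> 1] \<psi>
    by (intro bexI[of _ "sl2_to_mat (scalar n)"] sl2_to_mat_in_borel) (auto simp: borel_coeff_def)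
  hence "carrier (induced_module \<theta>) = range (induced_presentation \<theta>)"
    using scalar_extension.carrier_E_cyclic[OF scalar_extension_borel_module, of 1 \<theta>]
    by (simp add: induced_module_def induced_presentation_def[abs_def] carrier_group_algebra_SL2 image_image
        del: group_algebra_simps(1))
  moreover have "induced_presentation \<theta> 0 = \<zero>\<^bsub>induced_module \<theta>\<^esub>"
    using scalar_extension.pure_tensor_zero[OF scalar_extension_borel_module, of 1 \<theta>] by (simp add: induced_module_def induced_presentation_def)
  moreover have "induced_presentation \<theta> (a + b) = induced_presentation \<theta> a \<oplus>\<^bsub>induced_module \<theta>\<^esub> induced_presentation \<theta> b" for a b
    using scalar_extension.pure_tensor_add_left[OF scalar_extension_borel_module sl2_to_mat_in_carrier sl2_to_mat_in_carrier, of 1 \<theta> a b]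
    by (simp add: induced_module_def induced_presentation_def push_add)
  moreover have "induced_presentation \<theta> (a * b) = sl2_to_mat a \<odot>\<^bsub>induced_module \<theta>\<^esub> induced_presentation \<theta> b" for a b
    unfolding induced_module_def induced_presentation_def
    by (simp only: scalar_extension.smult_pure_tensor[OF scalar_extension_borel_module sl2_to_mat_in_carrier] sl2_to_mat_mult)
  ultimately show ?thesis unfolding presents_def by blast
qed

text \<open>The generator spans a line stable under the Borel subgroup, so the universal property
  gives one inclusion. For the other, balanced maps built from \<open>borel_eval\<close> detect
  every element outside \<open>induced_ann\<close>.\<close>

lemma ann_induced_presentation:
  fixes \<theta> :: "'f::field ^ 2 ^ 2 \<Rightarrow> 'k::field"
  assumes "\<theta> \<in> linear_characters torus"
  shows "ann (induced_presentation \<theta>) = induced_ann (diag_char \<theta>)"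
proof
  let ?A = "group_algebra SL2 :: ('f ^ 2 ^ 2 \<Rightarrow>\<^sub>0 'k) ring"
  let ?B = "group_algebra borel_subgroup :: ('f ^ 2 ^ 2 \<Rightarrow>\<^sub>0 'k) ring"
  let ?\<psi> = "diag_char \<theta>" and ?\<pi> = "induced_presentation \<theta>"
  have \<psi>: "mult_char ?\<psi>" by (rule mult_char_diag_char[OF assms])
  have pres: "presents ?\<pi> (induced_module \<theta>)" by (rule presents_induced_module[OF assms])
  have b: "?\<pi> r = pure_tensor ?A ?B (borel_module \<theta>) \<one>\<^bsub>?A\<^esub> (borel_eval ?\<psi> r)"
    if r: "keys r \<subseteq> {g. entry g 2 1 = 0}" for r
  proof -
    have "sl2_to_mat r = \<one>\<^bsub>?A\<^esub> \<otimes>\<^bsub>?A\<^esub> sl2_to_mat r"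
      unfolding sl2_to_mat_one[symmetric] sl2_to_mat_mult[symmetric] by simp
    hence "?\<pi> r = pure_tensor ?A ?B (borel_module \<theta>) \<one>\<^bsub>?A\<^esub> (sl2_to_mat r \<odot>\<^bsub>borel_module \<theta>\<^esub> 1)"
      unfolding induced_presentation_def
      using scalar_extension.pure_tensor_balanced[OF scalar_extension_borel_module sl2_to_mat_in_carrier[of 1] sl2_to_mat_in_borel[OF r], of 1 \<theta>]
      unfolding sl2_to_mat_one by simp
    thus ?thesis by (simp add: borel_module_smult[OF r])
  qed
  have b': "point g - scalar (?\<psi> (entry g 1 1)) \<in> ann ?\<pi>" if "entry g 2 1 = 0" for g
    unfolding presented_diff_eq_0[OF pres]
    using b[of "point g"] b[of "scalar (?\<psi> (entry g 1 1))"] that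
    by (simp add: borel_coeff_def mult_charD(1)[OF \<psi>])
  have "borel_stable ?\<psi> (ann ?\<pi>)"
    unfolding borel_stable_def
  proof (intro conjI allI impI left_ideal_ann[OF pres])
    show "point (upper x) - 1 \<in> ann ?\<pi>" for x
      using b'[of "upper x"] by (simp add: mult_charD(1)[OF \<psi>])
    show "point (diag t) - scalar (?\<psi> t) \<in> ann ?\<pi>" if "t \<noteq> 0" for t
      using b'[of "diag t"] that by simp
  qed
  from induced_ann_subset[OF \<psi> this] show "induced_ann ?\<psi> \<subseteq> ann ?\<pi>" .
  show "ann ?\<pi> \<subseteq> induced_ann ?\<psi>"
  proof
    fix a assume "a \<in> ann ?\<pi>"
    hence a: "pure_tensor ?A ?B (borel_module \<theta>) (sl2_to_mat a) 1 = \<zero>\<^bsub>extend_scalars ?A ?B (borel_module \<theta>)\<^esub>"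
      using presentsD(2)[OF pres] by (simp add: ann_def induced_presentation_def induced_module_def)
    \<comment> \<open>The balanced map has to be defined on matrix-indexed functions, so
      \<open>sl2_to_mat\<close> is inverted.\<close>
    let ?x = "inv_into UNIV sl2_to_mat :: _ \<Rightarrow> 'f sl2 \<Rightarrow>\<^sub>0 'k"
    have x: "?x (sl2_to_mat c) = c" for c :: "'f sl2 \<Rightarrow>\<^sub>0 'k"
      by (rule inv_into_f_f) (auto intro: injI simp: sl2_to_mat_inject)
    have exA: "\<exists>c'. c = sl2_to_mat c'" if "c \<in> carrier ?A" for c
      using that carrier_group_algebra_SL2 by blast
    have "borel_eval ?\<psi> (r * a) = 0" for r
    proof -
      define f where "f c n = borel_eval ?\<psi> (r * ?x c) * n" for c n
      have "f (sl2_to_mat a) 1 = 0"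
      proof (rule scalar_extension.pure_tensor_eq_0_imp[OF scalar_extension_borel_module a])
        fix c d n assume "c \<in> carrier ?A" "d \<in> carrier ?A"
        then obtain c' d' where "c = sl2_to_mat c'" "d = sl2_to_mat d'" using exA by metis
        thus "f (c \<oplus>\<^bsub>?A\<^esub> d) n = f c n + f d n"
          by (simp add: f_def x distrib_left distrib_right borel_eval_add push_add[symmetric])
      next
        fix c n m
        show "f c (n \<oplus>\<^bsub>borel_module \<theta>\<^esub> m) = f c n + f c m"
          by (simp add: f_def borel_module_def one_dim_module_simps distrib_left)
      next
        fix c b n assume "c \<in> carrier ?A" "b \<in> carrier ?B"
        then obtain c' b' where *: "c = sl2_to_mat c'" "b = sl2_to_mat b'" "keys b' \<subseteq> {g. entry g 2 1 = 0}"
          using exA carrier_group_algebra_borel by metis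
        show "f (c \<otimes>\<^bsub>?A\<^esub> b) n = f c (b \<odot>\<^bsub>borel_module \<theta>\<^esub> n)"
          unfolding * sl2_to_mat_mult[symmetric] f_def x borel_module_smult[OF *(3)]
          by (simp add: mult.assoc[symmetric] borel_eval_mult_borel[OF \<psi> *(3)])
      qed
      thus ?thesis by (simp add: f_def x)
    qed
    thus "a \<in> induced_ann ?\<psi>" by (simp add: induced_ann_def form_kernel_def)
  qed
qed

lemma matrix_of_weyl: "matrix_of weyl = weyl_s"
  by (simp add: weyl.rep_eq)

lemma carrier_unipotent: "carrier unipotent = matrix_of ` range upper"
proof -
  have "carrier unipotent = {A \<in> range matrix_of. A $ 1 $ 1 = 1 \<and> A $ 2 $ 2 = 1 \<and> A $ 2 $ 1 = 0}"
    unfolding range_matrix_of by (simp add: unipotent_def)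
  also have "\<dots> = matrix_of ` {g. entry g 1 1 = 1 \<and> entry g 2 2 = 1 \<and> entry g 2 1 = 0}"
    by (auto simp: entry_def)
  also have "{g. entry g 1 1 = 1 \<and> entry g 2 2 = 1 \<and> entry g 2 1 = 0} = range upper"
    by (auto simp: sl2_eq_iff)
  finally show ?thesis .
qed

definition steinberg_presentation :: "('f::field sl2 \<Rightarrow>\<^sub>0 'k::field) \<Rightarrow> ('f, 'k) induced_carrier" where
  "steinberg_presentation a = induced_presentation trivial_character (a * (1 - point weyl))"

lemma ann_induced_trivial:
  "ann (induced_presentation trivial_character) = induced_ann (\<lambda>_. 1)"
  using ann_induced_presentation[OF trivial_character_linear] by (simp add: diag_char_trivial)

lemma ann_steinberg_presentation: "ann steinberg_presentation = steinberg_ann"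
  unfolding steinberg_ann_def colon_def ann_induced_trivial[symmetric]
  by (simp add: ann_def steinberg_presentation_def)

lemma presents_steinberg_module:
  "presents steinberg_presentation (steinberg_module :: ('f::field ^ 2 ^ 2 \<Rightarrow>\<^sub>0 'k::field, ('f, 'k) induced_carrier) module)"
proof -
  let ?\<pi> = "induced_presentation trivial_character :: ('f sl2 \<Rightarrow>\<^sub>0 'k) \<Rightarrow> _"
  let ?M = "induced_module trivial_character :: ('f ^ 2 ^ 2 \<Rightarrow>\<^sub>0 'k, ('f, 'k) induced_carrier) module"
  have pres: "presents ?\<pi> ?M" by (rule presents_induced_module[OF trivial_character_linear])
  note P = presentsD[OF pres]
  have "\<one>\<^bsub>group_algebra SL2\<^esub> - single weyl_s 1 = sl2_to_mat (1 - point weyl :: 'f sl2 \<Rightarrow>\<^sub>0 'k)"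
    by (simp only: push_diff sl2_to_mat_one push_single matrix_of_weyl)
  hence eta: "eta_s = ?\<pi> (1 - point weyl)"
    using P(4)[of "1 - point weyl" 1]
    by (simp add: eta_s_def one_tr_def induced_presentation_def sl2_to_mat_one del: group_algebra_simps)
  have act: "sl2_to_mat a \<odot>\<^bsub>?M\<^esub> eta_s = steinberg_presentation a" for a
    unfolding eta P(4) steinberg_presentation_def ..
  have "carrier (steinberg_module :: ('f ^ 2 ^ 2 \<Rightarrow>\<^sub>0 'k, ('f, 'k) induced_carrier) module) =
      range (\<lambda>w. steinberg_presentation (upper_alg w))"
  proof (intro equalityI subsetI)
    fix x :: "('f, 'k) induced_carrier"
    assume "x \<in> carrier steinberg_module"
    then obtain a where a: "keys a \<subseteq> carrier unipotent" "x = a \<odot>\<^bsub>?M\<^esub> eta_s"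
      by (auto simp: steinberg_module_def)
    obtain b where b: "a = sl2_to_mat b" "keys b \<subseteq> range upper"
      using push_onto a(1) unfolding carrier_unipotent by blast
    obtain w where "b = upper_alg w" using push_onto[OF b(2)] by blast
    thus "x \<in> range (\<lambda>w. steinberg_presentation (upper_alg w))" using a(2) b(1) act by auto
  next
    fix x :: "('f, 'k) induced_carrier"
    assume "x \<in> range (\<lambda>w. steinberg_presentation (upper_alg w))"
    then obtain w where x: "x = sl2_to_mat (upper_alg w) \<odot>\<^bsub>?M\<^esub> eta_s" using act by auto
    have "keys (sl2_to_mat (upper_alg w)) \<subseteq> carrier unipotent"
      using keys_push[of matrix_of "upper_alg w"] keys_push[of upper w] unfolding carrier_unipotent by blast
    thus "x \<in> carrier steinberg_module" by (auto simp: x steinberg_module_def)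
  qed
  \<comment> \<open>The Steinberg module is defined by the action of \<open>U\<close> only;
    \<open>mod_steinberg\<close> shows that the whole group algebra yields nothing more.\<close>
  also have "\<dots> = range steinberg_presentation"
  proof -
    have "\<exists>w. steinberg_presentation a = steinberg_presentation (upper_alg w)" for a :: "'f sl2 \<Rightarrow>\<^sub>0 'k"
    proof -
      obtain w where "a - upper_alg w \<in> steinberg_ann" using mod_steinberg by blast
      hence "?\<pi> (a * (1 - point weyl)) = ?\<pi> (upper_alg w * (1 - point weyl))"
        unfolding presented_diff_eq_0[OF pres, symmetric] left_diff_distrib[symmetric] ann_induced_trivial
        by (simp add: steinberg_ann_def colon_def)
      thus ?thesis by (auto simp: steinberg_presentation_def)
    qed
    thus ?thesis by blast
  qed
  finally show ?thesis
    using P(2,3,4)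
    by (simp add: presents_def steinberg_module_def steinberg_presentation_def distrib_right mult.assoc)
qed

lemma (in locally_finite_fields) simple_induced_module:
  fixes \<theta> :: "'f ^ 2 ^ 2 \<Rightarrow> 'k"
  assumes "\<theta> \<in> linear_characters torus" "\<theta> \<noteq> trivial_character"
  shows "maximal_left_ideal (ann (induced_presentation \<theta>))"
    "simple_module (group_algebra SL2) (induced_module \<theta>)" "admits_T_stable_lines (induced_module \<theta>)"
proof -
  have \<psi>: "mult_char (diag_char \<theta>)" by (rule mult_char_diag_char[OF assms(1)])
  note ker = ann_induced_presentation[OF assms(1)]
  obtain t where "t \<noteq> 0" "diag_char \<theta> t \<noteq> 1" by (rule diag_char_nontrivial[OF assms])
  thus max: "maximal_left_ideal (ann (induced_presentation \<theta>))"
    unfolding ker by (rule maximal_induced_ann[OF \<psi>])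
  show "simple_module (group_algebra SL2) (induced_module \<theta>)"
    by (rule simple_module_presented[OF presents_induced_module[OF assms(1)] max])
  show "admits_T_stable_lines (induced_module \<theta>)"
    using borel_stableD(3)[OF borel_stable_induced_ann[OF \<psi>], of _ 1] one_notin_induced_ann[OF \<psi>]
    by (intro admits_T_stable_linesI[OF presents_induced_module[OF assms(1)] _ assms(1)]) (simp_all add: ker)
qed

lemma (in locally_finite_fields) simple_steinberg_module:
  fixes M :: "('f ^ 2 ^ 2 \<Rightarrow>\<^sub>0 'k, ('f, 'k) induced_carrier) module"
  defines "M \<equiv> steinberg_module"
  shows "simple_module (group_algebra SL2) M" "admits_T_stable_lines M"
proof -
  note pres = presents_steinberg_module[where ?'f = 'f and ?'k = 'k, folded M_def]
  have max: "maximal_left_ideal (ann (steinberg_presentation :: ('f sl2 \<Rightarrow>\<^sub>0 'k) \<Rightarrow> _))"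
    unfolding ann_steinberg_presentation by (rule maximal_steinberg_ann)
  show "simple_module (group_algebra SL2) M" by (rule simple_module_presented[OF pres max])
  show "admits_T_stable_lines M"
    using max diag_minus_one_in_steinberg_ann
    by (intro admits_T_stable_linesI[OF pres _ trivial_character_linear])
      (simp_all add: ann_steinberg_presentation diag_char_trivial maximal_left_ideal_def)
qed

lemma simple_trivial_module:
  fixes M :: "('f::field ^ 2 ^ 2 \<Rightarrow>\<^sub>0 'k::field, 'k) module"
  defines "M \<equiv> trivial_module"
  shows "simple_module (group_algebra SL2) M" "admits_T_stable_lines M"
proof -
  note pres = presents_trivial_module[where ?'f = 'f and ?'k = 'k, folded M_def]
  show "simple_module (group_algebra SL2) M"
    by (rule simple_module_presented[OF pres maximal_ann_augmentation])
  show "admits_T_stable_lines M"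
    using maximal_ann_augmentation[where ?'f = 'f and ?'k = 'k]
    by (intro admits_T_stable_linesI[OF pres _ trivial_character_linear])
      (simp_all add: ann_augmentation diag_char_trivial augmentation_diff maximal_left_ideal_def del: single_one)
qed

lemma (in locally_finite_fields) simple_module_cases:
  fixes M :: "('f ^ 2 ^ 2 \<Rightarrow>\<^sub>0 'k, 'm) module"
  assumes "simple_module (group_algebra SL2) M" "admits_T_stable_lines M"
  shows "module_isomorphic (group_algebra SL2) M trivial_module \<or>
    module_isomorphic (group_algebra SL2) M steinberg_module \<or>
    (\<exists>\<theta>. \<theta> \<in> linear_characters torus \<and> \<theta> \<noteq> trivial_character \<and>
       module_isomorphic (group_algebra SL2) M (induced_module \<theta>))"
proof -
  obtain \<pi> \<theta> where pres: "presents \<pi> M" and max: "maximal_left_ideal (ann \<pi>)"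
    and \<theta>: "\<theta> \<in> linear_characters torus"
    and w: "\<And>t. t \<noteq> 0 \<Longrightarrow> point (diag t) - scalar (diag_char \<theta> t) \<in> ann \<pi>"
    using admits_T_stable_linesE[OF assms] by metis
  interpret torus_eigenvector ff kk "ann \<pi>" "diag_char \<theta>"
    by unfold_locales (use max w mult_char_diag_char[OF \<theta>] in auto)
  show ?thesis
  proof (cases rule: eigenvector_cases)
    case trivial
    have "colon (ann augmentation) 1 \<subseteq> colon (ann \<pi>) 1"
      using ann_augmentation_subset[OF left_ideal trivial] by (simp add: colon_def subset_iff)
    moreover have "1 \<notin> ann (augmentation :: ('f sl2 \<Rightarrow>\<^sub>0 'k) \<Rightarrow> 'k)"
      using maximal_ann_augmentation by (auto simp: maximal_left_ideal_def)
    ultimately show ?thesis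
      using module_isomorphic_colon[OF pres max one_notin presents_trivial_module maximal_ann_augmentation] by blast
  next
    case (steinberg y z)
    thus ?thesis
      using module_isomorphic_colon[OF pres max steinberg(1) presents_steinberg_module, of z] maximal_steinberg_ann
      by (simp add: ann_steinberg_presentation)
  next
    case (induced \<psi>' x y z)
    \<comment> \<open>Back from a function on the field to a normalised character of matrices. The
      two agree only away from \<open>0\<close>, which is enough by
      \<open>induced_ann_cong\<close>.\<close>
    let ?\<theta> = "torus_char \<psi>'"
    have \<theta>': "?\<theta> \<in> linear_characters torus" by (rule torus_char_linear[OF induced(1)])
    have "diag_char ?\<theta> x \<noteq> 1" using induced(2,3) by (simp add: diag_char_torus_char)
    hence nt: "?\<theta> \<noteq> trivial_character" by (auto simp: diag_char_trivial)
    have "induced_ann (diag_char ?\<theta>) = induced_ann \<psi>'"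
      by (intro induced_ann_cong diag_char_torus_char)
    hence "module_isomorphic (group_algebra SL2) M (induced_module ?\<theta>)"
      using module_isomorphic_colon[OF pres max induced(4) presents_induced_module[OF \<theta>']
          simple_induced_module(1)[OF \<theta>' nt], of z] induced(5,6)
      by (simp add: ann_induced_presentation[OF \<theta>'])
    thus ?thesis using \<theta>' nt by blast
  qed
qed

theorem theorem1p1:
  assumes "CHAR('k::alg_closed_field) \<noteq> 2"
    and "CHAR('k) \<noteq> CARD('p::prime_card)"
  shows
    "(simple_module (group_algebra SL2)
        (trivial_module :: ('p Fp_closure ^ 2 ^ 2 \<Rightarrow>\<^sub>0 'k, 'k) module) \<and>
      admits_T_stable_lines
        (trivial_module :: ('p Fp_closure ^ 2 ^ 2 \<Rightarrow>\<^sub>0 'k, 'k) module)) \<and>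
     (simple_module (group_algebra SL2)
        (steinberg_module ::
          ('p Fp_closure ^ 2 ^ 2 \<Rightarrow>\<^sub>0 'k, ('p Fp_closure, 'k) induced_carrier) module) \<and>
      admits_T_stable_lines
        (steinberg_module ::
          ('p Fp_closure ^ 2 ^ 2 \<Rightarrow>\<^sub>0 'k, ('p Fp_closure, 'k) induced_carrier) module)) \<and>
     (\<forall>\<theta> :: 'p Fp_closure ^ 2 ^ 2 \<Rightarrow> 'k.
        \<theta> \<in> linear_characters torus \<and> \<theta> \<noteq> trivial_character \<longrightarrow>
          simple_module (group_algebra SL2) (induced_module \<theta>) \<and>
          admits_T_stable_lines (induced_module \<theta>)) \<and>
     (\<forall>M :: ('p Fp_closure ^ 2 ^ 2 \<Rightarrow>\<^sub>0 'k, 'm) module.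
        simple_module (group_algebra SL2) M \<and> admits_T_stable_lines M \<longrightarrow>
          module_isomorphic (group_algebra SL2) M trivial_module \<or>
          module_isomorphic (group_algebra SL2) M steinberg_module \<or>
          (\<exists>\<theta>. \<theta> \<in> linear_characters torus \<and> \<theta> \<noteq> trivial_character \<and>
             module_isomorphic (group_algebra SL2) M (induced_module \<theta>)))"
proof -
  interpret locally_finite_fields "TYPE('p Fp_closure)" "TYPE('k)"
    by (rule locally_finite_Fp_closure) (rule assms(2))
  show ?thesis
    using simple_trivial_module simple_steinberg_module simple_induced_module(2,3) simple_module_cases by blast
qed

end
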